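(* Let $r\ge 2$, let $K=GL_2^r$ (put $\ell=r$) or $K=S(GL_2^r)$ (put $\ell=r-1$), and let $z\in\mathbb{Z}^\ell$, $s\in\mathbb{N}^r$, $n\in\mathbb{N}^r$. If $\dim\mathrm{Hom}_K(F_{z,s},\mathcal{H}_n)>0$, then $$\dim\mathrm{Hom}_K(F_{z,s},\mathcal{H}_n)=\#\left\{m\in\mathbb{N}^r\ :\ m\in\partial_eP_n\cap\partial_{-e}Q_s,\ \ m_i\equiv n_i \pmod 2\ \ \forall i\in[r]\right\}.$$
   Context: The ground field is $\mathbb{C}$, $\mathbb{N}=\{0,1,2,\dots\}$, $[r]=\{1,\dots,r\}$, indices are read mod $r$ with representatives in $[r]$ (so $x_0=x_r$, $g_{r+1}=g_1$). Let $e=(1,\dots,1)$. Groups and action: $GL_2=GL_2(\mathbb{C})$, $SL_2=SL_2(\mathbb{C})$; $S(GL_2^r)=\{(g_1,\dots,g_r)\in GL_2^r:\prod_j\det g_j=1\}$. $V=\bigoplus_{i\in[r]}M_i$ with $M_i\cong\mathrm{Hom}(\mathbb{C}^2,\mathbb{C}^2)$, and $g=(g_1,\dots,g_r)\in K$ acts on $(X_1,\dots,X_r)\in V$ by $X_i\mapsto g_iX_ig_{i+1}^{-1}$. $K$ acts on $\mathbb{C}[V]$ by $(gf)(x)=f(g^{-1}x)$. For $n\in\mathbb{N}^r$, $\mathbb{C}[V]_n$ is the space of polynomials homogeneous of degree $n_i$ in the coordinates of $M_i$ for each $i$. Harmonics: $\mathcal{H}=\{f\in\mathbb{C}[V]:\Delta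 f=0$ for every $K$-invariant constant-coefficient differential operator $\Delta\in\mathrm{Sym}(V)$ without constant term$\}$, and $\mathcal{H}_n=\mathcal{H}\cap\mathbb{C}[V]_n$. Representations: $\mathbb{C}_k$ is the representation of $\mathbb{C}^\times$ with $w$ acting by $w^k$; $F_k=\mathrm{Sym}^k(\mathbb{C}^2)$ as an $SL_2$-representation; $F_{z,s}=\mathbb{C}_{z_1}\otimes\cdots\otimes\mathbb{C}_{z_\ell}\otimes F_{s_1}\otimes\cdots\otimes F_{s_r}$ is the outer tensor product representation of $\widetilde K=(\mathbb{C}^\times)^\ell\times SL_2^r$. The surjection $\varphi:\widetilde K\to K$ is $(w_1,\dots,w_r,g_1,\dots,g_r)\mapsto(w_1g_1,\dots,w_rg_r)$ if $K=GL_2^r$, and $(w_1,\dots,w_{r-1},g_1,\dots,g_r)\mapsto(w_1g_1,\dots,w_{r-1}g_{r-1},w_1^{-1}\cdots w_{r-1}^{-1}g_r)$ if $K=S(GL_2^r)$. Representations of $K$ are viewed as representations of $\widetilde K$ via $\varphi$, and $F_{z,s}$ is a representation of $K$ when $\ker\varphi$ acts trivially on it. $\mathrm{Hom}_K(F_{z,s},\mathcal{H}_n)$ is the space of intertwining maps (equivalently of $\widetilde K$-intertwining maps), so its dimension is the multiplicity of $F_{z,s}$ in $\mathcal{H}_n$. Polyhedra: $P_n=\{x\in\mathbb{R}^r: x_i\le n_i\ \forall i\in[r]\}$; $Q_s=\{x\in\mathbb{R}^r: x_{i-1}+x_i-s_i\ge0,\ x_{i-1}-x_i+s_i\ge0,\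 -x_{i-1}+x_i+s_i\ge0\ \ \forall i\in[r]\}$. For a polyhedron $P$ and $v\in\mathbb{R}^r$, $\partial_vP$ denotes the union of faces of $P$ for which movement by any positive amount in direction $v$ leaves $P$; explicitly $\partial_eP_n=\bigcup_{i\in[r]}\{x\in P_n:x_i=n_i\}$ and $\partial_{-e}Q_s=\bigcup_{i\in[r]}\{x\in Q_s:x_{i-1}+x_i=s_i\}$. *)

theory Defs
  imports
    "HOL-Analysis.Analysis"
    "HOL-Computational_Algebra.Polynomial"
    "HOL-Number_Theory.Cong"
    "HOL-Library.FuncSet"
    "HOL-Library.Function_Algebras"
begin

text \<open>Indices run over \<open>{1..r}\<close> and are read cyclically.\<close>

definition nxt :: "nat \<Rightarrow> nat \<Rightarrow> nat" where
  "nxt r i = (if i = r then 1 else i + 1)"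

definition prv :: "nat \<Rightarrow> nat \<Rightarrow> nat" where
  "prv r i = (if i = 1 then r else i - 1)"

text \<open>
  Pointwise scalar multiplication on complex-valued functions, and on maps into such functions;
  the additive structure is the pointwise one of \<^theory>\<open>HOL-Library.Function_Algebras\<close>.
\<close>

definition fscale :: "complex \<Rightarrow> ('a \<Rightarrow> complex) \<Rightarrow> ('a \<Rightarrow> complex)" where
  "fscale c f = (\<lambda>x. c * f x)"

definition hscale :: "complex \<Rightarrow> ('b \<Rightarrow> 'a \<Rightarrow> complex) \<Rightarrow> ('b \<Rightarrow> 'a \<Rightarrow> complex)" where
  "hscale c T = (\<lambda>u. fscale c (T u))"

lemma vector_space_fscale: "vector_space fscale"
  by unfold_locales (auto simp: fscale_def fun_eq_iff algebra_simps)

lemma vector_space_hscale: "vector_space hscale"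
  by unfold_locales (auto simp: hscale_def fscale_def fun_eq_iff algebra_simps)


text \<open>
  Tuples \<open>(X\<^sub>1, \<dots>, X\<^sub>r)\<close> of matrices are functions on \<^typ>\<open>nat\<close>; only the
  values at \<open>1, \<dots>, r\<close> are ever relevant.
\<close>

type_synonym tuple = "nat \<Rightarrow> complex^2^2"

datatype group_type = GL_power | S_GL_power

fun ell :: "group_type \<Rightarrow> nat \<Rightarrow> nat" where
  "ell GL_power r = r"
| "ell S_GL_power r = r - 1"

fun K_grp :: "group_type \<Rightarrow> nat \<Rightarrow> tuple set" where
  "K_grp GL_power r = {g. \<forall>i\<in>{1..r}. invertible (g i)}"
| "K_grp S_GL_power r = {g. (\<forall>i\<in>{1..r}. invertible (g i)) \<and> (\<Prod>i\<in>{1..r}. det (g i)) = 1}"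

definition inv_tuple :: "tuple \<Rightarrow> tuple" where
  "inv_tuple g = (\<lambda>i. matrix_inv (g i))"

definition act_V :: "nat \<Rightarrow> tuple \<Rightarrow> tuple \<Rightarrow> tuple" where
  "act_V r g x = (\<lambda>i. g i ** x i ** matrix_inv (g (nxt r i)))"

definition act :: "nat \<Rightarrow> tuple \<Rightarrow> (tuple \<Rightarrow> complex) \<Rightarrow> (tuple \<Rightarrow> complex)" where
  "act r g f = (\<lambda>x. f (act_V r (inv_tuple g) x))"


text \<open>
  Polynomials on \<open>V\<close> are treated as polynomial functions. The exponent of the coordinate
  \<open>(X\<^sub>i)\<^sub>a\<^sub>b\<close> in a monomial is \<open>\<alpha> i a b\<close>.
\<close>

definition monomial_fun :: "nat \<Rightarrow> (nat \<Rightarrow> 2 \<Rightarrow> 2 \<Rightarrow> nat) \<Rightarrow> tuple \<Rightarrow> complex" where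
  "monomial_fun r \<alpha> = (\<lambda>x. \<Prod>i\<in>{1..r}. \<Prod>a\<in>UNIV. \<Prod>b\<in>UNIV. (x i $ a $ b) ^ \<alpha> i a b)"

definition CV :: "nat \<Rightarrow> (tuple \<Rightarrow> complex) set" where
  "CV r = module.span fscale (range (monomial_fun r))"

definition CV_deg :: "nat \<Rightarrow> (nat \<Rightarrow> nat) \<Rightarrow> (tuple \<Rightarrow> complex) set" where
  "CV_deg r n = module.span fscale
     (monomial_fun r ` {\<alpha>. \<forall>i\<in>{1..r}. (\<Sum>a\<in>UNIV. \<Sum>b\<in>UNIV. \<alpha> i a b) = n i})"

definition dir_deriv :: "tuple \<Rightarrow> (tuple \<Rightarrow> complex) \<Rightarrow> (tuple \<Rightarrow> complex)" where
  "dir_deriv v f = (\<lambda>x. deriv (\<lambda>t::complex. f (\<lambda>i. \<chi> a b. x i $ a $ b + t * v i $ a $ b)) 0)"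

text \<open>
  \<open>v \<in> V\<close> acts on \<open>\<complex>[V]\<close> as the directional derivative along \<open>v\<close>, so the constant-coefficient
  differential operators without constant term are the non-unital algebra generated by these,
  that is, the image of the augmentation ideal of \<open>Sym(V)\<close>.
\<close>

inductive_set Sym_plus :: "((tuple \<Rightarrow> complex) \<Rightarrow> (tuple \<Rightarrow> complex)) set" where
  deriv: "dir_deriv v \<in> Sym_plus"
| add: "D \<in> Sym_plus \<Longrightarrow> E \<in> Sym_plus \<Longrightarrow> (\<lambda>f. D f + E f) \<in> Sym_plus"
| scale: "D \<in> Sym_plus \<Longrightarrow> (\<lambda>f. fscale c (D f)) \<in> Sym_plus"
| mult: "D \<in> Sym_plus \<Longrightarrow> E \<in> Sym_plus \<Longrightarrow> D \<circ> E \<in> Sym_plus"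

text \<open>
  The action of \<open>g\<close> on \<open>Sym(V)\<close> is conjugation by \<open>g\<close> on operators, because
  \<open>g \<circ> \<partial>\<^sub>v \<circ> g\<^sup>-\<^sup>1\<close> is the derivative along \<open>g v\<close>. Operators are compared on \<open>\<complex>[V]\<close> only.
\<close>

definition K_invariant ::
  "group_type \<Rightarrow> nat \<Rightarrow> ((tuple \<Rightarrow> complex) \<Rightarrow> (tuple \<Rightarrow> complex)) \<Rightarrow> bool" where
  "K_invariant G r D \<longleftrightarrow>
     (\<forall>g\<in>K_grp G r. \<forall>f\<in>CV r. act r g (D (act r (inv_tuple g) f)) = D f)"

definition Harm :: "group_type \<Rightarrow> nat \<Rightarrow> (tuple \<Rightarrow> complex) set" where
  "Harm G r = {f \<in> CV r. \<forall>D\<in>Sym_plus. K_invariant G r D \<longrightarrow> D f = 0}"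

definition Harm_deg :: "group_type \<Rightarrow> nat \<Rightarrow> (nat \<Rightarrow> nat) \<Rightarrow> (tuple \<Rightarrow> complex) set" where
  "Harm_deg G r n = Harm G r \<inter> CV_deg r n"


definition K_tilde :: "group_type \<Rightarrow> nat \<Rightarrow> ((nat \<Rightarrow> complex) \<times> tuple) set" where
  "K_tilde G r = {(w, g). (\<forall>j\<in>{1..ell G r}. w j \<noteq> 0) \<and> (\<forall>i\<in>{1..r}. det (g i) = 1)}"

fun phi :: "group_type \<Rightarrow> nat \<Rightarrow> (nat \<Rightarrow> complex) \<times> tuple \<Rightarrow> tuple" where
  "phi GL_power r (w, g) = (\<lambda>i. mat (w i) ** g i)"
| "phi S_GL_power r (w, g) =
     (\<lambda>i. mat (if i = r then (\<Prod>j\<in>{1..r-1}. inverse (w j)) else w i) ** g i)"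

text \<open>
  \<open>sym_pow k g\<close> is the matrix of \<open>g\<close> acting on \<open>Sym\<^sup>k(\<complex>\<^sup>2)\<close> in the basis \<open>e\<^sub>1\<^sup>k\<^sup>-\<^sup>a e\<^sub>2\<^sup>a\<close>
  (\<open>0 \<le> a \<le> k\<close>): the entry in row \<open>b\<close>, column \<open>a\<close> is the coefficient of
  \<open>e\<^sub>1\<^sup>k\<^sup>-\<^sup>b e\<^sub>2\<^sup>b\<close> in \<open>(g e\<^sub>1)\<^sup>k\<^sup>-\<^sup>a (g e\<^sub>2)\<^sup>a\<close>, read off after setting \<open>e\<^sub>1 = 1\<close>.
\<close>

definition sym_pow :: "nat \<Rightarrow> complex^2^2 \<Rightarrow> nat \<Rightarrow> nat \<Rightarrow> complex" where
  "sym_pow k g b a =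
     coeff ([:g $ 1 $ 1, g $ 2 $ 1:] ^ (k - a) * [:g $ 1 $ 2, g $ 2 $ 2:] ^ a) b"

text \<open>
  The tensor product of the \<open>Sym\<^bsup>s\<^sub>i\<^esup>(\<complex>\<^sup>2)\<close> is given in coordinates: its standard basis is indexed
  by \<open>tensor_index r s\<close>, a vector is its coefficient function, and a tuple of group elements acts
  by the Kronecker product of the matrices of its components.
\<close>

definition tensor_index :: "nat \<Rightarrow> (nat \<Rightarrow> nat) \<Rightarrow> (nat \<Rightarrow> nat) set" where
  "tensor_index r s = (\<Pi>\<^sub>E i\<in>{1..r}. {0..s i})"

definition F_space :: "nat \<Rightarrow> (nat \<Rightarrow> nat) \<Rightarrow> ((nat \<Rightarrow> nat) \<Rightarrow> complex) set" where
  "F_space r s = {u. \<forall>k. k \<notin> tensor_index r s \<longrightarrow> u k = 0}"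

definition F_act ::
  "group_type \<Rightarrow> nat \<Rightarrow> (nat \<Rightarrow> int) \<Rightarrow> (nat \<Rightarrow> nat) \<Rightarrow> (nat \<Rightarrow> complex) \<times> tuple
     \<Rightarrow> ((nat \<Rightarrow> nat) \<Rightarrow> complex) \<Rightarrow> ((nat \<Rightarrow> nat) \<Rightarrow> complex)" where
  "F_act G r z s = (\<lambda>(w, g) u k.
     if k \<in> tensor_index r s then
       (\<Prod>j\<in>{1..ell G r}. w j powi z j) *
       (\<Sum>l\<in>tensor_index r s. (\<Prod>i\<in>{1..r}. sym_pow (s i) (g i) (k i) (l i)) * u l)
     else 0)"

text \<open>
  The space of intertwining maps \<open>F\<^sub>z\<^sub>,\<^sub>s \<rightarrow> \<H>\<^sub>n\<close>. Maps are extended by \<open>0\<close> outside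
  \<open>F_space r s\<close> so that each is represented by exactly one function. Equivariance is required
  for the covering group, which acts on \<open>\<H>\<^sub>n\<close> through \<open>phi\<close>.
\<close>

definition Hom_K ::
  "group_type \<Rightarrow> nat \<Rightarrow> (nat \<Rightarrow> int) \<Rightarrow> (nat \<Rightarrow> nat) \<Rightarrow> (nat \<Rightarrow> nat)
     \<Rightarrow> (((nat \<Rightarrow> nat) \<Rightarrow> complex) \<Rightarrow> (tuple \<Rightarrow> complex)) set" where
  "Hom_K G r z s n = {T.
     (\<forall>u\<in>F_space r s. T u \<in> Harm_deg G r n) \<and>
     (\<forall>u\<in>F_space r s. \<forall>v\<in>F_space r s. T (u + v) = T u + T v) \<and>
     (\<forall>c. \<forall>u\<in>F_space r s. T (fscale c u) = fscale c (T u)) \<and>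
     (\<forall>h\<in>K_tilde G r. \<forall>u\<in>F_space r s. T (F_act G r z s h u) = act r (phi G r h) (T u)) \<and>
     (\<forall>u. u \<notin> F_space r s \<longrightarrow> T u = 0)}"

definition dim_Hom_K ::
  "group_type \<Rightarrow> nat \<Rightarrow> (nat \<Rightarrow> int) \<Rightarrow> (nat \<Rightarrow> nat) \<Rightarrow> (nat \<Rightarrow> nat) \<Rightarrow> nat" where
  "dim_Hom_K G r z s n = vector_space.dim hscale (Hom_K G r z s n)"


text \<open>\<open>\<real>\<^sup>r\<close> and \<open>\<nat>\<^sup>r\<close> are the extensional functions on \<open>{1..r}\<close>.\<close>

definition P_poly :: "nat \<Rightarrow> (nat \<Rightarrow> nat) \<Rightarrow> (nat \<Rightarrow> real) set" where
  "P_poly r n = {x \<in> {1..r} \<rightarrow>\<^sub>E UNIV. \<forall>i\<in>{1..r}. x i \<le> real (n i)}"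

definition Q_poly :: "nat \<Rightarrow> (nat \<Rightarrow> nat) \<Rightarrow> (nat \<Rightarrow> real) set" where
  "Q_poly r s = {x \<in> {1..r} \<rightarrow>\<^sub>E UNIV. \<forall>i\<in>{1..r}.
     x (prv r i) + x i - real (s i) \<ge> 0 \<and>
     x (prv r i) - x i + real (s i) \<ge> 0 \<and>
     - x (prv r i) + x i + real (s i) \<ge> 0}"

text \<open>
  Let \<open>\<partial>\<^sub>v\<close> of a polyhedron be the union of the faces that are left by moving any positive amount
  in direction \<open>v\<close>, and let \<open>e = (1, \<dots>, 1)\<close>. Then \<open>bd_P r n = \<partial>\<^sub>e (P_poly r n)\<close>, where each
  inequality is tightened by the movement, and \<open>bd_Q r s = \<partial>\<^bsub>-e\<^esub> (Q_poly r s)\<close>, where only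
  \<open>x\<^bsub>i-1\<^esub> + x\<^sub>i \<ge> s\<^sub>i\<close> is tightened.
\<close>

definition bd_P :: "nat \<Rightarrow> (nat \<Rightarrow> nat) \<Rightarrow> (nat \<Rightarrow> real) set" where
  "bd_P r n = (\<Union>i\<in>{1..r}. {x \<in> P_poly r n. x i = real (n i)})"

definition bd_Q :: "nat \<Rightarrow> (nat \<Rightarrow> nat) \<Rightarrow> (nat \<Rightarrow> real) set" where
  "bd_Q r s = (\<Union>i\<in>{1..r}. {x \<in> Q_poly r s. x (prv r i) + x i = real (s i)})"

end

theory Submission
  imports Defs "HOL-Library.Poly_Mapping"
begin

text \<open>An intertwining map \<open>T\<close> is the same thing as the polynomial
  \<open>T (v\<^sub>1\<^bsup>s\<^sub>1\<^esup> \<otimes> \<dots> \<otimes> v\<^sub>r\<^bsup>s\<^sub>r\<^esup>) (x)\<close> in \<open>x \<in> V\<close> and auxiliary vectors \<open>v\<^sub>i\<close>, which is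
  multihomogeneous of degree \<open>(n, s)\<close>, invariant under \<open>SL\<^sub>2\<^sup>r\<close> and harmonic in \<open>x\<close>; the scalars in
  \<open>K\<close> act through a character, and a nonzero \<open>T\<close> forces it to be the one given by \<open>z\<close>.

  The invariant differential operators are generated by those with symbols \<open>tr (X\<^sub>1 \<cdots> X\<^sub>r)\<close> and
  \<open>det (X\<^sub>1 \<cdots> X\<^sub>r)\<close>, by the dimension count below for \<open>s = 0\<close>. They are adjoint to multiplication for the Fischer inner product, so the
  harmonic invariants form the orthogonal complement of the ideal generated by these two
  polynomials, inside the spaces \<open>I n\<close> of invariants of degree \<open>(n, s)\<close>. As their leading monomials
  are coprime, they are a regular sequence, and the dimension wanted is
  \<open>dim I n - dim I (n - e) - dim I (n - 2 e) + dim I (n - 3 e)\<close>.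

  Counting weights, \<open>dim I n\<close> is the number of \<open>m \<in> P\<^sub>n \<inter> Q\<^sub>s\<close> with \<open>m \<equiv> n\<close> modulo 2. Removing
  \<open>P\<^bsub>n - 2 e\<^esub>\<close> from \<open>P\<^sub>n\<close> leaves \<open>\<partial>\<^sub>e P\<^sub>n\<close>, and by parity removing \<open>Q\<^sub>s + e\<close> from \<open>Q\<^sub>s\<close> leaves
  \<open>\<partial>\<^bsub>-e\<^esub> Q\<^sub>s\<close>, so inclusion and exclusion yields the points common to both boundaries.\<close>

section \<open>Dimensions of subspaces\<close>

text \<open>Generation of the invariants is itself a consequence of counting: for
  \<open>s = 0\<close> no harmonic invariant of positive degree is left, and orthogonal projection
  then puts every invariant of such a degree into the ideal. The Fischer inner product also stands
  in for complete reducibility. Transposing a matrix unit is taking an adjoint, so the kernel of a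
  raising operator is the orthogonal complement of the image of the lowering one, and dimensions of
  invariants become alternating sums of numbers of monomials of given weights. The obstacle is
  translation. The statement speaks of functions, group actions and operators compared only on C[V],
  while ideals, leading monomials and weights need formal polynomials. Evaluation separates
  polynomials, and transvections link the group to its Lie algebra: they generate SL_2 and move a
  point along a straight line whose velocity is given by a derivation. Positivity of the dimension
  enters twice: it identifies the character, and it makes every
  \<open>n i + n (prev i) + s i\<close> even, as an odd sum leaves no invariants at all.\<close>

definition fin_dim :: "('a::field \<Rightarrow> 'b::ab_group_add \<Rightarrow> 'b) \<Rightarrow> 'b set \<Rightarrow> bool" where
  "fin_dim scl S \<longleftrightarrow> (\<exists>B. finite B \<and> S \<subseteq> module.span scl B)"

locale vspace = V: vector_space scl
  for scl :: "'a::field \<Rightarrow> 'b::ab_group_add \<Rightarrow> 'b"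
begin

lemma fin_dim_subset: "fin_dim scl T \<Longrightarrow> S \<subseteq> T \<Longrightarrow> fin_dim scl S"
  by (auto simp: fin_dim_def)

text \<open>The subspaces below sit in infinite dimensional spaces of functions and polynomials, so
  finiteness of a basis is always drawn from \<open>fin_dim\<close>, containment in the span of a
  finite set.\<close>

lemma finite_basis_exists:
  assumes "fin_dim scl S"
  obtains B where "B \<subseteq> S" "V.independent B" "S \<subseteq> V.span B" "finite B" "card B = V.dim S"
proof -
  obtain B where B: "B \<subseteq> S" "V.independent B" "S \<subseteq> V.span B" "card B = V.dim S"
    using V.basis_exists by blast
  moreover obtain C where "finite C" "S \<subseteq> V.span C"
    using assms by (auto simp: fin_dim_def)
  with B have "finite B"
    by (meson V.independent_span_bound subset_trans)
  ultimately show ?thesis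
    using that by blast
qed

lemma dim_eq_0_iff:
  assumes "fin_dim scl S"
  shows "V.dim S = 0 \<longleftrightarrow> S \<subseteq> {0}"
proof
  assume "V.dim S = 0"
  obtain B where B: "S \<subseteq> V.span B" "finite B" "card B = V.dim S"
    using finite_basis_exists[OF assms] by metis
  with \<open>V.dim S = 0\<close> have "B = {}" by simp
  with B show "S \<subseteq> {0}" by simp
next
  assume "S \<subseteq> {0}"
  then have "S \<subseteq> V.span {}" by simp
  from V.dim_le_card[OF this] show "V.dim S = 0" by simp
qed

text \<open>The bases \<open>B\<close> and \<open>C\<close> together form a basis: in a linear
  relation the \<open>B\<close> part is minus the \<open>C\<close> part, so both lie in
  \<open>U \<inter> W\<close>.\<close>

lemma dim_direct_sum:
  assumes U: "V.subspace U" "fin_dim scl U" and W: "V.subspace W" "fin_dim scl W" and UW: "U \<inter> W \<subseteq> {0}"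
  shows "V.dim {x + y | x y. x \<in> U \<and> y \<in> W} = V.dim U + V.dim W"
proof -
  obtain B where B: "B \<subseteq> U" "V.independent B" "U \<subseteq> V.span B" "finite B" "card B = V.dim U"
    using finite_basis_exists[OF U(2)] .
  obtain C where C: "C \<subseteq> W" "V.independent C" "W \<subseteq> V.span C" "finite C" "card C = V.dim W"
    using finite_basis_exists[OF W(2)] .
  have disj: "B \<inter> C = {}"
  proof -
    have "B \<inter> C \<subseteq> {0}" using B(1) C(1) UW by blast
    moreover have "0 \<notin> B" using B(2) V.dependent_zero by blast
    ultimately show ?thesis by blast
  qed
  have ind: "V.independent (B \<union> C)"
  proof
    assume "V.dependent (B \<union> C)"
    then obtain u v where v: "v \<in> B \<union> C" "u v \<noteq> 0" and s: "(\<Sum>v\<in>B \<union> C. scl (u v) v) = 0"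
      using B(4) C(4) by (auto simp: V.dependent_finite)
    let ?b = "\<Sum>v\<in>B. scl (u v) v" and ?c = "\<Sum>v\<in>C. scl (u v) v"
    have bc: "?b + ?c = 0"
      using s by (simp add: sum.union_disjoint B(4) C(4) disj)
    have b: "?b \<in> U"
      using B(1) U(1) by (auto intro!: V.subspace_sum V.subspace_scale)
    have c: "?c \<in> W"
      using C(1) W(1) by (auto intro!: V.subspace_sum V.subspace_scale)
    have "?b = - ?c" using bc by (simp add: eq_neg_iff_add_eq_0)
    then have "?b \<in> W" using c W(1) by (simp add: V.subspace_neg)
    then have "?b = 0" using b UW by blast
    moreover from this bc have "?c = 0" by simp
    ultimately show False
      using v B(2,4) C(2,4) by (auto simp: V.dependent_finite)
  qed
  show ?thesis
  proof (rule V.dim_unique[of "B \<union> C"])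
    show "B \<union> C \<subseteq> {x + y |x y. x \<in> U \<and> y \<in> W}"
    proof
      fix z assume "z \<in> B \<union> C"
      then have "z + 0 \<in> {x + y |x y. x \<in> U \<and> y \<in> W} \<or> 0 + z \<in> {x + y |x y. x \<in> U \<and> y \<in> W}"
        using B(1) C(1) V.subspace_0[OF U(1)] V.subspace_0[OF W(1)] by blast
      then show "z \<in> {x + y |x y. x \<in> U \<and> y \<in> W}" by simp
    qed
    show "{x + y |x y. x \<in> U \<and> y \<in> W} \<subseteq> V.span (B \<union> C)"
    proof clarify
      fix x y assume "x \<in> U" "y \<in> W"
      then have "x \<in> V.span (B \<union> C)" "y \<in> V.span (B \<union> C)"
        using B(3) C(3) V.span_mono[of B "B \<union> C"] V.span_mono[of C "B \<union> C"] by blast+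
      then show "x + y \<in> V.span (B \<union> C)" by (rule V.span_add)
    qed
    show "card (B \<union> C) = V.dim U + V.dim W"
      using disj by (simp add: card_Un_disjoint B(4,5) C(4,5))
  qed (rule ind)
qed

end

context vector_space_pair
begin

lemma dim_inj_image:
  assumes lf: "Vector_Spaces.linear s1 s2 f" and fi: "inj_on f (vs1.span S)"
  shows "vs2.dim (f ` S) = vs1.dim S"
proof -
  interpret lf: Vector_Spaces.linear s1 s2 f by fact
  obtain B where B: "B \<subseteq> S" "vs1.independent B" "S \<subseteq> vs1.span B" "card B = vs1.dim S"
    using vs1.basis_exists[of S] by auto
  have "vs1.span S = vs1.span B"
    using vs1.span_mono[of B S] vs1.span_mono[of S "vs1.span B"] vs1.span_span[of B] B by auto
  moreover have "card (f ` B) = card B"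
    using fi card_image[of f B] inj_on_subset[of f "vs1.span S" B] B vs1.span_superset by auto
  ultimately show ?thesis
    by (metis B(2) B(4) fi lf.dependent_inj_imageD lf.span_image vs2.dim_eq_card_independent
        vs2.dim_span)
qed

lemma dim_inj_image_subspace:
  assumes "Vector_Spaces.linear s1 s2 f" "inj_on f S" "vs1.subspace S"
  shows "vs2.dim (f ` S) = vs1.dim S"
  using dim_inj_image[OF assms(1), of S] assms(2,3) by (metis vs1.span_eq_iff)

lemma fin_dim_image:
  assumes "Vector_Spaces.linear s1 s2 f" "fin_dim s1 S"
  shows "fin_dim s2 (f ` S)"
proof -
  interpret lf: Vector_Spaces.linear s1 s2 f by fact
  obtain B where "finite B" "S \<subseteq> vs1.span B"
    using assms(2) by (auto simp: fin_dim_def)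
  then have "finite (f ` B)" "f ` S \<subseteq> vs2.span (f ` B)"
    by (auto simp: lf.span_image)
  then show ?thesis by (auto simp: fin_dim_def)
qed

end

section \<open>Orthogonal projection in a complex inner product space\<close>

locale hermitian_space = vspace scl
  for scl :: "complex \<Rightarrow> 'b::ab_group_add \<Rightarrow> 'b" (infixr \<open>*\<^sub>C\<close> 75) +
  fixes ip :: "'b \<Rightarrow> 'b \<Rightarrow> complex"
  assumes ip_add_left: "ip (x + y) z = ip x z + ip y z"
    and ip_scale_left: "ip (c *\<^sub>C x) y = c * ip x y"
    and ip_cnj: "cnj (ip x y) = ip y x"
    and ip_nonneg: "Re (ip x x) \<ge> 0"
    and ip_definite: "ip x x = 0 \<Longrightarrow> x = 0"
begin

definition orth :: "'b set \<Rightarrow> 'b set" where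
  "orth U = {x. \<forall>y\<in>U. ip x y = 0}"

lemma ip_zero_left [simp]: "ip 0 y = 0"
  using ip_scale_left[of 0 0 y] by simp

lemma ip_zero_right [simp]: "ip x 0 = 0"
  using ip_cnj[of 0 x] by simp

lemma ip_add_right: "ip x (y + z) = ip x y + ip x z"
  by (metis ip_add_left ip_cnj complex_cnj_add)

lemma ip_scale_right: "ip x (c *\<^sub>C y) = cnj c * ip x y"
  by (metis ip_scale_left ip_cnj complex_cnj_mult)

lemma ip_minus_left: "ip (- x) y = - ip x y"
  using ip_scale_left[of "-1" x y] by simp

lemma ip_diff_left: "ip (x - y) z = ip x z - ip y z"
  using ip_add_left[of x "- y" z] by (simp add: ip_minus_left)

lemma ip_minus_right: "ip x (- y) = - ip x y"
  using ip_scale_right[of x "-1" y] by simp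

lemma ip_diff_right: "ip x (y - z) = ip x y - ip x z"
  using ip_add_right[of x y "- z"] by (simp add: ip_minus_right)

lemma eq_0_if_ip: "(\<And>y. ip x y = 0) \<Longrightarrow> x = 0"
  using ip_definite by blast

lemma subspace_orth: "V.subspace (orth U)"
  by (rule V.subspaceI) (auto simp: orth_def ip_add_left ip_scale_left)

text \<open>Gram-Schmidt, one vector at a time. Only spans of finite sets are projected onto, since
  the space of all polynomials has infinite dimension.\<close>

lemma projection_span:
  assumes "finite B"
  shows "\<exists>u\<in>V.span B. \<forall>y\<in>V.span B. ip (x - u) y = 0"
  using assms
proof (induction B arbitrary: x)
  case empty
  then show ?case by simp
next
  case (insert c B)
  obtain w where w: "w \<in> V.span B" "\<forall>y\<in>V.span B. ip (c - w) y = 0"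
    using insert.IH by blast
  obtain u where u: "u \<in> V.span B" "\<forall>y\<in>V.span B. ip (x - u) y = 0"
    using insert.IH by blast
  define d where "d = c - w"
  \<comment> \<open>If \<open>d = 0\<close>, then \<open>c\<close> already lies in the span of
    \<open>B\<close> and nothing is left to subtract.\<close>
  define k where "k = (if d = 0 then 0 else ip (x - u) d / ip d d)"
  have sub: "V.span B \<subseteq> V.span (insert c B)" by (rule V.span_mono) auto
  have d: "d \<in> V.span (insert c B)"
    unfolding d_def using w(1) sub by (auto intro: V.span_diff V.span_base)
  have "u + k *\<^sub>C d \<in> V.span (insert c B)"
    using u(1) sub d by (auto intro: V.span_add V.span_scale)
  moreover have "ip (x - (u + k *\<^sub>C d)) y = 0" if y: "y \<in> V.span (insert c B)" for y
  proof -
    obtain a where a: "y - a *\<^sub>C c \<in> V.span B"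
      using y by (auto simp: V.span_insert)
    define y' where "y' = y - a *\<^sub>C d"
    have "y' = (y - a *\<^sub>C c) + a *\<^sub>C w"
      by (simp add: y'_def d_def V.scale_right_diff_distrib)
    then have y': "y' \<in> V.span B" using a w(1) by (simp add: V.span_add V.span_scale)
    have yy: "y = y' + a *\<^sub>C d" by (simp add: y'_def)
    have "ip (x - (u + k *\<^sub>C d)) y' = ip (x - u) y' - k * ip d y'"
      by (simp add: ip_diff_left ip_add_left ip_scale_left)
    also have "\<dots> = 0" using u(2) w(2) y' by (simp add: d_def)
    finally have 1: "ip (x - (u + k *\<^sub>C d)) y' = 0" .
    have "ip (x - (u + k *\<^sub>C d)) d = ip (x - u) d - k * ip d d"
      by (simp add: ip_diff_left ip_add_left ip_scale_left)
    also have "\<dots> = 0" using ip_definite by (auto simp: k_def)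
    finally show ?thesis
      using 1 by (simp add: yy ip_add_right ip_scale_right)
  qed
  ultimately show ?case by blast
qed

lemma projection:
  assumes "V.subspace U" "fin_dim (*\<^sub>C) U"
  obtains u w where "u \<in> U" "w \<in> orth U" "x = u + w"
proof -
  obtain B where B: "B \<subseteq> U" "U \<subseteq> V.span B" "finite B"
    using finite_basis_exists[OF assms(2)] by metis
  then have "U = V.span B"
    using assms(1) by (simp add: V.span_minimal subset_antisym)
  with projection_span[OF B(3), of x] obtain u where "u \<in> U" "\<forall>y\<in>U. ip (x - u) y = 0"
    by blast
  then show ?thesis using that[of u "x - u"] by (simp add: orth_def)
qed

lemma dim_orth:
  assumes S: "V.subspace S" "fin_dim (*\<^sub>C) S" and U: "V.subspace U" "U \<subseteq> S"
  shows "V.dim S = V.dim U + V.dim (S \<inter> orth U)"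
proof -
  have fU: "fin_dim (*\<^sub>C) U" using S U fin_dim_subset by blast
  have "S = {x + y | x y. x \<in> U \<and> y \<in> S \<inter> orth U}"
  proof (intro equalityI subsetI)
    fix x assume x: "x \<in> S"
    obtain u w where uw: "u \<in> U" "w \<in> orth U" "x = u + w"
      using projection[OF U(1) fU] .
    have "w = x - u" using uw(3) by simp
    then have "w \<in> S" using x uw(1) U(2) S(1) V.subspace_diff by blast
    then show "x \<in> {x + y | x y. x \<in> U \<and> y \<in> S \<inter> orth U}" using uw by blast
  next
    fix x assume "x \<in> {x + y | x y. x \<in> U \<and> y \<in> S \<inter> orth U}"
    then show "x \<in> S" using S(1) U(2) by (auto intro: V.subspace_add)
  qed
  moreover have "U \<inter> (S \<inter> orth U) \<subseteq> {0}"
    using ip_definite by (auto simp: orth_def)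
  moreover have "V.subspace (S \<inter> orth U)"
    using S(1) subspace_orth V.subspace_inter by blast
  ultimately show ?thesis
    using dim_direct_sum[OF U(1) fU, of "S \<inter> orth U"] S(2) fin_dim_subset by auto
qed

text \<open>Replacing \<open>W\<close> by the orthogonal complement of \<open>U \<inter> W\<close>
  in \<open>W\<close> keeps the sum and makes it direct.\<close>

lemma dim_sum_Int:
  assumes U: "V.subspace U" "fin_dim (*\<^sub>C) U" and W: "V.subspace W" "fin_dim (*\<^sub>C) W"
  shows "V.dim {x + y | x y. x \<in> U \<and> y \<in> W} + V.dim (U \<inter> W) = V.dim U + V.dim W"
proof -
  define W' where "W' = W \<inter> orth (U \<inter> W)"
  have UW: "V.subspace (U \<inter> W)" "fin_dim (*\<^sub>C) (U \<inter> W)"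
    using U W V.subspace_inter fin_dim_subset by blast+
  have W': "V.subspace W'" "fin_dim (*\<^sub>C) W'"
    unfolding W'_def using W subspace_orth V.subspace_inter fin_dim_subset by blast+
  have "V.dim W = V.dim (U \<inter> W) + V.dim W'"
    unfolding W'_def by (rule dim_orth) (use W UW in auto)
  moreover have "{x + y | x y. x \<in> U \<and> y \<in> W} = {x + y | x y. x \<in> U \<and> y \<in> W'}"
  proof (intro equalityI subsetI)
    fix z assume "z \<in> {x + y | x y. x \<in> U \<and> y \<in> W}"
    then obtain x y where z: "z = x + y" "x \<in> U" "y \<in> W" by blast
    obtain u w where uw: "u \<in> U \<inter> W" "w \<in> orth (U \<inter> W)" "y = u + w"
      using projection[OF UW] .
    have "w = y - u" using uw(3) by simp
    then have "w \<in> W'"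
      unfolding W'_def using z(3) uw W(1) V.subspace_diff by blast
    moreover have "z = (x + u) + w" "x + u \<in> U"
      using z uw U(1) V.subspace_add by (auto simp: add.assoc)
    ultimately show "z \<in> {x + y | x y. x \<in> U \<and> y \<in> W'}" by blast
  qed (auto simp: W'_def)
  moreover have "U \<inter> W' \<subseteq> {0}"
    using ip_definite by (auto simp: W'_def orth_def)
  then have "V.dim {x + y | x y. x \<in> U \<and> y \<in> W'} = V.dim U + V.dim W'"
    using dim_direct_sum U W' by blast
  ultimately show ?thesis by simp
qed

end

section \<open>Polynomials in arbitrarily many variables\<close>

type_synonym 'v mon = "'v \<Rightarrow>\<^sub>0 nat"
type_synonym 'v pol = "('v \<Rightarrow>\<^sub>0 nat) \<Rightarrow>\<^sub>0 complex"

text \<open>The numeral 1 is kept as index and as exponent, so that \<open>single v 1\<close> and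
  \<open>{1..r}\<close> stay in the shape the rules expect.\<close>

declare One_nat_def [simp del]

abbreviation lookup where "lookup \<equiv> Poly_Mapping.lookup"
abbreviation keys where "keys \<equiv> Poly_Mapping.keys"
abbreviation single where "single \<equiv> Poly_Mapping.single"

definition Var :: "'v \<Rightarrow> 'v pol" where "Var v = single (single v 1) 1"
definition Const :: "complex \<Rightarrow> 'v pol" where "Const c = single 0 c"

lemma Const_0 [simp]: "Const 0 = 0" by (simp add: Const_def)
lemma Const_1 [simp]: "Const 1 = 1" by (simp add: Const_def)
lemma Const_mult: "Const (a * b) = Const a * Const b" by (simp add: Const_def mult_single)
lemma Const_add: "Const (a + b) = Const a + Const b" by (simp add: Const_def single_add)
lemma Const_minus: "Const (- a) = - Const a" by (simp add: Const_def single_uminus)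

lemma pol_sum_single: "p = (\<Sum>\<alpha>\<in>keys p. single \<alpha> (lookup p \<alpha>))"
  by (rule poly_mapping_eqI)
    (auto simp: lookup_sum lookup_single when_def sum.delta in_keys_iff)

text \<open>Every polynomial is a finite sum of terms; the empty sum is covered as a term with
  coefficient 0.\<close>

lemma pol_add_induct [case_names single add]:
  assumes "\<And>\<alpha> c. P (single \<alpha> c)" and "\<And>p q. P p \<Longrightarrow> P q \<Longrightarrow> P (p + q)"
  shows "P (p :: 'a \<Rightarrow>\<^sub>0 'b::comm_monoid_add)"
proof -
  have "P (\<Sum>\<alpha>\<in>A. single \<alpha> (lookup p \<alpha>))" if "finite A" for A
    using that
  proof (induction A)
    case empty
    then show ?case using assms(1)[of undefined 0] by simp
  next
    case (insert \<alpha> A)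
    then show ?case by (simp only: sum.insert assms(2)[OF assms(1)] not_False_eq_True)
  qed
  from this[OF finite_keys[of p]] show ?thesis
    by (simp only: pol_sum_single[symmetric])
qed

lemma mon_induct [case_names zero add]:
  assumes "P 0" and "\<And>\<alpha> v. P \<alpha> \<Longrightarrow> P (\<alpha> + single v 1)"
  shows "P (\<alpha> :: 'v mon)"
proof (induction \<alpha> rule: update_induct)
  case const
  then show ?case using assms(1) by simp
next
  case (update \<beta> v n)
  have "P (\<beta> + single v k)" for k
  proof (induction k)
    case 0
    then show ?case using update by simp
  next
    case (Suc k)
    have "\<beta> + single v (Suc k) = (\<beta> + single v k) + single v 1"
      by (rule poly_mapping_eqI) (simp add: lookup_add lookup_single when_def)
    then show ?case using assms(2)[OF Suc] by simp
  qed
  moreover have "Poly_Mapping.update v n \<beta> = \<beta> + single v n"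
    using update(1)
    by (intro poly_mapping_eqI) (auto simp: lookup_update lookup_add lookup_single when_def in_keys_iff)
  ultimately show ?case by simp
qed

lemma single_Suc: "single (\<alpha> + single v 1) c = single \<alpha> c * Var v"
  by (simp add: Var_def mult_single)

lemma single_eq_Const_mult: "single \<alpha> c = Const c * single \<alpha> 1"
  by (simp add: Const_def mult_single)

lemma pol_induct [case_names Const mult add]:
  assumes "\<And>c. P (Const c)" and "\<And>p v. P p \<Longrightarrow> P (p * Var v)"
    and "\<And>p q. P p \<Longrightarrow> P q \<Longrightarrow> P (p + q)"
  shows "P p"
proof (induction p rule: pol_add_induct)
  case (single \<alpha> c)
  show ?case
  proof (induction \<alpha> rule: mon_induct)
    case zero
    then show ?case using assms(1)[of c] by (simp add: Const_def)
  next
    case (add \<alpha> v)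
    then show ?case unfolding single_Suc by (rule assms(2))
  qed
qed (rule assms(3))

lemma lookup_Const_mult [simp]: "lookup (Const c * p) \<alpha> = c * lookup p \<alpha>"
  by (simp add: Const_def mult_map_scale_conv_mult[symmetric] Poly_Mapping.map.rep_eq when_def)

lemma lookup_single_mult:
  "lookup (single \<beta> c * p :: 'v pol) (\<beta> + \<gamma>) = c * lookup p \<gamma>"
  by (induction p rule: pol_add_induct)
    (auto simp: mult_single lookup_single when_def distrib_left lookup_add)

lemma lookup_single_mult_not:
  assumes "\<And>\<gamma>. \<delta> \<noteq> \<beta> + \<gamma>"
  shows "lookup (single \<beta> c * p :: 'v pol) \<delta> = 0"
  using assms by (induction p rule: pol_add_induct)
    (auto simp: mult_single lookup_single when_def distrib_left lookup_add)

lemma lookup_Var_mult [simp]: "lookup (Var v * p) (\<gamma> + single v 1) = lookup p \<gamma>"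
  using lookup_single_mult[of "single v 1" 1 p \<gamma>] by (simp add: Var_def add.commute)

lemma lookup_Var_mult_0: "lookup \<gamma> v = 0 \<Longrightarrow> lookup (Var v * p) \<gamma> = 0"
  unfolding Var_def by (rule lookup_single_mult_not) (auto simp: lookup_add)

lemma mon_decompose:
  assumes "lookup \<gamma> v \<noteq> (0::nat)"
  obtains \<delta> where "\<gamma> = \<delta> + single v 1"
proof
  show "\<gamma> = (\<gamma> - single v 1) + single v 1"
    using assms by (intro poly_mapping_eqI) (auto simp: lookup_add lookup_minus lookup_single when_def)
qed

subsection \<open>Evaluation\<close>

definition mev :: "('v \<Rightarrow> complex) \<Rightarrow> 'v mon \<Rightarrow> complex" where
  "mev y \<alpha> = (\<Prod>v\<in>keys \<alpha>. y v ^ lookup \<alpha> v)"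

definition ev :: "('v \<Rightarrow> complex) \<Rightarrow> 'v pol \<Rightarrow> complex" where
  "ev y p = (\<Sum>\<alpha>\<in>keys p. lookup p \<alpha> * mev y \<alpha>)"

lemma mev_superset:
  "finite S \<Longrightarrow> keys \<alpha> \<subseteq> S \<Longrightarrow> mev y \<alpha> = (\<Prod>v\<in>S. y v ^ lookup \<alpha> v)"
  unfolding mev_def by (rule prod.mono_neutral_left) (auto simp: in_keys_iff)

lemma mev_0 [simp]: "mev y 0 = 1"
  by (simp add: mev_def)

lemma mev_add: "mev y (\<alpha> + \<beta>) = mev y \<alpha> * mev y \<beta>"
proof -
  let ?S = "keys \<alpha> \<union> keys \<beta>"
  have "keys (\<alpha> + \<beta>) \<subseteq> ?S" by (rule Poly_Mapping.keys_add)
  then show ?thesis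
    by (simp add: mev_superset[of ?S] lookup_add power_add prod.distrib)
qed

lemma mev_single [simp]: "mev y (single v n) = y v ^ n"
  by (cases "n = 0") (auto simp: mev_def)

lemma ev_superset:
  "finite S \<Longrightarrow> keys p \<subseteq> S \<Longrightarrow> ev y p = (\<Sum>\<alpha>\<in>S. lookup p \<alpha> * mev y \<alpha>)"
  unfolding ev_def by (rule sum.mono_neutral_left) (auto simp: in_keys_iff)

lemma ev_0 [simp]: "ev y 0 = 0"
  by (simp add: ev_def)

lemma ev_add [simp]: "ev y (p + q) = ev y p + ev y q"
proof -
  let ?S = "keys p \<union> keys q"
  have "keys (p + q) \<subseteq> ?S" by (rule Poly_Mapping.keys_add)
  then show ?thesis
    by (simp add: ev_superset[of ?S] lookup_add distrib_right sum.distrib)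
qed

lemma ev_single [simp]: "ev y (single \<alpha> c) = c * mev y \<alpha>"
  by (cases "c = 0") (auto simp: ev_def)

lemma ev_Var [simp]: "ev y (Var v) = y v"
  by (simp add: Var_def)

lemma ev_Const [simp]: "ev y (Const c) = c"
  by (simp add: Const_def)

lemma ev_1 [simp]: "ev y 1 = 1"
  using ev_Const[of y 1] by simp

lemma ev_mult [simp]: "ev y (p * q) = ev y p * ev y q"
proof (induction p rule: pol_add_induct)
  case (single \<alpha> c)
  show ?case
    by (induction q rule: pol_add_induct) (simp_all add: mult_single mev_add algebra_simps)
qed (simp add: algebra_simps)

lemma ev_uminus [simp]: "ev y (- p) = - ev y p"
proof -
  have "- p = Const (-1) * p" by (simp add: Const_minus)
  then show ?thesis by (simp only: ev_mult ev_Const) simp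
qed

lemma ev_diff [simp]: "ev y (p - q) = ev y p - ev y q"
  using ev_add[of y p "- q"] by (simp del: ev_add)

lemma ev_sum [simp]: "ev y (\<Sum>i\<in>I. f i) = (\<Sum>i\<in>I. ev y (f i))"
  by (induction I rule: infinite_finite_induct) auto

lemma ev_prod [simp]: "ev y (\<Prod>i\<in>I. f i) = (\<Prod>i\<in>I. ev y (f i))"
  by (induction I rule: infinite_finite_induct) auto

lemma ev_cong:
  assumes "\<And>\<alpha> v. \<alpha> \<in> keys p \<Longrightarrow> v \<in> keys \<alpha> \<Longrightarrow> y v = y' v"
  shows "ev y p = ev y' p"
  unfolding ev_def mev_def using assms by (auto intro!: sum.cong prod.cong)

lemma ev_at_0: "ev (\<lambda>_. 0) p = lookup p 0"
proof -
  have "mev (\<lambda>_. 0) \<alpha> = (if \<alpha> = 0 then 1 else 0)" for \<alpha> :: "'a mon"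
  proof (cases "\<alpha> = 0")
    case False
    then obtain v where "v \<in> keys \<alpha>"
      by (metis in_keys_iff lookup_zero poly_mapping_eqI)
    then have "mev (\<lambda>_. 0) \<alpha> = 0"
      unfolding mev_def by (intro prod_zero) (auto simp: in_keys_iff intro!: bexI[of _ v])
    then show ?thesis using False by simp
  qed simp
  then have "ev (\<lambda>_. 0) p = (\<Sum>\<alpha>\<in>keys p. if \<alpha> = 0 then lookup p 0 else 0)"
    unfolding ev_def by (intro sum.cong) auto
  then show ?thesis by (auto simp: in_keys_iff)
qed

subsection \<open>Constant coefficient differential operators\<close>

text \<open>The multi-factorial of an exponent, which is the squared norm of the monomial in the
  Fischer inner product.\<close>

definition mfact :: "'v mon \<Rightarrow> nat" where
  "mfact \<alpha> = (\<Prod>v\<in>keys \<alpha>. fact (lookup \<alpha> v))"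

lemma mfact_superset:
  "finite S \<Longrightarrow> keys \<alpha> \<subseteq> S \<Longrightarrow> mfact \<alpha> = (\<Prod>v\<in>S. fact (lookup \<alpha> v))"
  unfolding mfact_def by (rule prod.mono_neutral_left) (auto simp: in_keys_iff)

lemma mfact_0 [simp]: "mfact 0 = 1"
  by (simp add: mfact_def)

lemma mfact_pos [simp]: "mfact \<alpha> > 0"
  by (simp add: mfact_def prod_pos)

lemma mfact_nonzero [simp]: "mfact \<alpha> \<noteq> 0"
  using mfact_pos[of \<alpha>] by linarith

lemma mfact_Suc: "mfact (\<alpha> + single v 1) = Suc (lookup \<alpha> v) * mfact \<alpha>"
proof -
  let ?S = "insert v (keys \<alpha>)"
  have "keys (\<alpha> + single v 1) \<subseteq> ?S"
    using Poly_Mapping.keys_add[of \<alpha> "single v 1"] by auto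
  then have "mfact (\<alpha> + single v 1) = (\<Prod>u\<in>?S. fact (lookup (\<alpha> + single v 1) u))"
    by (intro mfact_superset) auto
  also have "\<dots> = fact (Suc (lookup \<alpha> v)) * (\<Prod>u\<in>?S - {v}. fact (lookup (\<alpha> + single v 1) u))"
    by (subst prod.remove[of _ v]) (auto simp: lookup_add lookup_single One_nat_def)
  also have "(\<Prod>u\<in>?S - {v}. fact (lookup (\<alpha> + single v 1) u)) = (\<Prod>u\<in>?S - {v}. fact (lookup \<alpha> u) :: nat)"
    by (rule prod.cong) (auto simp: lookup_add lookup_single when_def)
  also have "fact (Suc (lookup \<alpha> v)) * \<dots> = Suc (lookup \<alpha> v) * (\<Prod>u\<in>?S. fact (lookup \<alpha> u))"
    by (subst (2) prod.remove[of _ v]) (auto simp: algebra_simps)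
  also have "(\<Prod>u\<in>?S. fact (lookup \<alpha> u)) = mfact \<alpha>"
    by (rule mfact_superset[symmetric]) auto
  finally show ?thesis .
qed

text \<open>The bilinear form of the Fischer pairing: the value at 0 of the operator with symbol
  \<open>p\<close> applied to \<open>q\<close> (\<open>lookup_pd_0\<close>). Without conjugation it
  makes multiplication and differentiation adjoint for all complex symbols; the Hermitian
  \<open>pip\<close> does so for real ones.\<close>

definition fischer :: "'v pol \<Rightarrow> 'v pol \<Rightarrow> complex" where
  "fischer p q = (\<Sum>\<alpha>\<in>keys p. of_nat (mfact \<alpha>) * lookup p \<alpha> * lookup q \<alpha>)"

lemma fischer_superset:
  "finite S \<Longrightarrow> keys p \<subseteq> S \<Longrightarrow>
    fischer p q = (\<Sum>\<alpha>\<in>S. of_nat (mfact \<alpha>) * lookup p \<alpha> * lookup q \<alpha>)"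
  unfolding fischer_def by (rule sum.mono_neutral_left) (auto simp: in_keys_iff)

lemma fischer_add_left: "fischer (p + p') q = fischer p q + fischer p' q"
proof -
  let ?S = "keys p \<union> keys p'"
  have "keys (p + p') \<subseteq> ?S" by (rule Poly_Mapping.keys_add)
  then show ?thesis
    by (simp add: fischer_superset[of ?S] lookup_add distrib_right distrib_left sum.distrib)
qed

lemma fischer_add_right: "fischer p (q + q') = fischer p q + fischer p q'"
  by (simp add: fischer_def lookup_add distrib_left sum.distrib)

lemma fischer_Const_right: "fischer p (Const c * q) = c * fischer p q"
  unfolding fischer_def lookup_Const_mult sum_distrib_left by (simp add: mult_ac)

lemma fischer_single: "fischer (single \<alpha> c) q = of_nat (mfact \<alpha>) * c * lookup q \<alpha>"
  by (cases "c = 0") (auto simp: fischer_def)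

lemma fischer_Const_left: "fischer (Const c * p) q = c * fischer p q"
  by (induction p rule: pol_add_induct)
    (auto simp: fischer_add_left fischer_single distrib_left Const_def mult_single)

lemma fischer_eqI:
  assumes "\<And>f. fischer f p = fischer f q"
  shows "p = q"
proof (rule poly_mapping_eqI)
  fix \<alpha>
  show "lookup p \<alpha> = lookup q \<alpha>"
    using assms[of "single \<alpha> 1"] by (simp add: fischer_single)
qed

text \<open>The differential operator with symbol \<open>p\<close>, defined as the adjoint of
  multiplication by \<open>p\<close> for the nondegenerate pairing \<open>fischer\<close>.
  Composition, commutation and linearity are then inherited from multiplication, for any set of
  variables.\<close>

definition pd :: "'v pol \<Rightarrow> 'v pol \<Rightarrow> 'v pol" where
  "pd p q = Abs_poly_mapping (\<lambda>\<gamma>. fischer (p * single \<gamma> 1) q / of_nat (mfact \<gamma>))"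

lemma pd_support:
  assumes "fischer (p * single \<gamma> 1) q \<noteq> 0"
  shows "\<exists>\<alpha>\<in>keys p. \<alpha> + \<gamma> \<in> keys q"
proof -
  from assms obtain \<delta> where \<delta>: "\<delta> \<in> keys (p * single \<gamma> 1)" "lookup q \<delta> \<noteq> 0"
    unfolding fischer_def by (metis (no_types, lifting) mult_eq_0_iff sum.neutral)
  then have "\<delta> \<in> {a + b | a b. a \<in> keys p \<and> b \<in> keys (single \<gamma> (1::complex))}"
    using keys_mult[of p "single \<gamma> 1"] by blast
  then obtain \<alpha> where "\<alpha> \<in> keys p" "\<delta> = \<alpha> + \<gamma>"
    by auto
  then show ?thesis using \<delta>(2) by (auto simp: in_keys_iff)
qed

lemma lookup_pd: "lookup (pd p q) \<gamma> = fischer (p * single \<gamma> 1) q / of_nat (mfact \<gamma>)"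
proof -
  have "{\<gamma>. fischer (p * single \<gamma> 1) q / of_nat (mfact \<gamma>) \<noteq> 0} \<subseteq> (\<Union>\<alpha>\<in>keys p. (\<lambda>\<delta>. \<delta> - \<alpha>) ` keys q)"
  proof
    fix \<gamma> assume "\<gamma> \<in> {\<gamma>. fischer (p * single \<gamma> 1) q / of_nat (mfact \<gamma>) \<noteq> 0}"
    then obtain \<alpha> where "\<alpha> \<in> keys p" "\<alpha> + \<gamma> \<in> keys q"
      using pd_support by fastforce
    then show "\<gamma> \<in> (\<Union>\<alpha>\<in>keys p. (\<lambda>\<delta>. \<delta> - \<alpha>) ` keys q)"
      by (auto intro!: bexI[of _ \<alpha>] image_eqI[of _ _ "\<alpha> + \<gamma>"])
  qed
  then have "finite {\<gamma>. fischer (p * single \<gamma> 1) q / of_nat (mfact \<gamma>) \<noteq> 0}"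
    by (rule finite_subset) auto
  then show ?thesis by (simp add: pd_def)
qed

lemma keys_pd: "\<gamma> \<in> keys (pd p q) \<Longrightarrow> \<exists>\<alpha>\<in>keys p. \<alpha> + \<gamma> \<in> keys q"
  by (rule pd_support) (auto simp: in_keys_iff lookup_pd)

lemma fischer_pd: "fischer f (pd p q) = fischer (f * p) q"
proof (induction f rule: pol_add_induct)
  case (single \<alpha> c)
  have "fischer (single \<alpha> c * p) q = c * fischer (p * single \<alpha> 1) q"
    using fischer_Const_left[of c "single \<alpha> 1 * p" q] single_eq_Const_mult[of \<alpha> c]
    by (simp add: mult.assoc mult.commute[of p])
  then show ?case by (simp add: fischer_single lookup_pd)
qed (simp add: fischer_add_left distrib_right)

lemma pd_mult: "pd (p * p') q = pd p (pd p' q)"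
  by (rule fischer_eqI) (simp add: fischer_pd mult.assoc)

lemma pd_commute: "pd p (pd p' q) = pd p' (pd p q)"
  unfolding pd_mult[symmetric] by (simp only: mult.commute)

lemma pd_add_left: "pd (p + p') q = pd p q + pd p' q"
  by (rule fischer_eqI) (simp add: fischer_pd distrib_left fischer_add_left fischer_add_right)

lemma pd_add_right: "pd p (q + q') = pd p q + pd p q'"
  by (rule fischer_eqI) (simp add: fischer_pd fischer_add_right)

lemma pd_Const [simp]: "pd (Const c) q = Const c * q"
proof (rule fischer_eqI)
  fix f
  have "fischer f (pd (Const c) q) = fischer (Const c * f) q"
    by (simp only: fischer_pd mult.commute)
  then show "fischer f (pd (Const c) q) = fischer f (Const c * q)"
    by (simp only: fischer_Const_left fischer_Const_right)
qed

lemma pd_1 [simp]: "pd 1 q = q"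
  using pd_Const[of 1 q] by simp

lemma pd_Const_mult_right: "pd p (Const c * q) = Const c * pd p q"
  by (rule fischer_eqI) (simp add: fischer_pd fischer_Const_right)

lemma pd_0_left [simp]: "pd 0 q = 0"
  using pd_Const[of 0 q] by simp

lemma pd_0_right [simp]: "pd p 0 = 0"
  using pd_Const_mult_right[of p 0 0] by simp

lemma pd_sum_left: "pd (\<Sum>i\<in>I. f i) q = (\<Sum>i\<in>I. pd (f i) q)"
  by (induction I rule: infinite_finite_induct) (auto simp: pd_add_left)

lemma pd_sum_right: "pd p (\<Sum>i\<in>I. f i) = (\<Sum>i\<in>I. pd p (f i))"
  by (induction I rule: infinite_finite_induct) (auto simp: pd_add_right)

lemma lookup_pd_0: "lookup (pd p q) 0 = fischer p q"
  by (simp add: lookup_pd)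

abbreviation dv :: "'v \<Rightarrow> 'v pol \<Rightarrow> 'v pol" where
  "dv v \<equiv> pd (Var v)"

text \<open>The quotient of the factorials of \<open>\<gamma> + single v 1\<close> and
  \<open>\<gamma>\<close> shows that \<open>dv v\<close> is the usual partial derivative.\<close>

lemma lookup_dv: "lookup (dv v q) \<gamma> = of_nat (Suc (lookup \<gamma> v)) * lookup q (\<gamma> + single v 1)"
proof -
  have "Var v * single \<gamma> 1 = single (\<gamma> + single v 1) 1"
    by (simp only: single_Suc mult.commute)
  then show ?thesis
    by (simp add: lookup_pd fischer_single mfact_Suc field_simps)
qed

lemma dv_Const [simp]: "dv v (Const c) = 0"
proof (rule poly_mapping_eqI)
  fix \<gamma> :: "'a mon"
  have "0 \<noteq> \<gamma> + single v 1"
  proof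
    assume "0 = \<gamma> + single v 1"
    then have "lookup 0 v = lookup (\<gamma> + single v 1) v" by simp
    then show False by (simp add: lookup_add)
  qed
  then show "lookup (dv v (Const c)) \<gamma> = lookup 0 \<gamma>"
    by (simp add: lookup_dv Const_def lookup_single del: of_nat_Suc)
qed

lemma dv_Var_mult: "dv v (Var w * p) = Var w * dv v p + (if v = w then p else 0)"
proof (rule poly_mapping_eqI)
  fix \<gamma> :: "'a mon"
  show "lookup (dv v (Var w * p)) \<gamma> = lookup (Var w * dv v p + (if v = w then p else 0)) \<gamma>"
  proof (cases "lookup \<gamma> w = 0")
    case True
    then show ?thesis
      by (auto simp: lookup_dv lookup_add lookup_Var_mult_0 lookup_single simp del: of_nat_Suc)
  next
    case False
    then obtain \<delta> where \<delta>: "\<gamma> = \<delta> + single w 1" by (rule mon_decompose)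
    show ?thesis
    proof (cases "v = w")
      case True
      have "lookup (dv w (Var w * p)) (\<delta> + single w 1) = of_nat (Suc (Suc (lookup \<delta> w))) * lookup p (\<delta> + single w 1)"
        by (simp only: lookup_dv lookup_Var_mult) (simp add: lookup_add)
      moreover have "lookup (Var w * dv w p) (\<delta> + single w 1) = of_nat (Suc (lookup \<delta> w)) * lookup p (\<delta> + single w 1)"
        by (simp only: lookup_dv lookup_Var_mult)
      ultimately show ?thesis
        using True \<delta> by (simp add: lookup_add algebra_simps)
    next
      case False
      have e: "\<delta> + single w 1 + single v 1 = (\<delta> + single v 1) + single w 1"
        by (simp add: add_ac)
      show ?thesis
        unfolding lookup_add \<delta> lookup_dv e lookup_Var_mult using False
        by (simp add: lookup_dv lookup_add lookup_single)
    qed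
  qed
qed

lemma dv_mult_Var: "dv v (p * Var w) = dv v p * Var w + (if v = w then p else 0)"
  using dv_Var_mult[of v w p] by (simp only: mult.commute)

subsection \<open>Derivations\<close>

definition derivation :: "('v pol \<Rightarrow> 'v pol) \<Rightarrow> bool" where
  "derivation D \<longleftrightarrow> (\<forall>p q. D (p + q) = D p + D q) \<and> (\<forall>p q. D (p * q) = D p * q + p * D q)
     \<and> (\<forall>c. D (Const c) = 0)"

lemma derivationD:
  assumes "derivation D"
  shows "D (p + q) = D p + D q" "D (p * q) = D p * q + p * D q" "D (Const c) = 0"
    "D (Const c * p) = Const c * D p" "D 0 = 0" "D 1 = 0" "D (- p) = - D p" "D (p - q) = D p - D q"
proof -
  show a: "\<And>p q. D (p + q) = D p + D q" and m: "\<And>p q. D (p * q) = D p * q + p * D q"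
    and c: "\<And>c. D (Const c) = 0"
    using assms by (auto simp: derivation_def)
  show cm: "\<And>p. D (Const c * p) = Const c * D p" for c by (simp add: m c)
  show "D 0 = 0" "D 1 = 0" using c[of 0] c[of 1] by simp_all
  show u: "\<And>p. D (- p) = - D p" using cm[of "-1"] by (simp add: Const_minus)
  show "D (p - q) = D p - D q" using a[of p "- q"] by (simp add: u)
qed

lemma derivation_dv: "derivation (dv v)"
  unfolding derivation_def
proof (intro conjI allI)
  fix p q
  show "dv v (p * q) = dv v p * q + p * dv v q"
  proof (induction p arbitrary: q rule: pol_induct)
    case (mult p w)
    \<comment> \<open>The variable is shifted to the other factor, which the induction hypothesis
      leaves arbitrary.\<close>
    have "dv v (p * Var w * q) = dv v p * (q * Var w) + p * dv v (q * Var w)"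
      using mult.IH[of "q * Var w"] by (simp only: mult_ac)
    then show ?case
      by (simp add: dv_mult_Var algebra_simps)
  qed (simp_all add: pd_Const_mult_right pd_add_right distrib_right)
qed (auto simp: pd_add_right)

lemma dv_Var: "dv v (Var w) = (if v = w then 1 else 0)"
  using dv_Var_mult[of v w 1] dv_Const[of v 1] by simp

lemma derivation_ext:
  assumes "derivation D" "derivation D'" "\<And>v. D (Var v) = D' (Var v)"
  shows "D p = D' p"
  by (induction p rule: pol_induct)
    (simp_all add: derivationD(1,2,3)[OF assms(1)] derivationD(1,2,3)[OF assms(2)] assms(3))

lemma derivation_mult: "derivation D \<Longrightarrow> derivation (\<lambda>p. f * D p)"
  by (auto simp: derivation_def algebra_simps)

lemma derivation_add: "derivation D \<Longrightarrow> derivation D' \<Longrightarrow> derivation (\<lambda>p. D p + D' p)"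
  by (auto simp: derivation_def algebra_simps)

lemma derivation_diff: "derivation D \<Longrightarrow> derivation D' \<Longrightarrow> derivation (\<lambda>p. D p - D' p)"
  by (auto simp: derivation_def algebra_simps)

lemma derivation_0: "derivation (\<lambda>p. 0)"
  by (auto simp: derivation_def)

lemma derivation_sum:
  "(\<And>i. i \<in> I \<Longrightarrow> derivation (D i)) \<Longrightarrow> derivation (\<lambda>p. \<Sum>i\<in>I. D i p)"
  by (induction I rule: infinite_finite_induct) (auto intro: derivation_0 derivation_add)

text \<open>The second order terms cancel. Commutator relations between the operators below thus
  need only be checked on variables.\<close>

lemma derivation_commutator:
  assumes "derivation D" "derivation D'"
  shows "derivation (\<lambda>p. D (D' p) - D' (D p))"
  unfolding derivation_def
  by (auto simp: derivationD[OF assms(1)] derivationD[OF assms(2)] algebra_simps)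

text \<open>Chain rule along the line through \<open>y\<close> whose velocity is the vector field of
  \<open>D\<close> at \<open>y\<close>. It is the bridge between group elements and derivations, and
  it also yields the directional derivatives.\<close>

lemma DERIV_ev_line:
  assumes D: "derivation D" and w: "\<And>v. ev y (D (Var v)) = w v"
  shows "((\<lambda>t. ev (\<lambda>v. y v + t * w v) p) has_field_derivative ev y (D p)) (at 0)"
proof (induction p rule: pol_induct)
  case (Const c)
  show ?case by (simp add: derivationD[OF D])
next
  case (mult p v)
  show ?case
    by (auto intro!: derivative_eq_intros mult.IH simp: derivationD[OF D] w)
next
  case (add p q)
  show ?case
    using DERIV_add[OF add] by (simp add: derivationD[OF D])
qed

text \<open>If the function vanishes, so do all its iterated partial derivatives, and their values
  at 0 are the coefficients up to factorials.\<close>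

lemma pol_eq_0_if_ev_0:
  assumes "\<And>y. ev y p = 0"
  shows "p = 0"
proof (rule poly_mapping_eqI)
  fix \<alpha> :: "'a mon"
  have "ev y (pd (single \<alpha> 1) p) = 0" if "\<And>y. ev y p = 0" for p :: "'a pol" and y
    using that
  proof (induction \<alpha> arbitrary: p rule: mon_induct)
    case zero
    then show ?case by simp
  next
    case (add \<alpha> v)
    have "ev y (dv v p) = 0" for y
    proof -
      have "((\<lambda>t. ev (\<lambda>u. y u + t * ev y (dv v (Var u))) p) has_field_derivative ev y (dv v p)) (at 0)"
        by (rule DERIV_ev_line) (auto intro: derivation_dv)
      then have "((\<lambda>t. 0) has_field_derivative ev y (dv v p)) (at (0::complex))"
        using add.prems by simp
      then show ?thesis
        using DERIV_unique DERIV_const by blast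
    qed
    then show ?case
      using add.IH[of "dv v p"] by (simp only: single_Suc pd_mult)
  qed
  then have "ev (\<lambda>_. 0) (pd (single \<alpha> 1) p) = 0"
    using assms by blast
  then show "lookup p \<alpha> = lookup 0 \<alpha>"
    by (simp add: ev_at_0 lookup_pd_0 fischer_single)
qed

lemma pol_eqI_ev:
  assumes "\<And>y. ev y p = ev y q"
  shows "p = q"
  using pol_eq_0_if_ev_0[of "p - q"] assms by simp

subsection \<open>The Fischer inner product\<close>

definition pscale :: "complex \<Rightarrow> 'v pol \<Rightarrow> 'v pol" where
  "pscale c p = Const c * p"

definition pip :: "'v pol \<Rightarrow> 'v pol \<Rightarrow> complex" where
  "pip p q = (\<Sum>\<alpha>\<in>keys p. of_nat (mfact \<alpha>) * lookup p \<alpha> * cnj (lookup q \<alpha>))"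

lemma pip_superset:
  "finite S \<Longrightarrow> keys p \<subseteq> S \<Longrightarrow>
    pip p q = (\<Sum>\<alpha>\<in>S. of_nat (mfact \<alpha>) * lookup p \<alpha> * cnj (lookup q \<alpha>))"
  unfolding pip_def by (rule sum.mono_neutral_left) (auto simp: in_keys_iff)

lemma vector_space_pscale: "vector_space pscale"
  by unfold_locales (auto simp: pscale_def Const_add Const_mult algebra_simps)

interpretation P: hermitian_space pscale pip
proof (intro hermitian_space.intro hermitian_space_axioms.intro vspace.intro vector_space_pscale)
  fix x y z :: "'a pol" and c :: complex
  have "keys (x + y) \<subseteq> keys x \<union> keys y" by (rule Poly_Mapping.keys_add)
  then show "pip (x + y) z = pip x z + pip y z"
    by (simp add: pip_superset[of "keys x \<union> keys y"] lookup_add distrib_right distrib_left sum.distrib)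
  have "keys (pscale c x) \<subseteq> keys x"
    by (auto simp: in_keys_iff pscale_def)
  then show "pip (pscale c x) y = c * pip x y"
    by (simp add: pip_superset[of "keys x"] pscale_def) (simp add: sum_distrib_left mult_ac)
  have "pip x y = (\<Sum>\<alpha>\<in>keys x \<union> keys y. of_nat (mfact \<alpha>) * lookup x \<alpha> * cnj (lookup y \<alpha>))" for x y :: "'a pol"
    by (rule pip_superset) auto
  from this[of x y] this[of y x] show "cnj (pip x y) = pip y x"
    by (simp add: Un_commute mult_ac)
  have *: "pip x x = of_real (\<Sum>\<alpha>\<in>keys x. real (mfact \<alpha>) * (cmod (lookup x \<alpha>))\<^sup>2)"
    by (simp add: pip_def mult.assoc complex_norm_square[symmetric] del: of_real_power)
  show "0 \<le> Re (pip x x)"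
    by (simp add: * sum_nonneg)
  assume "pip x x = 0"
  then have "(\<Sum>\<alpha>\<in>keys x. real (mfact \<alpha>) * (cmod (lookup x \<alpha>))\<^sup>2) = 0"
    using * of_real_eq_0_iff by metis
  then have "\<forall>\<alpha>\<in>keys x. lookup x \<alpha> = 0"
    by (subst (asm) sum_nonneg_eq_0_iff) auto
  then show "x = 0" by (metis lookup_zero in_keys_iff poly_mapping_eqI)
qed

lemma pip_single_right: "pip p (single \<beta> c) = of_nat (mfact \<beta>) * lookup p \<beta> * cnj c"
proof -
  have "pip p (single \<beta> c) = (\<Sum>\<alpha>\<in>insert \<beta> (keys p). if \<alpha> = \<beta> then of_nat (mfact \<beta>) * lookup p \<beta> * cnj c else 0)"
    by (subst pip_superset[of "insert \<beta> (keys p)"])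
      (simp, blast, rule sum.cong, auto simp: lookup_single when_def)
  then show ?thesis by simp
qed

text \<open>For \<open>pip\<close>, the adjoint of multiplication by a polynomial is the operator
  whose symbol has the conjugated coefficients. The property thus singles out symbols with real
  coefficients, such as the trace and the determinant.\<close>

definition fischer_adjoint :: "'v pol \<Rightarrow> bool" where
  "fischer_adjoint r \<longleftrightarrow> (\<forall>p q. pip (pd r p) q = pip p (r * q))"

lemma fischer_adjointD: "fischer_adjoint r \<Longrightarrow> pip (pd r p) q = pip p (r * q)"
  by (simp add: fischer_adjoint_def)

lemma fischer_adjointD': "fischer_adjoint r \<Longrightarrow> pip (r * p) q = pip p (pd r q)"
  by (metis fischer_adjointD P.ip_cnj)

lemma fischer_adjoint_Var: "fischer_adjoint (Var v)"
  unfolding fischer_adjoint_def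
proof (intro allI)
  fix p q
  show "pip (dv v p) q = pip p (Var v * q)"
  proof (induction q rule: pol_add_induct)
    case (single \<beta> c)
    have "Var v * single \<beta> c = single (\<beta> + single v 1) c"
      by (simp only: single_Suc mult.commute)
    then show ?case
      by (simp add: pip_single_right lookup_dv mfact_Suc algebra_simps)
  qed (simp add: P.ip_add_right distrib_left)
qed

lemma fischer_adjoint_mult: "fischer_adjoint p \<Longrightarrow> fischer_adjoint q \<Longrightarrow> fischer_adjoint (p * q)"
  by (simp add: fischer_adjoint_def pd_mult mult_ac)

lemma fischer_adjoint_add: "fischer_adjoint p \<Longrightarrow> fischer_adjoint q \<Longrightarrow> fischer_adjoint (p + q)"
  by (simp add: fischer_adjoint_def pd_add_left distrib_right P.ip_add_left P.ip_add_right)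

lemma fischer_adjoint_Const: "c \<in> \<real> \<Longrightarrow> fischer_adjoint (Const c)"
  by (simp add: fischer_adjoint_def P.ip_scale_left[unfolded pscale_def]
      P.ip_scale_right[unfolded pscale_def] Reals_cnj_iff)

lemma fischer_adjoint_0: "fischer_adjoint 0" and fischer_adjoint_1: "fischer_adjoint 1"
  using fischer_adjoint_Const[of 0] fischer_adjoint_Const[of 1] by auto

lemma fischer_adjoint_diff: "fischer_adjoint p \<Longrightarrow> fischer_adjoint q \<Longrightarrow> fischer_adjoint (p - q)"
  using fischer_adjoint_add[of p "Const (-1) * q"]
    fischer_adjoint_mult[OF fischer_adjoint_Const[of "-1"], of q]
  by (simp add: Const_minus)

lemma fischer_adjoint_prod:
  "(\<And>i. i \<in> I \<Longrightarrow> fischer_adjoint (f i)) \<Longrightarrow> fischer_adjoint (\<Prod>i\<in>I. f i)"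
  by (induction I rule: infinite_finite_induct) (auto intro: fischer_adjoint_mult fischer_adjoint_1)

section \<open>Matrices\<close>

lemma matrix_inv_unique:
  fixes A B :: "'a::semiring_1^'n^'n"
  assumes "A ** B = mat 1" "B ** A = mat 1"
  shows "matrix_inv A = B"
proof -
  have "A ** matrix_inv A = mat 1 \<and> matrix_inv A ** A = mat 1"
    unfolding matrix_inv_def by (rule someI[of _ B]) (use assms in simp)
  then have "matrix_inv A = (B ** A) ** matrix_inv A" "B ** (A ** matrix_inv A) = B"
    using assms by simp_all
  then show ?thesis by (simp add: matrix_mul_assoc)
qed

lemma matrix_inv_right:
  fixes A :: "'a::semiring_1^'n^'n"
  assumes "invertible A"
  shows "A ** matrix_inv A = mat 1"
  using assms matrix_inv_unique unfolding invertible_def by metis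

lemma matrix_inv_left:
  fixes A :: "'a::semiring_1^'n^'n"
  assumes "invertible A"
  shows "matrix_inv A ** A = mat 1"
  using assms matrix_inv_unique unfolding invertible_def by metis

lemma matrix_inv_mat_1 [simp]: "matrix_inv (mat 1 :: 'a::semiring_1^'n^'n) = mat 1"
  by (rule matrix_inv_unique) auto

lemma invertible_matrix_inv:
  fixes A :: "'a::semiring_1^'n^'n"
  shows "invertible A \<Longrightarrow> invertible (matrix_inv A)"
  using matrix_inv_left matrix_inv_right unfolding invertible_def by blast

lemma matrix_inv_matrix_inv:
  fixes A :: "'a::semiring_1^'n^'n"
  shows "invertible A \<Longrightarrow> matrix_inv (matrix_inv A) = A"
  by (intro matrix_inv_unique matrix_inv_left matrix_inv_right)

lemma matrix_inv_mult:
  fixes A B :: "'a::semiring_1^'n^'n"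
  assumes "invertible A" "invertible B"
  shows "matrix_inv (A ** B) = matrix_inv B ** matrix_inv A"
proof (rule matrix_inv_unique)
  have "A ** B ** (matrix_inv B ** matrix_inv A) = A ** (B ** matrix_inv B) ** matrix_inv A"
    by (simp add: matrix_mul_assoc)
  then show "A ** B ** (matrix_inv B ** matrix_inv A) = mat 1"
    by (simp add: matrix_inv_right assms)
  have "matrix_inv B ** matrix_inv A ** (A ** B) = matrix_inv B ** (matrix_inv A ** A) ** B"
    by (simp add: matrix_mul_assoc)
  then show "matrix_inv B ** matrix_inv A ** (A ** B) = mat 1"
    by (simp add: matrix_inv_left assms)
qed

lemma invertible_det_1: "det (A :: complex^2^2) = 1 \<Longrightarrow> invertible A"
  by (simp add: invertible_det_nz)

lemma matrix_eq_2:
  "(A :: 'a^2^2) = B \<longleftrightarrow> A$1$1 = B$1$1 \<and> A$1$2 = B$1$2 \<and> A$2$1 = B$2$1 \<and> A$2$2 = B$2$2"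
  by (auto simp: vec_eq_iff forall_2)

lemma matrix_mult_2: "((A :: 'a::semiring_1^2^2) ** B) $ i $ j = A$i$1 * B$1$j + A$i$2 * B$2$j"
  by (simp add: matrix_matrix_mult_def sum_2)

lemma matrix_vector_mult_2: "((A :: 'a::semiring_1^2^2) *v w) $ i = A$i$1 * w$1 + A$i$2 * w$2"
  by (simp add: matrix_vector_mult_def sum_2)

lemma mat_1_2 [simp]:
  "(mat 1 :: 'a::semiring_1^2^2)$1$1 = 1" "(mat 1 :: 'a::semiring_1^2^2)$1$2 = 0"
  "(mat 1 :: 'a::semiring_1^2^2)$2$1 = 0" "(mat 1 :: 'a::semiring_1^2^2)$2$2 = 1"
  by (simp_all add: mat_def)

definition transvection :: "2 \<Rightarrow> 2 \<Rightarrow> complex \<Rightarrow> complex^2^2" where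
  "transvection a b t = (\<chi> c d. (if c = d then 1 else 0) + (if c = a \<and> d = b then t else 0))"

lemma transvection_mult:
  "(transvection a b t ** (A :: complex^2^2)) $ c $ d = A $ c $ d + (if c = a then t * A $ b $ d else 0)"
  using exhaust_2[of a] exhaust_2[of b] exhaust_2[of c]
  by (elim disjE) (simp_all add: matrix_mult_2 transvection_def algebra_simps)

lemma mult_transvection:
  "((A :: complex^2^2) ** transvection a b t) $ c $ d = A $ c $ d + (if d = b then t * A $ c $ a else 0)"
  using exhaust_2[of a] exhaust_2[of b] exhaust_2[of d]
  by (elim disjE) (simp_all add: matrix_mult_2 transvection_def algebra_simps)

lemma transvection_mult_vec: "(transvection a b t *v w) $ c = w $ c + (if c = a then t * w $ b else 0)"
  using exhaust_2[of a] exhaust_2[of b] exhaust_2[of c]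
  by (elim disjE) (simp_all add: matrix_vector_mult_2 transvection_def algebra_simps)

lemma matrix_inv_transvection:
  assumes "a \<noteq> b"
  shows "matrix_inv (transvection a b t) = transvection a b (- t)"
  using assms exhaust_2[of a] exhaust_2[of b]
  by (intro matrix_inv_unique) (auto simp: matrix_eq_2 matrix_mult_2 transvection_def)

lemma det_transvection: "a \<noteq> b \<Longrightarrow> det (transvection a b t) = 1"
  using exhaust_2[of a] exhaust_2[of b] by (auto simp: det_2 transvection_def)

text \<open>If the lower left entry is nonzero, the matrix is a product upper, lower, upper: the
  diagonal entries force \<open>u\<close> and \<open>w\<close>, and determinant 1 makes the
  remaining entry fit. If it is zero, the lower right entry is nonzero, and one lower transvection
  leads back to the first case.\<close>

lemma SL2_transvection_induct [consumes 1, case_names transvection mult]: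
  fixes A :: "complex^2^2"
  assumes det: "det A = 1"
    and tr: "\<And>a b t. a \<noteq> b \<Longrightarrow> P (transvection a b t)"
    and mult: "\<And>A B. det A = 1 \<Longrightarrow> det B = 1 \<Longrightarrow> P A \<Longrightarrow> P B \<Longrightarrow> P (A ** B)"
  shows "P A"
proof -
  have lower: "P A" if d: "det A = 1" and c: "A$2$1 \<noteq> 0" for A :: "complex^2^2"
  proof -
    define u w where "u = (A$1$1 - 1) / A$2$1" and "w = (A$2$2 - 1) / A$2$1"
    have u: "A$2$1 * u = A$1$1 - 1" and w: "A$2$1 * w = A$2$2 - 1"
      using c by (simp_all add: u_def w_def)
    have "A$2$1 * (A$1$1 * w + u) = A$1$1 * (A$2$1 * w) + A$2$1 * u"
      by (simp add: algebra_simps)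
    also have "\<dots> = A$2$1 * A$1$2"
      using d by (simp only: u w) (simp add: det_2 algebra_simps)
    finally have "A$1$1 * w + u = A$1$2" using c by simp
    moreover have "1 + u * A$2$1 = A$1$1" "A$2$1 * w + 1 = A$2$2"
      using u w by (simp_all add: mult.commute)
    ultimately have "A = (transvection 1 2 u ** transvection 2 1 (A$2$1)) ** transvection 1 2 w"
      by (simp add: matrix_eq_2 matrix_mult_2 transvection_def)
    moreover have "P \<dots>"
      by (intro mult tr) (auto simp: det_mul det_transvection)
    ultimately show ?thesis by simp
  qed
  show ?thesis
  proof (cases "A$2$1 = 0")
    case True
    define B where "B = A ** transvection 2 1 1"
    have "A = B ** transvection 2 1 (- 1)"
      by (simp add: B_def matrix_eq_2 matrix_mult_2 transvection_def)
    moreover have dB: "det B = 1" by (simp add: B_def det_mul det det_transvection)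
    moreover have "B$2$1 \<noteq> 0"
      using det True by (auto simp: B_def matrix_mult_2 transvection_def det_2)
    then have "P B" using lower dB by blast
    ultimately show ?thesis
      using mult[of B "transvection 2 1 (- 1)"] tr by (simp add: det_transvection)
  next
    case False
    then show ?thesis using lower det by blast
  qed
qed

section \<open>The infinitesimal action\<close>

text \<open>Besides the coordinates of \<open>V\<close> there are the coordinates \<open>U i a\<close> of one vector
  in \<open>\<complex>\<^sup>2\<close> per vertex: an intertwining map \<open>T\<close> out of \<open>F_space r s\<close> is encoded by the invariant
  polynomial \<open>T (v\<^sub>1\<^bsup>s\<^sub>1\<^esup> \<otimes> \<dots> \<otimes> v\<^sub>r\<^bsup>s\<^sub>r\<^esup>) (x)\<close> of \<open>(x, v)\<close>.\<close>

datatype var = X nat 2 2 | U nat 2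

definition point :: "tuple \<Rightarrow> (nat \<Rightarrow> complex^2) \<Rightarrow> var \<Rightarrow> complex" where
  "point x v w = (case w of X i a b \<Rightarrow> x i $ a $ b | U i a \<Rightarrow> v i $ a)"

lemma point_simps [simp]: "point x v (X i a b) = x i $ a $ b" "point x v (U i a) = v i $ a"
  by (simp_all add: point_def)

lemma point_surj: "\<exists>x v. y = point x v"
proof (intro exI ext)
  fix w show "y w = point (\<lambda>i. \<chi> a b. y (X i a b)) (\<lambda>i. \<chi> a. y (U i a)) w"
    by (cases w) auto
qed

definition vars :: "nat \<Rightarrow> var set" where
  "vars r = {X i a b | i a b. i \<in> {1..r}} \<union> {U i a | i a. i \<in> {1..r}}"

lemma in_vars [simp]: "X i a b \<in> vars r \<longleftrightarrow> i \<in> {1..r}" "U i a \<in> vars r \<longleftrightarrow> i \<in> {1..r}"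
  by (auto simp: vars_def)

text \<open>Tuples are functions on all natural numbers, but group elements are controlled only at
  the indices in \<open>{1..r}\<close>; polynomials in range do not see the others.\<close>

definition in_range :: "nat \<Rightarrow> var pol \<Rightarrow> bool" where
  "in_range r p \<longleftrightarrow> (\<forall>\<alpha>\<in>keys p. keys \<alpha> \<subseteq> vars r)"

lemma ev_cong_in_range:
  "in_range r p \<Longrightarrow> (\<And>w. w \<in> vars r \<Longrightarrow> y w = y' w) \<Longrightarrow> ev y p = ev y' p"
  by (rule ev_cong) (auto simp: in_range_def)

lemma point_cong:
  "(\<And>i. i \<in> {1..r} \<Longrightarrow> x i = x' i) \<Longrightarrow> (\<And>i. i \<in> {1..r} \<Longrightarrow> v i = v' i) \<Longrightarrow> w \<in> vars r
    \<Longrightarrow> point x v w = point x' v' w"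
  by (cases w) auto

definition act_U :: "tuple \<Rightarrow> (nat \<Rightarrow> complex^2) \<Rightarrow> nat \<Rightarrow> complex^2" where
  "act_U g v = (\<lambda>i. g i *v v i)"

definition fixed_by :: "nat \<Rightarrow> tuple \<Rightarrow> var pol \<Rightarrow> bool" where
  "fixed_by r g p \<longleftrightarrow> (\<forall>x v. ev (point (act_V r g x) (act_U g v)) p = ev (point x v) p)"

definition SL_invariant :: "nat \<Rightarrow> var pol \<Rightarrow> bool" where
  "SL_invariant r p \<longleftrightarrow> (\<forall>g. (\<forall>i\<in>{1..r}. det (g i) = 1) \<longrightarrow> fixed_by r g p)"

locale cyclic =
  fixes r :: nat
  assumes r2: "r \<ge> 2"
begin

abbreviation "prev \<equiv> prv r"

lemma prev_in [simp]: "i \<in> {1..r} \<Longrightarrow> prev i \<in> {1..r}" and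
  prev_neq: "i \<in> {1..r} \<Longrightarrow> prev i \<noteq> i" and
  nxt_in: "i \<in> {1..r} \<Longrightarrow> nxt r i \<in> {1..r}" and
  nxt_prev: "i \<in> {1..r} \<Longrightarrow> nxt r (prev i) = i" and
  prev_nxt: "i \<in> {1..r} \<Longrightarrow> prev (nxt r i) = i"
  using r2 by (auto simp: prv_def nxt_def)

lemma prev_inj: "i \<in> {1..r} \<Longrightarrow> j \<in> {1..r} \<Longrightarrow> prev i = prev j \<longleftrightarrow> i = j"
  by (metis nxt_prev)

lemma nxt_eq: "i \<in> {1..r} \<Longrightarrow> k \<in> {1..r} \<Longrightarrow> nxt r k = i \<longleftrightarrow> k = prev i"
  by (metis nxt_prev prev_nxt)

section \<open>The operators of sl_2 at each vertex\<close>

definition xd :: "var \<Rightarrow> var \<Rightarrow> var pol \<Rightarrow> var pol" where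
  "xd u w p = Var u * dv w p"

text \<open>\<open>root_op i a b\<close> is the action of the matrix unit \<open>e\<^sub>a\<^sub>b\<close> at the vertex \<open>i\<close>, up to sign.\<close>

definition root_op :: "nat \<Rightarrow> 2 \<Rightarrow> 2 \<Rightarrow> var pol \<Rightarrow> var pol" where
  "root_op i a b p =
     (xd (X i b 1) (X i a 1) p + xd (X i b 2) (X i a 2) p)
     - (xd (X (prev i) 1 a) (X (prev i) 1 b) p + xd (X (prev i) 2 a) (X (prev i) 2 b) p)
     + xd (U i b) (U i a) p"

text \<open>The diagonal element H of sl_2 at vertex \<open>i\<close>: a derivation that scales each
  monomial by \<open>up_deg\<close> minus \<open>low_deg\<close>.\<close>

definition weight_op :: "nat \<Rightarrow> var pol \<Rightarrow> var pol" where
  "weight_op i p =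
     (xd (X i 2 1) (X i 2 1) p + xd (X i 2 2) (X i 2 2) p
      + (xd (X (prev i) 1 1) (X (prev i) 1 1) p + xd (X (prev i) 2 1) (X (prev i) 2 1) p)
      + xd (U i 2) (U i 2) p)
     - (xd (X i 1 1) (X i 1 1) p + xd (X i 1 2) (X i 1 2) p
      + (xd (X (prev i) 1 2) (X (prev i) 1 2) p + xd (X (prev i) 2 2) (X (prev i) 2 2) p)
      + xd (U i 1) (U i 1) p)"

lemma derivation_xd: "derivation (xd u w)"
  unfolding xd_def[abs_def] by (intro derivation_mult derivation_dv)

lemma derivation_root_op: "derivation (root_op i a b)"
  unfolding root_op_def[abs_def]
  by (intro derivation_add derivation_diff derivation_xd)

lemma derivation_weight_op: "derivation (weight_op i)"
  unfolding weight_op_def[abs_def]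
  by (intro derivation_add derivation_diff derivation_xd)

lemma xd_Var: "xd u w (Var z) = (if w = z then Var u else 0)"
  by (simp add: xd_def dv_Var)

lemma xd_rows_X: "xd (X i b 1) (X i a 1) (Var (X k c d)) + xd (X i b 2) (X i a 2) (Var (X k c d))
    = (if k = i \<and> c = a then Var (X i b d) else 0)"
  using exhaust_2[of d] by (elim disjE) (auto simp: xd_Var)

lemma xd_cols_X: "xd (X i 1 b) (X i 1 a) (Var (X k c d)) + xd (X i 2 b) (X i 2 a) (Var (X k c d))
    = (if k = i \<and> d = a then Var (X k c b) else 0)"
  using exhaust_2[of c] by (elim disjE) (auto simp: xd_Var)

lemma root_op_X: "root_op i a b (Var (X k c d)) =
    (if k = i \<and> c = a then Var (X i b d) else 0)
    - (if k = prev i \<and> d = b then Var (X k c a) else 0)"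
  unfolding root_op_def xd_rows_X xd_cols_X by (simp add: xd_Var)

lemma root_op_U: "root_op i a b (Var (U k c)) = (if k = i \<and> c = a then Var (U i b) else 0)"
  by (auto simp: root_op_def xd_Var)

lemma weight_op_X: "weight_op i (Var (X k c d)) =
    (if k = i then (if c = 2 then Var (X k c d) else - Var (X k c d)) else 0)
    + (if k = prev i then (if d = 1 then Var (X k c d) else - Var (X k c d)) else 0)"
  unfolding weight_op_def xd_rows_X xd_cols_X
  using exhaust_2[of c] exhaust_2[of d] by (elim disjE) (simp_all add: xd_Var)

lemma weight_op_U: "weight_op i (Var (U k c)) =
    (if k = i then (if c = 2 then Var (U k c) else - Var (U k c)) else 0)"
  using exhaust_2[of c] by (auto simp: weight_op_def xd_Var)

lemmas root_op_rules = derivationD[OF derivation_root_op]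

text \<open>Distinct vertices share no \<open>U\<close> variable, and on a common arrow one acts
  from the left and the other from the right. For \<open>r = 2\<close> they share both
  arrows.\<close>

lemma root_op_commute:
  assumes "i \<in> {1..r}" "j \<in> {1..r}" "i \<noteq> j"
  shows "root_op i a b (root_op j c d p) = root_op j c d (root_op i a b p)"
proof -
  have "root_op i a b (root_op j c d p) - root_op j c d (root_op i a b p) = 0"
  proof (rule derivation_ext[OF derivation_commutator derivation_0])
    show "root_op i a b (root_op j c d (Var w)) - root_op j c d (root_op i a b (Var w)) = 0" for w
    proof (cases w)
      case (X k e f)
      have ne: "i \<noteq> j" "j \<noteq> i" "prev i \<noteq> prev j" "prev j \<noteq> prev i" "prev i \<noteq> i" "prev j \<noteq> j"
          "i \<noteq> prev i" "j \<noteq> prev j" "prev (prev i) \<noteq> prev i" "prev i \<noteq> prev (prev i)"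
          "prev (prev j) \<noteq> prev j" "prev j \<noteq> prev (prev j)"
        using assms prev_inj[of i j] prev_neq[of i] prev_neq[of j] prev_neq[of "prev i"] prev_neq[of "prev j"]
          prev_in[of i] prev_in[of j] by metis+
      consider "k = i" | "k = j" "k \<noteq> i" | "k \<noteq> i" "k \<noteq> j" by blast
      then show ?thesis
        by cases (simp_all add: X ne root_op_X root_op_rules)
    next
      case (U k e)
      then show ?thesis using assms(3) by (simp add: root_op_U root_op_rules)
    qed
  qed (rule derivation_root_op)+
  then show ?thesis by simp
qed

text \<open>The relation [E, F] = H of sl_2 with \<open>root_op i 1 2\<close> as E and
  \<open>root_op i 2 1\<close> as F.\<close>

lemma root_op_bracket:
  assumes "i \<in> {1..r}"
  shows "root_op i 1 2 (root_op i 2 1 p) - root_op i 2 1 (root_op i 1 2 p) = weight_op i p"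
proof (rule derivation_ext[OF derivation_commutator derivation_weight_op])
  show "root_op i 1 2 (root_op i 2 1 (Var w)) - root_op i 2 1 (root_op i 1 2 (Var w)) = weight_op i (Var w)" for w
  proof (cases w)
    case (X k e f)
    have ne: "prev i \<noteq> i" "i \<noteq> prev i"
      using assms prev_neq[of i] by metis+
    show ?thesis
      using exhaust_2[of e] exhaust_2[of f]
      by (elim disjE) (simp_all add: X ne root_op_X root_op_rules weight_op_X)
  next
    case (U k e)
    then show ?thesis
      using exhaust_2[of e] by (elim disjE) (simp_all add: root_op_U root_op_rules weight_op_U)
  qed
qed (rule derivation_root_op)+

lemma pip_xd: "pip (xd u w p) q = pip p (xd w u q)"
  by (metis xd_def fischer_adjointD fischer_adjointD' fischer_adjoint_Var)

text \<open>Each summand \<open>xd u w\<close> has adjoint \<open>xd w u\<close>, so transposing a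
  matrix unit is taking the adjoint. This is what makes orthogonal complements of subrepresentations
  available.\<close>

lemma pip_root_op: "pip (root_op i a b p) q = pip p (root_op i b a q)"
  by (simp add: root_op_def P.ip_add_left P.ip_diff_left P.ip_add_right P.ip_diff_right pip_xd)

text \<open>The number of factors of positive weight at vertex \<open>i\<close>: the second row of
  X_i, the first column of X_(i-1), on which the inverse acts, and the second coordinate of the
  vector at \<open>i\<close>. Applying \<open>root_op i 1 2\<close> raises it by one.\<close>

definition up_deg :: "nat \<Rightarrow> var mon \<Rightarrow> nat" where
  "up_deg i \<alpha> = lookup \<alpha> (X i 2 1) + lookup \<alpha> (X i 2 2)
     + (lookup \<alpha> (X (prev i) 1 1) + lookup \<alpha> (X (prev i) 2 1)) + lookup \<alpha> (U i 2)"

definition low_deg :: "nat \<Rightarrow> var mon \<Rightarrow> nat" where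
  "low_deg i \<alpha> = lookup \<alpha> (X i 1 1) + lookup \<alpha> (X i 1 2)
     + (lookup \<alpha> (X (prev i) 1 2) + lookup \<alpha> (X (prev i) 2 2)) + lookup \<alpha> (U i 1)"

lemma lookup_xd_same: "lookup (xd u u p) \<alpha> = of_nat (lookup \<alpha> u) * lookup p \<alpha>"
proof (cases "lookup \<alpha> u = 0")
  case True
  then show ?thesis by (simp add: xd_def lookup_Var_mult_0)
next
  case False
  then obtain \<beta> where "\<alpha> = \<beta> + single u 1" by (rule mon_decompose)
  then show ?thesis
    by (simp only: xd_def lookup_Var_mult lookup_dv) (simp add: lookup_add)
qed

lemma lookup_weight_op:
  "lookup (weight_op i p) \<alpha> = (of_nat (up_deg i \<alpha>) - of_nat (low_deg i \<alpha>)) * lookup p \<alpha>"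
  by (simp add: weight_op_def lookup_add lookup_minus lookup_xd_same up_deg_def low_deg_def algebra_simps)

lemma keys_xd:
  assumes "\<alpha> \<in> keys (xd u w p)"
  shows "\<exists>\<beta>. \<alpha> = \<beta> + single u 1 \<and> \<beta> + single w 1 \<in> keys p"
proof -
  have nz: "lookup (Var u * dv w p) \<alpha> \<noteq> 0" using assms by (simp add: xd_def in_keys_iff)
  then have "lookup \<alpha> u \<noteq> 0" using lookup_Var_mult_0 by metis
  then obtain \<beta> where \<beta>: "\<alpha> = \<beta> + single u 1" by (rule mon_decompose)
  then have "lookup (dv w p) \<beta> \<noteq> 0" using nz by (simp only: lookup_Var_mult) simp
  then show ?thesis using \<beta> by (auto simp: lookup_dv in_keys_iff)
qed

lemma keys_root_op:
  assumes "\<alpha> \<in> keys (root_op i a b p)"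
  obtains \<beta> u w where "\<alpha> = \<beta> + single u 1" "\<beta> + single w 1 \<in> keys p"
    "(\<exists>c. u = X i b c \<and> w = X i a c) \<or> (\<exists>c. u = X (prev i) c a \<and> w = X (prev i) c b)
      \<or> (u = U i b \<and> w = U i a)"
proof -
  have "\<alpha> \<in> keys (xd (X i b 1) (X i a 1) p) \<or> \<alpha> \<in> keys (xd (X i b 2) (X i a 2) p)
      \<or> \<alpha> \<in> keys (xd (X (prev i) 1 a) (X (prev i) 1 b) p)
      \<or> \<alpha> \<in> keys (xd (X (prev i) 2 a) (X (prev i) 2 b) p) \<or> \<alpha> \<in> keys (xd (U i b) (U i a) p)"
    using assms unfolding root_op_def by (auto simp: in_keys_iff lookup_add lookup_minus)
  then show ?thesis
    by (elim disjE) (drule keys_xd, use that in blast)+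
qed

subsection \<open>Invariance under the group and under its Lie algebra\<close>

definition at_vertex :: "nat \<Rightarrow> complex^2^2 \<Rightarrow> tuple" where
  "at_vertex i A = (\<lambda>j. if j = i then A else mat 1)"

text \<open>No power of \<open>t\<close> beyond the first occurs: since
  \<open>prev i \<noteq> i\<close>, each X_k is multiplied by the transvection on at most one
  side.\<close>

lemma point_transvection:
  assumes "i \<in> {1..r}" "a \<noteq> b" "w \<in> vars r"
  shows "point (act_V r (at_vertex i (transvection a b t)) x) (act_U (at_vertex i (transvection a b t)) v) w
    = point x v w + t * ev (point x v) (root_op i a b (Var w))"
proof (cases w)
  case (X k c d)
  then have k: "k \<in> {1..r}" using assms(3) by simp
  have nxt: "nxt r k = i \<longleftrightarrow> k = prev i" using nxt_eq[OF assms(1) k] .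
  have ne: "prev i \<noteq> i" using prev_neq[OF assms(1)] .
  consider "k = i" "nxt r k \<noteq> i" | "k = prev i" "nxt r k = i" | "k \<noteq> i" "k \<noteq> prev i" "nxt r k \<noteq> i"
    using nxt ne by metis
  then show ?thesis
    by cases (simp_all add: X act_V_def at_vertex_def ne ne[symmetric] assms(2) root_op_X
        matrix_inv_transvection transvection_mult mult_transvection)
next
  case (U k c)
  then show ?thesis
    by (simp add: act_U_def at_vertex_def root_op_U transvection_mult_vec)
qed

lemma ev_transvection:
  assumes "in_range r p" "i \<in> {1..r}" "a \<noteq> b"
  shows "ev (point (act_V r (at_vertex i (transvection a b t)) x) (act_U (at_vertex i (transvection a b t)) v)) p
    = ev (\<lambda>w. point x v w + t * ev (point x v) (root_op i a b (Var w))) p"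
  by (rule ev_cong_in_range[OF assms(1)], rule point_transvection) (use assms in auto)

text \<open>Along a one-parameter group of transvections \<open>p\<close> is constant, and its
  derivative at \<open>t = 0\<close> is \<open>root_op i a b p\<close>.\<close>

lemma root_op_eq_0_if_SL_invariant:
  assumes p: "in_range r p" "SL_invariant r p" and i: "i \<in> {1..r}" and ab: "a \<noteq> b"
  shows "root_op i a b p = 0"
proof (rule pol_eq_0_if_ev_0)
  fix y
  obtain x v where y: "y = point x v" using point_surj by blast
  have "\<forall>j\<in>{1..r}. det (at_vertex i (transvection a b t) j) = 1" for t
    by (auto simp: at_vertex_def det_transvection ab)
  then have "fixed_by r (at_vertex i (transvection a b t)) p" for t
    using p(2) unfolding SL_invariant_def by blast
  then have "ev (\<lambda>w. y w + t * ev y (root_op i a b (Var w))) p = ev y p" for t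
    using ev_transvection[OF p(1) i ab, of t x v] by (simp add: fixed_by_def y)
  moreover have "((\<lambda>t. ev (\<lambda>w. y w + t * ev y (root_op i a b (Var w))) p) has_field_derivative
      ev y (root_op i a b p)) (at 0)"
    by (rule DERIV_ev_line) (auto intro: derivation_root_op)
  ultimately have "((\<lambda>t. ev y p) has_field_derivative ev y (root_op i a b p)) (at (0::complex))"
    by simp
  then show "ev y (root_op i a b p) = 0"
    using DERIV_unique DERIV_const by blast
qed

text \<open>The converse integrates: the derivative of \<open>p\<close> along the orbit vanishes for
  every \<open>t\<close>, not only at 0.\<close>

lemma fixed_by_transvection:
  assumes p: "in_range r p" "root_op i a b p = 0" and i: "i \<in> {1..r}" and ab: "a \<noteq> b"
  shows "fixed_by r (at_vertex i (transvection a b t)) p"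
  unfolding fixed_by_def
proof (intro allI)
  fix x v
  define y where "y = point x v"
  define \<xi> where "\<xi> w = ev y (root_op i a b (Var w))" for w
  \<comment> \<open>The velocity does not change along the line, because the matrix unit squares to
    zero. The line is therefore an integral curve of the derivation.\<close>
  have nil: "ev (\<lambda>w. y w + t * \<xi> w) (root_op i a b (Var w)) = \<xi> w" for t w
    using ab prev_neq[OF i]
    by (cases w) (auto simp: \<xi>_def root_op_X root_op_U)
  have "((\<lambda>t. ev (\<lambda>w. y w + t * \<xi> w) p) has_field_derivative 0) (at t)" for t
  proof -
    have "((\<lambda>h. ev (\<lambda>w. (y w + t * \<xi> w) + h * \<xi> w) p) has_field_derivative
        ev (\<lambda>w. y w + t * \<xi> w) (root_op i a b p)) (at 0)"
      by (rule DERIV_ev_line) (simp_all add: derivation_root_op nil)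
    then have "((\<lambda>h. ev (\<lambda>w. y w + (h + t) * \<xi> w) p) has_field_derivative 0) (at 0)"
      by (simp add: p algebra_simps)
    then show ?thesis
      using DERIV_shift[of "\<lambda>t. ev (\<lambda>w. y w + t * \<xi> w) p" 0 0 t] by simp
  qed
  then have "\<exists>c. \<forall>t\<in>UNIV. ev (\<lambda>w. y w + t * \<xi> w) p = c"
    by (intro has_field_derivative_zero_constant) auto
  then obtain c where c: "\<And>t. ev (\<lambda>w. y w + t * \<xi> w) p = c" by blast
  have "ev (point (act_V r (at_vertex i (transvection a b t)) x) (act_U (at_vertex i (transvection a b t)) v)) p
      = ev (\<lambda>w. y w + t * \<xi> w) p"
    unfolding ev_transvection[OF p(1) i ab] y_def \<xi>_def ..
  also have "\<dots> = ev (\<lambda>w. y w + 0 * \<xi> w) p"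
    by (simp only: c)
  also have "\<dots> = ev (point x v) p" by (simp add: y_def)
  finally show "ev (point (act_V r (at_vertex i (transvection a b t)) x) (act_U (at_vertex i (transvection a b t)) v)) p
    = ev (point x v) p" .
qed

lemma fixed_by_mult:
  assumes p: "in_range r p" and g: "\<forall>i\<in>{1..r}. invertible (g i)" and h: "\<forall>i\<in>{1..r}. invertible (h i)"
    and "fixed_by r g p" "fixed_by r h p"
  shows "fixed_by r (\<lambda>i. g i ** h i) p"
  unfolding fixed_by_def
proof (intro allI)
  fix x v
  have "ev (point (act_V r (\<lambda>i. g i ** h i) x) (act_U (\<lambda>i. g i ** h i) v)) p
      = ev (point (act_V r g (act_V r h x)) (act_U g (act_U h v))) p"
  proof (rule ev_cong_in_range[OF p], rule point_cong)
    fix i assume i: "i \<in> {1..r}"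
    then show "act_V r (\<lambda>i. g i ** h i) x i = act_V r g (act_V r h x) i"
      using g h nxt_in[OF i] by (simp add: act_V_def matrix_inv_mult matrix_mul_assoc)
    show "act_U (\<lambda>i. g i ** h i) v i = act_U g (act_U h v) i"
      by (simp add: act_U_def matrix_vector_mul_assoc)
  qed
  also have "\<dots> = ev (point x v) p"
    using assms(4,5) by (simp add: fixed_by_def)
  finally show "ev (point (act_V r (\<lambda>i. g i ** h i) x) (act_U (\<lambda>i. g i ** h i) v)) p = ev (point x v) p" .
qed

lemma fixed_by_cong:
  assumes p: "in_range r p" and gh: "\<And>i. i \<in> {1..r} \<Longrightarrow> g i = h i" and "fixed_by r h p"
  shows "fixed_by r g p"
  unfolding fixed_by_def
proof (intro allI)
  fix x v
  have "ev (point (act_V r g x) (act_U g v)) p = ev (point (act_V r h x) (act_U h v)) p"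
    by (rule ev_cong_in_range[OF p], rule point_cong) (use gh nxt_in in \<open>auto simp: act_V_def act_U_def\<close>)
  then show "ev (point (act_V r g x) (act_U g v)) p = ev (point x v) p"
    using assms(3) by (simp add: fixed_by_def)
qed

text \<open>At a single vertex, transvections generate SL_2, and a tuple is a product of tuples
  concentrated at one vertex.\<close>

lemma SL_invariant_if_root_op_eq_0:
  assumes p: "in_range r p" and op: "\<And>i a b. i \<in> {1..r} \<Longrightarrow> a \<noteq> b \<Longrightarrow> root_op i a b p = 0"
  shows "SL_invariant r p"
  unfolding SL_invariant_def
proof (intro allI impI)
  fix g :: tuple
  assume g: "\<forall>i\<in>{1..r}. det (g i) = 1"
  have inv: "\<forall>i\<in>{1..r}. invertible (at_vertex j A i)" if "det A = 1" for j A
    using that by (auto simp: at_vertex_def invertible_det_1)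
  have single: "fixed_by r (at_vertex i A) p" if "i \<in> {1..r}" "det A = 1" for i A
    using that(2)
  proof (induction rule: SL2_transvection_induct)
    case (transvection a b t)
    then show ?case using fixed_by_transvection[OF p op that(1)] that(1) by blast
  next
    case (mult A B)
    have "fixed_by r (\<lambda>j. at_vertex i A j ** at_vertex i B j) p"
      by (intro fixed_by_mult p inv mult)
    then show ?case
      by (rule fixed_by_cong[OF p, rotated]) (simp add: at_vertex_def)
  qed
  \<comment> \<open>The entries of \<open>g\<close> are filled in one vertex at a time.\<close>
  have "fixed_by r (\<lambda>i. if i \<in> {1..k} then g i else mat 1) p" if "k \<le> r" for k
    using that
  proof (induction k)
    case 0
    then show ?case by (simp add: fixed_by_def act_V_def act_U_def)
  next
    case (Suc k)
    have "Suc k \<in> {1..r}" using Suc.prems by simp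
    moreover from this g have "det (g (Suc k)) = 1" by blast
    moreover have "\<forall>i\<in>{1..r}. invertible (if i \<in> {1..k} then g i else mat 1)"
      using g by (simp add: invertible_det_1)
    ultimately have "fixed_by r (\<lambda>i. (if i \<in> {1..k} then g i else mat 1) ** at_vertex (Suc k) (g (Suc k)) i) p"
      using Suc by (intro fixed_by_mult p inv single) simp_all
    then show ?case
      by (rule fixed_by_cong[OF p, rotated]) (auto simp: at_vertex_def le_Suc_eq)
  qed
  from this[of r] have "fixed_by r (\<lambda>i. if i \<in> {1..r} then g i else mat 1) p" by simp
  then show "fixed_by r g p"
    by (rule fixed_by_cong[OF p, rotated]) simp
qed

end

section \<open>Leading monomials\<close>

definition wdeg :: "('v \<Rightarrow> nat) \<Rightarrow> 'v mon \<Rightarrow> nat" where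
  "wdeg w \<alpha> = (\<Sum>v\<in>keys \<alpha>. lookup \<alpha> v * w v)"

lemma wdeg_superset:
  "finite S \<Longrightarrow> keys \<alpha> \<subseteq> S \<Longrightarrow> wdeg w \<alpha> = (\<Sum>v\<in>S. lookup \<alpha> v * w v)"
  unfolding wdeg_def by (rule sum.mono_neutral_left) (auto simp: in_keys_iff)

lemma wdeg_add: "wdeg w (\<alpha> + \<beta>) = wdeg w \<alpha> + wdeg w \<beta>"
proof -
  let ?S = "keys \<alpha> \<union> keys \<beta>"
  have "keys (\<alpha> + \<beta>) \<subseteq> ?S" by (rule Poly_Mapping.keys_add)
  then show ?thesis
    by (simp add: wdeg_superset[of ?S] lookup_add sum.distrib distrib_right)
qed

lemma wdeg_0 [simp]: "wdeg w 0 = 0"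
  by (simp add: wdeg_def)

lemma wdeg_single [simp]: "wdeg w (single v n) = n * w v"
  by (cases "n = 0") (auto simp: wdeg_def)

lemma keys_mult_elim:
  assumes "\<delta> \<in> keys (p * q :: 'v pol)"
  obtains \<alpha> \<beta> where "\<alpha> \<in> keys p" "\<beta> \<in> keys q" "\<delta> = \<alpha> + \<beta>"
  using keys_mult[of p q] assms by blast

definition wless :: "('v \<Rightarrow> nat) \<Rightarrow> 'v pol \<Rightarrow> nat \<Rightarrow> bool" where
  "wless w p W \<longleftrightarrow> (\<forall>\<alpha>\<in>keys p. wdeg w \<alpha> < W)"

text \<open>A grading by weights takes the place of a monomial order, so a polynomial has a leading
  monomial only if its part of top weight is a single term. A suitable choice of weights achieves
  this for the trace and the determinant.\<close>

definition lead :: "('v \<Rightarrow> nat) \<Rightarrow> 'v pol \<Rightarrow> 'v mon \<Rightarrow> bool" where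
  "lead w p \<mu> \<longleftrightarrow> lookup p \<mu> \<noteq> 0 \<and> wless w (p - single \<mu> (lookup p \<mu>)) (wdeg w \<mu>)"

lemma keys_add_elim: "\<alpha> \<in> keys (p + q :: 'v pol) \<Longrightarrow> \<alpha> \<in> keys p \<or> \<alpha> \<in> keys q"
  by (auto simp: in_keys_iff lookup_add)

lemma wless_0 [simp]: "wless w 0 W"
  by (simp add: wless_def)

lemma wless_add: "wless w p W \<Longrightarrow> wless w q W \<Longrightarrow> wless w (p + q) W"
  by (auto simp: wless_def dest: keys_add_elim)

lemma wless_uminus: "wless w p W \<Longrightarrow> wless w (- p) W"
  by (auto simp: wless_def in_keys_iff)

lemma wless_mono: "wless w p W \<Longrightarrow> W \<le> W' \<Longrightarrow> wless w p W'"
  by (auto simp: wless_def)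

lemma wless_mult_Var: "wless w p W \<Longrightarrow> wless w (p * Var v) (W + w v)"
  by (auto simp: wless_def wdeg_add Var_def elim!: keys_mult_elim)

lemma wless_Var: "w v < W \<Longrightarrow> wless w (Var v) W"
  by (auto simp: wless_def Var_def)

lemma lead_add: "lead w p \<mu> \<Longrightarrow> wless w q (wdeg w \<mu>) \<Longrightarrow> lead w (p + q) \<mu>"
proof -
  assume p: "lead w p \<mu>" and q: "wless w q (wdeg w \<mu>)"
  have "lookup q \<mu> = 0"
    using q by (auto simp: wless_def in_keys_iff)
  moreover have "p + q - single \<mu> (lookup p \<mu>) = (p - single \<mu> (lookup p \<mu>)) + q" by simp
  moreover have "wless w ((p - single \<mu> (lookup p \<mu>)) + q) (wdeg w \<mu>)"
    using p q by (intro wless_add) (auto simp: lead_def)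
  ultimately have "wless w (p + q - single \<mu> (lookup (p + q) \<mu>)) (wdeg w \<mu>)" "lookup (p + q) \<mu> = lookup p \<mu>"
    by (simp_all only: lookup_add add_0_right)
  then show ?thesis
    using p unfolding lead_def by metis
qed

lemma lead_Var: "lead w (Var v) (single v 1)"
  by (simp add: lead_def Var_def)

lemma lead_1: "lead w 1 0"
  by (simp add: lead_def lookup_one)

lemma lead_uminus: "lead w p \<mu> \<Longrightarrow> lead w (- p) \<mu>"
  using wless_uminus[of w "p - single \<mu> (lookup p \<mu>)"]
  by (simp add: lead_def single_uminus)

lemma top_key:
  assumes "f \<noteq> (0 :: 'v pol)"
  obtains \<alpha> where "\<alpha> \<in> keys f" "\<And>\<beta>. \<beta> \<in> keys f \<Longrightarrow> wdeg w \<beta> \<le> wdeg w \<alpha>"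
proof -
  have "keys f \<noteq> {}"
    using assms by (metis empty_iff in_keys_iff lookup_zero poly_mapping_eqI)
  then have "Max (wdeg w ` keys f) \<in> wdeg w ` keys f" by (intro Max_in) auto
  then obtain \<alpha> where \<alpha>: "\<alpha> \<in> keys f" "wdeg w \<alpha> = Max (wdeg w ` keys f)" by auto
  then show ?thesis by (intro that[of \<alpha>]) auto
qed

text \<open>In the top weight of a product only the leading term of \<open>p\<close> contributes,
  even if \<open>f\<close> itself has no leading monomial.\<close>

lemma lookup_mult_lead:
  assumes p: "lead w p \<mu>" and f: "\<And>\<beta>. \<beta> \<in> keys f \<Longrightarrow> wdeg w \<beta> \<le> W"
    and \<delta>: "wdeg w \<delta> = wdeg w \<mu> + W"
  shows "lookup (p * f) \<delta> = lookup (single \<mu> (lookup p \<mu>) * f) \<delta>"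
proof -
  define p' where "p' = p - single \<mu> (lookup p \<mu>)"
  have "\<delta> \<notin> keys (p' * f)"
  proof
    assume "\<delta> \<in> keys (p' * f)"
    then obtain \<alpha> \<beta> where "\<alpha> \<in> keys p'" "\<beta> \<in> keys f" "\<delta> = \<alpha> + \<beta>" by (rule keys_mult_elim)
    with p f[of \<beta>] \<delta> show False
      by (auto simp: lead_def wless_def wdeg_add simp flip: p'_def)
  qed
  moreover have "p * f = single \<mu> (lookup p \<mu>) * f + p' * f"
    by (simp add: p'_def algebra_simps)
  ultimately show ?thesis by (simp add: lookup_add in_keys_iff)
qed

lemma lead_keys_le: "lead w p \<mu> \<Longrightarrow> \<alpha> \<in> keys p \<Longrightarrow> wdeg w \<alpha> \<le> wdeg w \<mu>"
  by (cases "\<alpha> = \<mu>") (auto simp: lead_def wless_def in_keys_iff lookup_minus lookup_single when_def intro: less_imp_le)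

lemma lead_mult_keys_le:
  assumes p: "lead w p \<mu>" and f: "\<And>\<beta>. \<beta> \<in> keys f \<Longrightarrow> wdeg w \<beta> \<le> W" and "\<delta> \<in> keys (p * f)"
  shows "wdeg w \<delta> \<le> wdeg w \<mu> + W"
proof -
  obtain \<alpha> \<beta> where "\<alpha> \<in> keys p" "\<beta> \<in> keys f" "\<delta> = \<alpha> + \<beta>" using assms(3) by (rule keys_mult_elim)
  then show ?thesis using lead_keys_le[OF p, of \<alpha>] f[of \<beta>] by (simp add: wdeg_add)
qed

lemma lead_mult:
  assumes p: "lead w p \<mu>" and q: "lead w q \<nu>"
  shows "lead w (p * q) (\<mu> + \<nu>)"
proof -
  let ?a = "lookup p \<mu>" and ?b = "lookup q \<nu>"
  define p' q' where "p' = p - single \<mu> ?a" and "q' = q - single \<nu> ?b"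
  have l: "wless w p' (wdeg w \<mu>)" "wless w q' (wdeg w \<nu>)" "?a \<noteq> 0" "?b \<noteq> 0"
    using p q by (auto simp: lead_def p'_def q'_def)
  have c: "lookup (p * q) (\<mu> + \<nu>) = ?a * ?b"
    using lookup_mult_lead[OF p, of q "wdeg w \<nu>" "\<mu> + \<nu>"] lead_keys_le[OF q]
    by (simp add: wdeg_add lookup_single_mult)
  have "single \<mu> ?a * q' + p' * q = p * q - single \<mu> ?a * single \<nu> ?b"
    by (simp add: p'_def q'_def algebra_simps)
  then have e: "p * q - single (\<mu> + \<nu>) (?a * ?b) = single \<mu> ?a * q' + p' * q"
    by (simp add: mult_single)
  have "wless w (single \<mu> ?a * q' + p' * q) (wdeg w \<mu> + wdeg w \<nu>)"
  proof (rule wless_add)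
    show "wless w (single \<mu> ?a * q') (wdeg w \<mu> + wdeg w \<nu>)"
      using l(2,3) by (auto simp: wless_def wdeg_add elim!: keys_mult_elim)
    show "wless w (p' * q) (wdeg w \<mu> + wdeg w \<nu>)"
      unfolding wless_def
    proof
      fix \<delta> assume "\<delta> \<in> keys (p' * q)"
      then obtain \<alpha> \<beta> where "\<alpha> \<in> keys p'" "\<beta> \<in> keys q" "\<delta> = \<alpha> + \<beta>" by (rule keys_mult_elim)
      then show "wdeg w \<delta> < wdeg w \<mu> + wdeg w \<nu>"
        using l(1) lead_keys_le[OF q, of \<beta>] by (auto simp: wless_def wdeg_add intro: add_less_le_mono)
    qed
  qed
  then show ?thesis
    using l by (simp add: lead_def c e wdeg_add)
qed

lemma lead_prod:
  assumes "finite I" "\<And>i. i \<in> I \<Longrightarrow> lead w (f i) (\<mu> i)"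
  shows "lead w (\<Prod>i\<in>I. f i) (\<Sum>i\<in>I. \<mu> i)"
  using assms by (induction I) (auto intro: lead_1 lead_mult)

lemma lead_mult_top:
  assumes p: "lead w p \<mu>" and \<alpha>: "\<alpha> \<in> keys f" "\<And>\<beta>. \<beta> \<in> keys f \<Longrightarrow> wdeg w \<beta> \<le> wdeg w \<alpha>"
  shows "\<mu> + \<alpha> \<in> keys (p * f)"
  using lookup_mult_lead[OF p, of f "wdeg w \<alpha>" "\<mu> + \<alpha>"] p \<alpha>
  by (simp add: wdeg_add lookup_single_mult in_keys_iff lead_def)

lemma lead_mult_eq_0:
  assumes "lead w p \<mu>" "p * f = 0"
  shows "f = 0"
  using lead_mult_top[OF assms(1)] top_key[of f w] assms(2) by (metis empty_iff keys_zero)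

lemma lead_mult_cancel:
  assumes "lead w p \<mu>" "p * f = p * g"
  shows "f = g"
  using lead_mult_eq_0[OF assms(1), of "f - g"] assms(2) by (simp add: algebra_simps)

definition reduced :: "'v mon \<Rightarrow> 'v pol \<Rightarrow> bool" where
  "reduced \<mu> f \<longleftrightarrow> (\<forall>\<alpha>\<in>keys f. \<forall>\<beta>. \<alpha> \<noteq> \<mu> + \<beta>)"

lemma reduced_add: "reduced \<mu> f \<Longrightarrow> reduced \<mu> g \<Longrightarrow> reduced \<mu> (f + g)"
  by (auto simp: reduced_def dest: keys_add_elim)

text \<open>Two polynomials with coprime leading monomials form a regular sequence.\<close>

lemma coprime_lead_reduced_eq_0:
  assumes p: "lead w p \<mu>" and q: "lead w q \<nu>" and disj: "keys \<mu> \<inter> keys \<nu> = {}"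
    and f: "reduced \<nu> f" and eq: "p * f = q * g"
  shows "f = 0"
proof (rule ccontr)
  assume "f \<noteq> 0"
  then obtain \<alpha> where \<alpha>: "\<alpha> \<in> keys f" "\<And>\<beta>. \<beta> \<in> keys f \<Longrightarrow> wdeg w \<beta> \<le> wdeg w \<alpha>"
    using top_key[of f w] by blast
  have \<delta>: "\<mu> + \<alpha> \<in> keys (q * g)" using lead_mult_top[OF p \<alpha>] eq by simp
  then have "g \<noteq> 0" by auto
  then obtain \<sigma> where \<sigma>: "\<sigma> \<in> keys g" "\<And>\<beta>. \<beta> \<in> keys g \<Longrightarrow> wdeg w \<beta> \<le> wdeg w \<sigma>"
    using top_key[of g w] by blast
  have "\<nu> + \<sigma> \<in> keys (p * f)" using lead_mult_top[OF q \<sigma>] eq by simp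
  then have "wdeg w (\<nu> + \<sigma>) \<le> wdeg w \<mu> + wdeg w \<alpha>"
    using lead_mult_keys_le[OF p, of f "wdeg w \<alpha>"] \<alpha>(2) by blast
  moreover have "wdeg w (\<mu> + \<alpha>) \<le> wdeg w \<nu> + wdeg w \<sigma>"
    using lead_mult_keys_le[OF q, of g "wdeg w \<sigma>"] \<sigma>(2) \<delta> by blast
  ultimately have "wdeg w (\<mu> + \<alpha>) = wdeg w \<nu> + wdeg w \<sigma>"
    by (simp add: wdeg_add)
  then have "lookup (single \<nu> (lookup q \<nu>) * g) (\<mu> + \<alpha>) \<noteq> 0"
    using lookup_mult_lead[OF q, of g "wdeg w \<sigma>"] \<sigma>(2) \<delta> by (simp add: in_keys_iff)
  then obtain \<beta> where \<beta>: "\<mu> + \<alpha> = \<nu> + \<beta>"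
    using lookup_single_mult_not by blast
  \<comment> \<open>The monomial \<open>\<nu>\<close> divides \<open>\<mu> + \<alpha>\<close> and
    shares no variable with \<open>\<mu>\<close>, so it divides \<open>\<alpha>\<close>, which
    contradicts that \<open>f\<close> is reduced.\<close>
  have "\<alpha> = \<nu> + (\<alpha> - \<nu>)"
  proof (rule poly_mapping_eqI)
    fix v
    have "lookup \<nu> v \<le> lookup \<alpha> v"
    proof (cases "v \<in> keys \<nu>")
      case True
      then have "lookup \<mu> v = 0" using disj by (auto simp: in_keys_iff)
      then show ?thesis using arg_cong[OF \<beta>, of "\<lambda>\<gamma>. lookup \<gamma> v"] by (simp add: lookup_add)
    qed (simp add: in_keys_iff)
    then show "lookup \<alpha> v = lookup (\<nu> + (\<alpha> - \<nu>)) v"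
      by (simp add: lookup_add lookup_minus)
  qed
  then show False using f \<alpha>(1) by (auto simp: reduced_def)
qed

section \<open>Multihomogeneous invariants and harmonics\<close>

definition degX :: "nat \<Rightarrow> var mon \<Rightarrow> nat" where
  "degX i \<alpha> = lookup \<alpha> (X i 1 1) + lookup \<alpha> (X i 1 2) + lookup \<alpha> (X i 2 1) + lookup \<alpha> (X i 2 2)"

definition degU :: "nat \<Rightarrow> var mon \<Rightarrow> nat" where
  "degU i \<alpha> = lookup \<alpha> (U i 1) + lookup \<alpha> (U i 2)"

lemma degX_add [simp]: "degX i (\<alpha> + \<beta>) = degX i \<alpha> + degX i \<beta>"
  and degU_add [simp]: "degU i (\<alpha> + \<beta>) = degU i \<alpha> + degU i \<beta>"
  and degX_0 [simp]: "degX i 0 = 0" and degU_0 [simp]: "degU i 0 = 0"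
  by (simp_all add: degX_def degU_def lookup_add)

lemma degX_single [simp]:
  "degX i (single (X k a b) n) = (if k = i then n else 0)" "degX i (single (U k a) n) = 0"
  using exhaust_2[of a] exhaust_2[of b] by (auto simp: degX_def lookup_single when_def)

lemma degU_single [simp]:
  "degU i (single (X k a b) n) = 0" "degU i (single (U k a) n) = (if k = i then n else 0)"
  using exhaust_2[of a] by (auto simp: degU_def lookup_single when_def)

text \<open>Degrees in the \<open>X\<close> variables are integers, so that \<open>hom_space (n - e) s\<close> makes sense
  (and is \<open>{0}\<close>) when some \<open>n i\<close> vanishes.\<close>

definition mons :: "(nat \<Rightarrow> int) \<Rightarrow> (nat \<Rightarrow> nat) \<Rightarrow> var mon set" where
  "mons n s = {\<alpha>. (\<forall>i. int (degX i \<alpha>) = n i) \<and> (\<forall>i. degU i \<alpha> = s i)}"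

definition hom_space :: "(nat \<Rightarrow> int) \<Rightarrow> (nat \<Rightarrow> nat) \<Rightarrow> var pol set" where
  "hom_space n s = {p. keys p \<subseteq> mons n s}"

lemma subspace_keys: "P.V.subspace {p. keys p \<subseteq> M}"
  by (rule P.V.subspaceI) (auto simp: pscale_def in_keys_iff lookup_add subset_iff, metis add_0)

lemma fin_dim_keys:
  assumes "finite M"
  shows "fin_dim pscale {p :: 'v pol. keys p \<subseteq> M}"
  unfolding fin_dim_def
proof (intro exI conjI subsetI)
  show "finite ((\<lambda>\<alpha>. single \<alpha> 1) ` M)" using assms by simp
  fix p :: "'v pol" assume p: "p \<in> {p. keys p \<subseteq> M}"
  have "(\<Sum>\<alpha>\<in>keys p. pscale (lookup p \<alpha>) (single \<alpha> 1)) \<in> P.V.span ((\<lambda>\<alpha>. single \<alpha> 1) ` M)"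
    using p by (intro P.V.span_sum P.V.span_scale P.V.span_base) auto
  then show "p \<in> P.V.span ((\<lambda>\<alpha>. single \<alpha> 1) ` M)"
    by (simp add: pscale_def single_eq_Const_mult[symmetric] pol_sum_single[symmetric])
qed

lemma subspace_hom_space: "P.V.subspace (hom_space n s)"
  unfolding hom_space_def by (rule subspace_keys)

lemma hom_space_mult:
  "p \<in> hom_space n s \<Longrightarrow> q \<in> hom_space m t \<Longrightarrow> p * q \<in> hom_space (\<lambda>i. n i + m i) (\<lambda>i. s i + t i)"
  by (auto simp: hom_space_def mons_def subset_iff elim!: keys_mult_elim)

lemma single_in_hom_space: "\<alpha> \<in> mons n s \<Longrightarrow> single \<alpha> c \<in> hom_space n s"
  by (auto simp: hom_space_def)

lemma Var_X_in_hom_space: "Var (X k a b) \<in> hom_space (\<lambda>i. if i = k then 1 else 0) (\<lambda>_. 0)"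
  unfolding Var_def by (rule single_in_hom_space) (simp add: mons_def)

lemma mons_add_cancel:
  assumes "\<alpha> \<in> mons m (\<lambda>_. 0)" "\<alpha> + \<gamma> \<in> mons n s"
  shows "\<gamma> \<in> mons (\<lambda>i. n i - m i) s"
  unfolding mons_def mem_Collect_eq
proof (intro conjI allI)
  fix i
  have "int (degX i \<alpha>) = m i" "degU i \<alpha> = 0" "int (degX i (\<alpha> + \<gamma>)) = n i" "degU i (\<alpha> + \<gamma>) = s i"
    using assms unfolding mons_def by blast+
  then show "int (degX i \<gamma>) = n i - m i" "degU i \<gamma> = s i"
    by simp_all
qed

lemma pd_hom_space:
  assumes "p \<in> hom_space m (\<lambda>_. 0)" "q \<in> hom_space n s"
  shows "pd p q \<in> hom_space (\<lambda>i. n i - m i) s"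
proof -
  have "\<gamma> \<in> mons (\<lambda>i. n i - m i) s" if \<gamma>: "\<gamma> \<in> keys (pd p q)" for \<gamma>
  proof -
    obtain \<alpha> where \<alpha>: "\<alpha> \<in> keys p" "\<alpha> + \<gamma> \<in> keys q" using keys_pd[OF \<gamma>] by blast
    then have "\<alpha> \<in> mons m (\<lambda>_. 0)" "\<alpha> + \<gamma> \<in> mons n s"
      using assms by (auto simp: hom_space_def)
    then show ?thesis by (rule mons_add_cancel)
  qed
  then show ?thesis by (auto simp: hom_space_def)
qed

context cyclic
begin

text \<open>\<open>mons\<close> prescribes a degree at every natural number. Degrees that vanish
  outside \<open>{1..r}\<close> confine the monomials to \<open>vars r\<close> and leave finitely
  many of them.\<close>

definition supported :: "(nat \<Rightarrow> 'z::zero) \<Rightarrow> bool" where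
  "supported n \<longleftrightarrow> (\<forall>i. i \<notin> {1..r} \<longrightarrow> n i = 0)"

lemma mons_in_range:
  assumes "supported n" "supported s" "\<alpha> \<in> mons n s"
  shows "keys \<alpha> \<subseteq> vars r"
proof
  fix v assume v: "v \<in> keys \<alpha>"
  show "v \<in> vars r"
  proof (cases v)
    case (X i a b)
    then have "degX i \<alpha> \<noteq> 0"
      using v exhaust_2[of a] exhaust_2[of b] by (auto simp: degX_def in_keys_iff)
    moreover have "int (degX i \<alpha>) = n i" using assms(3) by (simp add: mons_def)
    ultimately have "n i \<noteq> 0" by simp
    then show ?thesis using assms(1) X by (auto simp: supported_def)
  next
    case (U i a)
    then have "degU i \<alpha> \<noteq> 0"
      using v exhaust_2[of a] by (auto simp: degU_def in_keys_iff)
    moreover have "degU i \<alpha> = s i" using assms(3) by (simp add: mons_def)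
    ultimately have "s i \<noteq> 0" by simp
    then show ?thesis using assms(2) U by (auto simp: supported_def)
  qed
qed

lemma finite_vars: "finite (vars r)"
proof -
  have "vars r = (\<Union>i\<in>{1..r}. \<Union>a. (\<Union>b. {X i a b}) \<union> {U i a})"
    unfolding vars_def by blast
  then show ?thesis by simp
qed

lemma finite_mons:
  assumes "supported n" "supported s"
  shows "finite (mons n s)"
proof -
  define N where "N = (\<Sum>i\<in>{1..r}. nat (n i)) + (\<Sum>i\<in>{1..r}. s i)"
  have bound: "lookup \<alpha> v \<le> N" if \<alpha>: "\<alpha> \<in> mons n s" and v: "v \<in> vars r" for \<alpha> v
  proof (cases v)
    case (X i a b)
    then have "lookup \<alpha> v \<le> degX i \<alpha>"
      using exhaust_2[of a] exhaust_2[of b] by (auto simp: degX_def)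
    also have "\<dots> = nat (int (degX i \<alpha>))" by simp
    also have "\<dots> = nat (n i)" using \<alpha> by (simp add: mons_def)
    also have "\<dots> \<le> (\<Sum>i\<in>{1..r}. nat (n i))" using v X by (intro member_le_sum) auto
    finally show ?thesis by (simp add: N_def)
  next
    case (U i a)
    then have "lookup \<alpha> v \<le> degU i \<alpha>"
      using exhaust_2[of a] by (auto simp: degU_def)
    also have "\<dots> = s i" using \<alpha> by (auto simp: mons_def)
    also have "\<dots> \<le> (\<Sum>i\<in>{1..r}. s i)" using v U by (intro member_le_sum) auto
    finally show ?thesis by (simp add: N_def)
  qed
  have "inj_on (\<lambda>\<alpha>. restrict (lookup \<alpha>) (vars r)) (mons n s)"
  proof (rule inj_onI, rule poly_mapping_eqI)
    fix \<alpha> \<beta> v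
    assume ab: "\<alpha> \<in> mons n s" "\<beta> \<in> mons n s" "restrict (lookup \<alpha>) (vars r) = restrict (lookup \<beta>) (vars r)"
    show "lookup \<alpha> v = lookup \<beta> v"
    proof (cases "v \<in> vars r")
      case True
      then show ?thesis using fun_cong[OF ab(3), of v] by simp
    next
      case False
      then have "v \<notin> keys \<alpha>" "v \<notin> keys \<beta>" using mons_in_range[OF assms] ab by blast+
      then show ?thesis by (simp add: in_keys_iff)
    qed
  qed
  moreover have "(\<lambda>\<alpha>. restrict (lookup \<alpha>) (vars r)) ` mons n s \<subseteq> vars r \<rightarrow>\<^sub>E {..N}"
    by (rule image_subsetI, rule restrict_PiE_iff[THEN iffD2]) (simp add: bound)
  moreover have "finite (vars r \<rightarrow>\<^sub>E {..N})" by (intro finite_PiE finite_vars) simp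
  ultimately show ?thesis by (rule inj_on_finite)
qed

lemma hom_space_in_range:
  assumes "supported n" "supported s" "p \<in> hom_space n s"
  shows "in_range r p"
  unfolding in_range_def using mons_in_range[OF assms(1,2)] assms(3) by (auto simp: hom_space_def)

section \<open>Trace and determinant of the product around the cycle\<close>

definition ones :: "nat \<Rightarrow> int" where
  "ones i = (if i \<in> {1..r} then 1 else 0)"

lemma supported_ones: "supported n \<Longrightarrow> supported (\<lambda>i. n i - k * ones i)"
  by (simp add: supported_def ones_def)

text \<open>The entry \<open>a b\<close> of the matrix product X_1 ... X_k, as a sum over
  paths.\<close>

fun path_poly :: "nat \<Rightarrow> 2 \<Rightarrow> 2 \<Rightarrow> var pol" where
  "path_poly 0 a b = (if a = b then 1 else 0)"
| "path_poly (Suc k) a b =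
     path_poly k a 1 * Var (X (Suc k) 1 b) + path_poly k a 2 * Var (X (Suc k) 2 b)"

definition trace_poly :: "var pol" where
  "trace_poly = path_poly r 1 1 + path_poly r 2 2"

definition det1_poly :: "nat \<Rightarrow> var pol" where
  "det1_poly i = Var (X i 1 1) * Var (X i 2 2) - Var (X i 1 2) * Var (X i 2 1)"

definition det_poly :: "var pol" where
  "det_poly = (\<Prod>i\<in>{1..r}. det1_poly i)"

fun mat_path :: "tuple \<Rightarrow> nat \<Rightarrow> complex^2^2" where
  "mat_path x 0 = mat 1"
| "mat_path x (Suc k) = mat_path x k ** x (Suc k)"

lemma ev_path_poly: "ev (point x v) (path_poly k a b) = mat_path x k $ a $ b"
proof (induction k arbitrary: a b)
  case 0
  then show ?case using exhaust_2[of a] exhaust_2[of b] by (simp add: mat_def)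
next
  case (Suc k)
  then show ?case by (simp add: matrix_mult_2)
qed

lemma ev_trace_poly: "ev (point x v) trace_poly = trace (mat_path x r)"
  by (simp add: trace_poly_def ev_path_poly trace_def sum_2)

lemma ev_det_poly: "ev (point x v) det_poly = (\<Prod>i\<in>{1..r}. det (x i))"
  by (simp add: det_poly_def det1_poly_def det_2)

lemma conj_cancel:
  assumes "invertible (B :: complex^2^2)"
  shows "G ** A ** matrix_inv B ** (B ** C ** D) = G ** (A ** C) ** D"
proof -
  have "G ** A ** matrix_inv B ** (B ** C ** D) = G ** A ** (matrix_inv B ** B) ** C ** D"
    by (simp add: matrix_mul_assoc)
  also have "\<dots> = G ** A ** C ** D"
    by (simp only: matrix_inv_left[OF assms] matrix_mul_rid)
  finally show ?thesis by (simp add: matrix_mul_assoc)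
qed

text \<open>Inner group elements cancel in the product. The bound \<open>k < r\<close> keeps away
  from the last arrow, where the path closes up at vertex 1.\<close>

lemma mat_path_act:
  assumes g: "\<forall>i\<in>{1..r}. invertible (g i)" and "k < r"
  shows "mat_path (act_V r g x) k = g 1 ** mat_path x k ** matrix_inv (g (Suc k))"
  using assms(2)
proof (induction k)
  case 0
  then show ?case using g r2 matrix_inv_right[of "g 1"] by (simp add: One_nat_def)
next
  case (Suc k)
  have "invertible (g (Suc k))" using g Suc.prems by auto
  then have "g 1 ** mat_path x k ** matrix_inv (g (Suc k)) ** (g (Suc k) ** x (Suc k) ** matrix_inv (g (Suc (Suc k))))
    = g 1 ** (mat_path x k ** x (Suc k)) ** matrix_inv (g (Suc (Suc k)))"
    by (rule conj_cancel)
  then show ?case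
    using Suc by (simp add: act_V_def nxt_def flip: Suc_eq_plus1)
qed

lemma trace_conj:
  assumes "invertible (g :: complex^2^2)"
  shows "trace (g ** A ** matrix_inv g) = trace A"
proof -
  have "trace (g ** A ** matrix_inv g) = trace (matrix_inv g ** (g ** A))"
    by (rule trace_mul_sym)
  also have "matrix_inv g ** (g ** A) = A"
    by (simp only: matrix_mul_assoc matrix_inv_left[OF assms] matrix_mul_lid)
  finally show ?thesis .
qed

lemma trace_poly_invariant:
  assumes g: "\<forall>i\<in>{1..r}. invertible (g i)"
  shows "ev (point (act_V r g x) v') trace_poly = ev (point x v) trace_poly"
proof -
  obtain k where k: "r = Suc k" using r2 by (cases r) auto
  have "invertible (g r)" using g r2 by auto
  then have "g 1 ** mat_path x k ** matrix_inv (g r) ** (g r ** x r ** matrix_inv (g 1))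
    = g 1 ** (mat_path x k ** x r) ** matrix_inv (g 1)"
    by (rule conj_cancel)
  then have "mat_path (act_V r g x) r = g 1 ** mat_path x r ** matrix_inv (g 1)"
    using mat_path_act[OF g, of k x] by (simp add: k act_V_def nxt_def)
  then show ?thesis
    using g r2 by (simp add: ev_trace_poly trace_conj)
qed

lemma bij_nxt: "bij_betw (nxt r) {1..r} {1..r}"
  by (rule bij_betw_byWitness[of _ prev]) (use nxt_prev prev_nxt nxt_in prev_in in blast)+

lemma det_poly_invariant:
  assumes g: "\<forall>i\<in>{1..r}. invertible (g i)"
  shows "ev (point (act_V r g x) v') det_poly = ev (point x v) det_poly"
proof -
  have d: "det (g i) * det (matrix_inv (g i)) = 1" if "i \<in> {1..r}" for i
    using g that matrix_inv_right[of "g i"] det_I by (metis det_mul)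
  have "(\<Prod>i\<in>{1..r}. det (act_V r g x i))
      = (\<Prod>i\<in>{1..r}. det (g i)) * (\<Prod>i\<in>{1..r}. det (x i)) * (\<Prod>i\<in>{1..r}. det (matrix_inv (g (nxt r i))))"
    by (simp add: act_V_def det_mul prod.distrib)
  also have "(\<Prod>i\<in>{1..r}. det (matrix_inv (g (nxt r i)))) = (\<Prod>i\<in>{1..r}. det (matrix_inv (g i)))"
    by (rule prod.reindex_bij_betw[OF bij_nxt])
  also have "(\<Prod>i\<in>{1..r}. det (g i)) * (\<Prod>i\<in>{1..r}. det (x i)) * \<dots>
      = (\<Prod>i\<in>{1..r}. det (x i)) * (\<Prod>i\<in>{1..r}. det (g i) * det (matrix_inv (g i)))"
    by (simp add: prod.distrib)
  also have "\<dots> = (\<Prod>i\<in>{1..r}. det (x i))" by (simp add: d)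
  finally show ?thesis by (simp add: ev_det_poly)
qed

lemma path_poly_in_hom_space:
  "path_poly k a b \<in> hom_space (\<lambda>i. if i \<in> {1..k} then 1 else 0) (\<lambda>_. 0)"
proof (induction k arbitrary: a b)
  case 0
  then show ?case by (auto simp: hom_space_def mons_def)
next
  case (Suc k)
  have "path_poly k a c * Var (X (Suc k) c b) \<in> hom_space (\<lambda>i. if i \<in> {1..Suc k} then 1 else 0) (\<lambda>_. 0)" for c
  proof -
    have "(\<lambda>i. (if i \<in> {1..k} then 1 else 0) + (if i = Suc k then 1 else 0 :: int))
        = (\<lambda>i. if i \<in> {1..Suc k} then 1 else 0)" by auto
    then show ?thesis
      using hom_space_mult[OF Suc[of a c] Var_X_in_hom_space[of "Suc k" c b]] by simp
  qed
  then show ?case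
    by (simp add: P.V.subspace_add[OF subspace_hom_space] del: atLeastAtMost_iff)
qed

lemma trace_poly_in_hom_space: "trace_poly \<in> hom_space ones (\<lambda>_. 0)"
  unfolding trace_poly_def ones_def[abs_def]
  by (intro P.V.subspace_add[OF subspace_hom_space] path_poly_in_hom_space)

lemma det1_poly_in_hom_space: "det1_poly k \<in> hom_space (\<lambda>i. if i = k then 2 else 0) (\<lambda>_. 0)"
proof -
  have "(\<lambda>i. (if i = k then 1 else 0) + (if i = k then 1 else 0 :: int)) = (\<lambda>i. if i = k then 2 else 0)" by auto
  then have "Var (X k a b) * Var (X k c d) \<in> hom_space (\<lambda>i. if i = k then 2 else 0) (\<lambda>_. 0)" for a b c d
    using hom_space_mult[OF Var_X_in_hom_space[of k a b] Var_X_in_hom_space[of k c d]] by simp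
  then show ?thesis
    unfolding det1_poly_def by (intro P.V.subspace_diff[OF subspace_hom_space])
qed

lemma det_poly_in_hom_space: "det_poly \<in> hom_space (\<lambda>i. 2 * ones i) (\<lambda>_. 0)"
proof -
  have "(\<Prod>k\<in>I. det1_poly k) \<in> hom_space (\<lambda>i. if i \<in> I then 2 else 0) (\<lambda>_. 0)" if "finite I" for I
    using that
  proof (induction I)
    case empty
    then show ?case by (auto simp: hom_space_def mons_def)
  next
    case (insert k I)
    have "(\<lambda>i. (if i = k then 2 else 0) + (if i \<in> I then 2 else 0 :: int)) = (\<lambda>i. if i \<in> insert k I then 2 else 0)"
      using insert.hyps by auto
    then show ?case
      using hom_space_mult[OF det1_poly_in_hom_space[of k] insert.IH] insert.hyps by simp
  qed
  from this[of "{1..r}"] have "det_poly \<in> hom_space (\<lambda>i. if i \<in> {1..r} then 2 else 0) (\<lambda>_. 0)"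
    by (simp add: det_poly_def)
  moreover have "(\<lambda>i. if i \<in> {1..r} then 2 else 0 :: int) = (\<lambda>i. 2 * ones i)"
    by (auto simp: ones_def)
  ultimately show ?thesis by simp
qed

lemma fischer_adjoint_path_poly: "fischer_adjoint (path_poly k a b)"
  by (induction k arbitrary: a b)
    (auto intro: fischer_adjoint_0 fischer_adjoint_1 fischer_adjoint_add fischer_adjoint_mult fischer_adjoint_Var)

lemma fischer_adjoint_trace_poly: "fischer_adjoint trace_poly"
  unfolding trace_poly_def by (intro fischer_adjoint_add fischer_adjoint_path_poly)

lemma fischer_adjoint_det_poly: "fischer_adjoint det_poly"
  unfolding det_poly_def det1_poly_def
  by (intro fischer_adjoint_prod fischer_adjoint_diff fischer_adjoint_mult fischer_adjoint_Var)

lemma SL_invariant_trace_poly: "SL_invariant r trace_poly"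
  and SL_invariant_det_poly: "SL_invariant r det_poly"
  unfolding SL_invariant_def fixed_by_def
  by (auto intro!: trace_poly_invariant det_poly_invariant invertible_det_1)

lemma supported_multiples: "supported (\<lambda>i. k * ones i)" "supported ones" "supported (\<lambda>_. 0)"
  by (auto simp: supported_def ones_def)

lemma trace_poly_in_range: "in_range r trace_poly"
  by (rule hom_space_in_range[OF _ _ trace_poly_in_hom_space]) (rule supported_multiples)+

lemma det_poly_in_range: "in_range r det_poly"
  by (rule hom_space_in_range[OF _ _ det_poly_in_hom_space]) (rule supported_multiples)+

lemma root_op_trace_poly: "i \<in> {1..r} \<Longrightarrow> a \<noteq> b \<Longrightarrow> root_op i a b trace_poly = 0"
  by (rule root_op_eq_0_if_SL_invariant[OF trace_poly_in_range SL_invariant_trace_poly])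

lemma root_op_det_poly: "i \<in> {1..r} \<Longrightarrow> a \<noteq> b \<Longrightarrow> root_op i a b det_poly = 0"
  by (rule root_op_eq_0_if_SL_invariant[OF det_poly_in_range SL_invariant_det_poly])

text \<open>The weights make \<open>X i 1 1\<close> win in the trace and \<open>X i 1 2 * X i 2 1\<close> in the determinants.\<close>

definition weight :: "var \<Rightarrow> nat" where
  "weight v = (case v of X i a b \<Rightarrow> if a = b then (if a = 1 then 4 else 0) else 3 | U i a \<Rightarrow> 0)"

text \<open>A path earns weight 4 in every step only by staying at index 1, so the full weight is
  reached by one monomial of the entry \<open>1 1\<close> alone. The other entries are bounded along
  with it because the recursion mixes them.\<close>

lemma lead_path_poly:
  "lead weight (path_poly (Suc k) 1 1) (\<Sum>i\<in>{1..Suc k}. single (X i 1 1) 1)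
    \<and> wless weight (path_poly (Suc k) 1 2) (4 * Suc k) \<and> wless weight (path_poly (Suc k) 2 1) (4 * Suc k)
    \<and> wless weight (path_poly (Suc k) 2 2) (4 * Suc k)
    \<and> wdeg weight (\<Sum>i\<in>{1..Suc k}. single (X i 1 1) 1) = 4 * Suc k"
proof (induction k)
  case 0
  have "path_poly (Suc 0) a b = Var (X (Suc 0) a b)" for a b
    using exhaust_2[of a] by auto
  then show ?case
    by (simp add: lead_Var wless_Var weight_def One_nat_def[symmetric])
next
  case (Suc k)
  define k' where "k' = Suc k"
  let ?\<mu> = "\<Sum>i\<in>{1..k'}. single (X i 1 1) (1::nat)"
  have IH: "lead weight (path_poly k' 1 1) ?\<mu>" "wless weight (path_poly k' 1 2) (4 * k')"
      "wless weight (path_poly k' 2 1) (4 * k')" "wless weight (path_poly k' 2 2) (4 * k')"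
      "wdeg weight ?\<mu> = 4 * k'"
    using Suc.IH unfolding k'_def by blast+
  have \<mu>: "(\<Sum>i\<in>{1..Suc k'}. single (X i 1 1) (1::nat)) = ?\<mu> + single (X (Suc k') 1 1) 1" by simp
  have w: "wdeg weight (?\<mu> + single (X (Suc k') 1 1) 1) = 4 * Suc k'"
    by (simp only: wdeg_add IH(5) wdeg_single) (simp add: weight_def)
  have m: "wless weight (path_poly k' a c * Var (X (Suc k') c b)) (4 * Suc k')"
    if "wless weight (path_poly k' a c) (4 * k')" for a b c
    by (rule wless_mono[OF wless_mult_Var[OF that]]) (simp add: weight_def)
  have 12: "wless weight (path_poly k' 1 1 * Var (X (Suc k') 1 2)) (4 * Suc k')"
    unfolding wless_def
  proof
    fix \<delta> assume "\<delta> \<in> keys (path_poly k' 1 1 * Var (X (Suc k') 1 2))"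
    then obtain \<alpha> where \<alpha>: "\<alpha> \<in> keys (path_poly k' 1 1)" "\<delta> = \<alpha> + single (X (Suc k') 1 2) 1"
      by (auto simp: Var_def elim!: keys_mult_elim)
    have "wdeg weight \<alpha> \<le> 4 * k'"
      using lead_keys_le[OF IH(1) \<alpha>(1)] by (simp only: IH(5))
    then show "wdeg weight \<delta> < 4 * Suc k'" by (simp add: \<alpha>(2) wdeg_add) (simp add: weight_def)
  qed
  have "lead weight (path_poly (Suc k') 1 1) (?\<mu> + single (X (Suc k') 1 1) 1)"
    unfolding path_poly.simps
    by (intro lead_add lead_mult lead_Var IH(1)) (unfold w, rule m[OF IH(2)])
  moreover have "wless weight (path_poly (Suc k') 1 2) (4 * Suc k')"
    unfolding path_poly.simps by (rule wless_add[OF 12 m[OF IH(2)]])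
  moreover have "wless weight (path_poly (Suc k') 2 b) (4 * Suc k')" for b
    unfolding path_poly.simps by (rule wless_add[OF m[OF IH(3)] m[OF IH(4)]])
  ultimately show ?case
    unfolding k'_def[symmetric] \<mu> w by blast
qed

lemma lead_trace_poly: "lead weight trace_poly (\<Sum>i\<in>{1..r}. single (X i 1 1) 1)"
proof -
  obtain k where k: "r = Suc k" using r2 by (cases r) auto
  have "lead weight (path_poly r 1 1) (\<Sum>i\<in>{1..r}. single (X i 1 1) 1)" "wless weight (path_poly r 2 2) (4 * r)"
      "wdeg weight (\<Sum>i\<in>{1..r}. single (X i 1 1) 1) = 4 * r"
    using lead_path_poly[of k] unfolding k by blast+
  then show ?thesis
    unfolding trace_poly_def by (intro lead_add) (simp_all only:)
qed

text \<open>The off-diagonal product has weight 3 + 3, the diagonal one 4 + 0.\<close>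

lemma lead_det1_poly: "lead weight (det1_poly i) (single (X i 1 2) 1 + single (X i 2 1) 1)"
proof -
  have "lead weight (- (Var (X i 1 2) * Var (X i 2 1))) (single (X i 1 2) 1 + single (X i 2 1) 1)"
    by (intro lead_uminus lead_mult lead_Var)
  moreover have "wless weight (Var (X i 1 1) * Var (X i 2 2)) 6"
    using wless_mult_Var[OF wless_Var[of weight "X i 1 1" 6], of "X i 2 2"] by (simp add: weight_def)
  ultimately have "lead weight (- (Var (X i 1 2) * Var (X i 2 1)) + Var (X i 1 1) * Var (X i 2 2))
      (single (X i 1 2) 1 + single (X i 2 1) 1)"
    by (intro lead_add) (simp_all add: wdeg_add weight_def)
  then show ?thesis by (simp add: det1_poly_def)
qed

definition det_lead :: "var mon" where
  "det_lead = (\<Sum>i\<in>{1..r}. single (X i 1 2) 1 + single (X i 2 1) 1)"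

lemma lead_det_poly: "lead weight det_poly det_lead"
  unfolding det_poly_def det_lead_def by (intro lead_prod lead_det1_poly) simp

lemma coprime_leads: "keys (\<Sum>i\<in>{1..r}. single (X i 1 1) (1::nat)) \<inter> keys det_lead = {}"
proof -
  have "lookup (\<Sum>i\<in>{1..r}. single (X i 1 1) (1::nat)) (X k a b) = 0" if "(a, b) \<noteq> (1, 1)" for k a b
    using that by (simp add: lookup_sum lookup_single when_def)
  moreover have "lookup det_lead (X k 1 1) = 0" for k
    by (simp add: det_lead_def lookup_sum lookup_add lookup_single)
  moreover have "lookup det_lead (U k a) = 0" for k a
    by (simp add: det_lead_def lookup_sum lookup_add lookup_single)
  ultimately have "lookup (\<Sum>i\<in>{1..r}. single (X i 1 1) (1::nat)) v = 0 \<or> lookup det_lead v = 0" for v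
    by (cases v) (metis prod.inject)+
  then show ?thesis by (metis disjoint_iff in_keys_iff)
qed

text \<open>Division with remainder, by induction on the weight: a monomial divisible by
  \<open>det_lead\<close> is traded for a multiple of \<open>det_poly\<close> and monomials of
  smaller weight. Homogeneity keeps quotient and remainder in the right degrees.\<close>

lemma det_division:
  assumes "f \<in> hom_space n s"
  shows "\<exists>q\<in>hom_space (\<lambda>i. n i - 2 * ones i) s. \<exists>h\<in>hom_space n s. reduced det_lead h \<and> f = det_poly * q + h"
proof -
  define D where "D = {f. \<exists>q\<in>hom_space (\<lambda>i. n i - 2 * ones i) s. \<exists>h\<in>hom_space n s.
      reduced det_lead h \<and> f = det_poly * q + h}"
  note hs = P.V.subspace_add[OF subspace_hom_space] P.V.subspace_scale[OF subspace_hom_space, unfolded pscale_def]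
    P.V.subspace_0[OF subspace_hom_space]
  have D0: "0 \<in> D"
    unfolding D_def by (rule CollectI, rule bexI[of _ 0], rule bexI[of _ 0]) (auto simp: reduced_def hs)
  have D_add: "f + g \<in> D" if fg: "f \<in> D" "g \<in> D" for f g
  proof -
    obtain q h q' h' where "q \<in> hom_space (\<lambda>i. n i - 2 * ones i) s" "h \<in> hom_space n s"
        "reduced det_lead h" "f = det_poly * q + h"
        "q' \<in> hom_space (\<lambda>i. n i - 2 * ones i) s" "h' \<in> hom_space n s"
        "reduced det_lead h'" "g = det_poly * q' + h'"
      using fg unfolding D_def by blast
    then show ?thesis
      unfolding D_def
      by (intro CollectI bexI[of _ "q + q'"] bexI[of _ "h + h'"]) (auto simp: hs reduced_add algebra_simps)
  qed
  have D_scale: "Const c * f \<in> D" if f: "f \<in> D" for f c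
  proof -
    obtain q h where "q \<in> hom_space (\<lambda>i. n i - 2 * ones i) s" "h \<in> hom_space n s"
        "reduced det_lead h" "f = det_poly * q + h"
      using f unfolding D_def by blast
    moreover from this have "Const c * f = det_poly * (Const c * q) + Const c * h"
      by (simp only: distrib_left mult.left_commute)
    moreover from calculation have "reduced det_lead (Const c * h)" by (auto simp: reduced_def in_keys_iff)
    ultimately show ?thesis
      unfolding D_def
      by (intro CollectI bexI[of _ "Const c * q"] bexI[of _ "Const c * h"] conjI hs(2))
  qed
  have D_sum: "f \<in> D" if "\<And>\<alpha>. \<alpha> \<in> keys f \<Longrightarrow> single \<alpha> 1 \<in> D" for f
  proof -
    have "(\<Sum>\<alpha>\<in>A. single \<alpha> (lookup f \<alpha>)) \<in> D" if "finite A" "A \<subseteq> keys f" for A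
      using that
    proof (induction A)
      case (insert \<alpha> A)
      have "single \<alpha> (lookup f \<alpha>) = Const (lookup f \<alpha>) * single \<alpha> 1"
        by (rule single_eq_Const_mult)
      then have "single \<alpha> (lookup f \<alpha>) \<in> D"
        using D_scale \<open>\<And>\<alpha>. \<alpha> \<in> keys f \<Longrightarrow> single \<alpha> 1 \<in> D\<close> insert.prems by auto
      then show ?case using insert D_add by simp
    qed (simp add: D0)
    from this[of "keys f"] show ?thesis by (simp add: pol_sum_single[symmetric])
  qed
  have mon: "single \<alpha> 1 \<in> D" if "\<alpha> \<in> mons n s" for \<alpha>
    using that
  proof (induction "wdeg weight \<alpha>" arbitrary: \<alpha> rule: less_induct)
    case less
    show ?case
    proof (cases "\<exists>\<beta>. \<alpha> = det_lead + \<beta>")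
      case False
      then have "reduced det_lead (single \<alpha> 1)" by (auto simp: reduced_def)
      then show ?thesis
        unfolding D_def using less.prems
        by (intro CollectI bexI[of _ 0] bexI[of _ "single \<alpha> 1"]) (auto simp: hs single_in_hom_space)
    next
      case True
      then obtain \<beta> where \<beta>: "\<alpha> = det_lead + \<beta>" by blast
      define c where "c = lookup det_poly det_lead"
      have c: "c \<noteq> 0" using lead_det_poly by (simp add: lead_def c_def)
      define rest where "rest = det_poly - single det_lead c"
      have "det_lead \<in> mons (\<lambda>i. 2 * ones i) (\<lambda>_. 0)"
        using det_poly_in_hom_space c by (auto simp: hom_space_def c_def in_keys_iff)
      then have "\<beta> \<in> mons (\<lambda>i. n i - 2 * ones i) s"
        using less.prems by (intro mons_add_cancel[of det_lead]) (simp_all add: \<beta>)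
      then have b: "single \<beta> 1 \<in> hom_space (\<lambda>i. n i - 2 * ones i) s"
        by (rule single_in_hom_space)
      have "det_poly * single \<beta> 1 \<in> hom_space n s"
        using hom_space_mult[OF det_poly_in_hom_space b] by simp
      then have rb_hom: "rest * single \<beta> 1 \<in> hom_space n s"
        using less.prems single_in_hom_space[of \<alpha> n s c] P.V.subspace_diff[OF subspace_hom_space, of "det_poly * single \<beta> 1" n s]
        by (simp add: rest_def left_diff_distrib mult_single \<beta>)
      have db: "det_poly * single \<beta> 1 \<in> D"
        unfolding D_def using b
        by (intro CollectI bexI[of _ "single \<beta> 1"] bexI[of _ 0]) (auto simp: hs reduced_def)
      have "rest * single \<beta> 1 \<in> D"
      proof (rule D_sum)
        fix \<gamma> assume \<gamma>: "\<gamma> \<in> keys (rest * single \<beta> 1)"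
        then obtain \<delta> where "\<delta> \<in> keys rest" "\<gamma> = \<delta> + \<beta>"
          by (auto elim!: keys_mult_elim)
        then have "wdeg weight \<gamma> < wdeg weight \<alpha>"
          using lead_det_poly by (auto simp: lead_def wless_def rest_def c_def \<beta> wdeg_add)
        moreover have "\<gamma> \<in> mons n s" using rb_hom \<gamma> by (auto simp: hom_space_def)
        ultimately show "single \<gamma> 1 \<in> D" by (rule less.hyps)
      qed
      \<comment> \<open>This combination is \<open>single \<alpha> 1\<close>, since
        \<open>det_poly\<close> minus \<open>rest\<close> is its leading term
        \<open>single det_lead c\<close>.\<close>
      from D_add[OF D_scale[OF db, of "1 / c"] D_scale[OF this, of "- (1 / c)"]]
      have "Const (1 / c) * (det_poly * single \<beta> 1) + Const (- (1 / c)) * (rest * single \<beta> 1) \<in> D" .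
      moreover have "Const (1 / c) * (det_poly * single \<beta> 1) + Const (- (1 / c)) * (rest * single \<beta> 1)
          = Const (1 / c) * (single det_lead c * single \<beta> 1)"
        by (simp only: Const_minus rest_def) (simp add: algebra_simps)
      moreover have "\<dots> = single \<alpha> 1"
        using c by (simp add: Const_def mult_single \<beta>)
      ultimately show ?thesis by simp
    qed
  qed
  have "f \<in> D"
    by (rule D_sum) (use assms mon in \<open>auto simp: hom_space_def\<close>)
  then show ?thesis by (simp add: D_def)
qed

text \<open>Replacing \<open>f\<close> by its remainder preserves divisibility of
  \<open>trace_poly * f\<close> by \<open>det_poly\<close>, and a reduced polynomial with this
  property is zero.\<close>

lemma det_divides:
  assumes f: "f \<in> hom_space n s" and eq: "trace_poly * f = det_poly * g"
  obtains q where "q \<in> hom_space (\<lambda>i. n i - 2 * ones i) s" "f = det_poly * q"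
proof -
  obtain q h where q: "q \<in> hom_space (\<lambda>i. n i - 2 * ones i) s"
    and h: "reduced det_lead h" "f = det_poly * q + h"
    using det_division[OF f] by blast
  have "trace_poly * h = det_poly * (g - trace_poly * q)"
    using eq h(2) by (simp add: algebra_simps)
  then have "h = 0"
    using coprime_lead_reduced_eq_0[OF lead_trace_poly lead_det_poly coprime_leads h(1)] by blast
  then show ?thesis using that q h(2) by simp
qed

subsection \<open>Dimensions of harmonic invariants\<close>

text \<open>Invariance is stated through the Lie algebra to have linear equations. The off-diagonal
  matrix units suffice, since the diagonal element of sl_2 is their commutator.\<close>

definition inv_space :: "(nat \<Rightarrow> int) \<Rightarrow> (nat \<Rightarrow> nat) \<Rightarrow> var pol set" where
  "inv_space n s = {p \<in> hom_space n s. \<forall>i\<in>{1..r}. \<forall>a b. a \<noteq> b \<longrightarrow> root_op i a b p = 0}"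

definition harm_space :: "(nat \<Rightarrow> int) \<Rightarrow> (nat \<Rightarrow> nat) \<Rightarrow> var pol set" where
  "harm_space n s = {p \<in> inv_space n s. pd trace_poly p = 0 \<and> pd det_poly p = 0}"

lemma subspace_inv_space: "P.V.subspace (inv_space n s)"
  by (rule P.V.subspaceI)
    (auto simp: inv_space_def pscale_def root_op_rules P.V.subspace_add[OF subspace_hom_space]
      P.V.subspace_0[OF subspace_hom_space] P.V.subspace_scale[OF subspace_hom_space, unfolded pscale_def])

lemma fin_dim_hom_space: "supported n \<Longrightarrow> supported s \<Longrightarrow> fin_dim pscale (hom_space n s)"
  unfolding hom_space_def by (intro fin_dim_keys finite_mons)

lemma fin_dim_inv_space: "supported n \<Longrightarrow> supported s \<Longrightarrow> fin_dim pscale (inv_space n s)"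
  by (rule P.fin_dim_subset[OF fin_dim_hom_space]) (auto simp: inv_space_def)

lemma subspace_harm_space: "P.V.subspace (harm_space n s)"
  by (rule P.V.subspaceI)
    (auto simp: harm_space_def P.V.subspace_add[OF subspace_inv_space] P.V.subspace_0[OF subspace_inv_space]
      P.V.subspace_scale[OF subspace_inv_space] pd_add_right pscale_def pd_Const_mult_right
      P.V.subspace_scale[OF subspace_inv_space, unfolded pscale_def])

lemma fin_dim_harm_space: "supported n \<Longrightarrow> supported s \<Longrightarrow> fin_dim pscale (harm_space n s)"
  by (rule P.fin_dim_subset[OF fin_dim_inv_space]) (auto simp: harm_space_def)

lemma inv_space_mult:
  assumes "p \<in> hom_space m (\<lambda>_. 0)" "\<And>i a b. i \<in> {1..r} \<Longrightarrow> a \<noteq> b \<Longrightarrow> root_op i a b p = 0"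
    and "q \<in> inv_space (\<lambda>i. n i - m i) s"
  shows "p * q \<in> inv_space n s"
  using assms hom_space_mult[OF assms(1), of q "\<lambda>i. n i - m i" s]
  by (auto simp: inv_space_def root_op_rules)

text \<open>Root operators are derivations that kill \<open>p\<close>, so they can be applied to
  \<open>q\<close> after cancelling \<open>p\<close>.\<close>

lemma inv_space_divide:
  assumes "lead w p \<mu>" "\<And>i a b. i \<in> {1..r} \<Longrightarrow> a \<noteq> b \<Longrightarrow> root_op i a b p = 0"
    and "q \<in> hom_space m s" "p * q \<in> inv_space n s"
  shows "q \<in> inv_space m s"
  unfolding inv_space_def
proof (intro CollectI conjI ballI allI impI assms(3))
  fix i and a b :: 2 assume "i \<in> {1..r}" "a \<noteq> b"
  then have "p * root_op i a b q = 0"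
    using assms(2,4) by (auto simp: inv_space_def root_op_rules)
  then show "root_op i a b q = 0" using lead_mult_eq_0[OF assms(1)] by blast
qed

text \<open>In a pairing with \<open>f\<close>, both operators move to the other side, where the
  root operator commutes with multiplication by the invariant \<open>p\<close>.\<close>

lemma pd_inv_space:
  assumes adj: "fischer_adjoint p" and p: "p \<in> hom_space m (\<lambda>_. 0)"
    and op: "\<And>i a b. i \<in> {1..r} \<Longrightarrow> a \<noteq> b \<Longrightarrow> root_op i a b p = 0"
    and q: "q \<in> inv_space n s"
  shows "pd p q \<in> inv_space (\<lambda>i. n i - m i) s"
  unfolding inv_space_def
proof (intro CollectI conjI ballI allI impI)
  show "pd p q \<in> hom_space (\<lambda>i. n i - m i) s"
    using pd_hom_space[OF p] q by (auto simp: inv_space_def)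
  fix i and a b :: 2 assume i: "i \<in> {1..r}" and ab: "a \<noteq> b"
  have "pip (root_op i a b (pd p q)) f = 0" for f
  proof -
    have "pip (root_op i a b (pd p q)) f = pip q (p * root_op i b a f)"
      by (simp add: pip_root_op fischer_adjointD[OF adj])
    also have "p * root_op i b a f = root_op i b a (p * f)"
      using op[OF i, of b a] ab by (simp add: root_op_rules)
    also have "pip q \<dots> = pip (root_op i a b q) (p * f)"
      by (simp add: pip_root_op)
    also have "\<dots> = 0" using q i ab by (simp add: inv_space_def)
    finally show ?thesis .
  qed
  then show "root_op i a b (pd p q) = 0" by (rule P.eq_0_if_ip)
qed

abbreviation "trace_mult \<equiv> \<lambda>q. trace_poly * q"
abbreviation "det_mult \<equiv> \<lambda>q. det_poly * q"

definition ideal_part :: "(nat \<Rightarrow> int) \<Rightarrow> (nat \<Rightarrow> nat) \<Rightarrow> var pol set" where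
  "ideal_part n s = {x + y | x y. x \<in> trace_mult ` inv_space (\<lambda>i. n i - ones i) s
     \<and> y \<in> det_mult ` inv_space (\<lambda>i. n i - 2 * ones i) s}"

lemma linear_mult: "Vector_Spaces.linear pscale pscale (\<lambda>q. p * q :: 'v pol)"
  unfolding Vector_Spaces.linear_iff
  by (simp add: vector_space_pscale distrib_left pscale_def mult.left_commute)

lemma subspace_image_mult: "P.V.subspace S \<Longrightarrow> P.V.subspace ((\<lambda>q. p * q) ` S)"
proof -
  interpret m: Vector_Spaces.linear pscale pscale "\<lambda>q. p * q" by (rule linear_mult)
  show "P.V.subspace S \<Longrightarrow> ?thesis" by (rule m.subspace_image)
qed

lemma dim_image_mult:
  assumes "lead w p \<mu>" "P.V.subspace S"
  shows "P.V.dim ((\<lambda>q. p * q) ` S) = P.V.dim S"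
proof -
  interpret vector_space_pair pscale pscale
    unfolding vector_space_pair_def by (simp add: vector_space_pscale)
  show ?thesis
    by (rule dim_inj_image_subspace[OF linear_mult _ assms(2)])
      (auto intro!: inj_onI lead_mult_cancel[OF assms(1)])
qed

lemma fin_dim_image_mult: "fin_dim pscale S \<Longrightarrow> fin_dim pscale ((\<lambda>q. p * q) ` S)"
proof -
  interpret vector_space_pair pscale pscale
    unfolding vector_space_pair_def by (simp add: vector_space_pscale)
  show "fin_dim pscale S \<Longrightarrow> ?thesis" by (rule fin_dim_image[OF linear_mult])
qed

lemma trace_mult_inv_space: "q \<in> inv_space (\<lambda>i. n i - ones i) s \<Longrightarrow> trace_poly * q \<in> inv_space n s"
  and det_mult_inv_space: "q \<in> inv_space (\<lambda>i. n i - 2 * ones i) s \<Longrightarrow> det_poly * q \<in> inv_space n s"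
  by (rule inv_space_mult[OF trace_poly_in_hom_space root_op_trace_poly]
      inv_space_mult[OF det_poly_in_hom_space root_op_det_poly]; assumption)+

lemma ideal_part_subset: "ideal_part n s \<subseteq> inv_space n s"
  by (auto simp: ideal_part_def intro!: P.V.subspace_add[OF subspace_inv_space] trace_mult_inv_space det_mult_inv_space)

lemma subspace_ideal_part: "P.V.subspace (ideal_part n s)"
  unfolding ideal_part_def by (intro P.V.subspace_sums subspace_image_mult subspace_inv_space)

text \<open>Harmonic polynomials are orthogonal to the ideal by adjointness. Conversely,
  \<open>trace_poly * pd trace_poly p\<close> lies in the ideal because differentiation preserves
  invariants, and pairing it with \<open>p\<close> gives the squared norm of
  \<open>pd trace_poly p\<close>; the same works for the determinant.\<close>

lemma harm_space_eq: "harm_space n s = inv_space n s \<inter> P.orth (ideal_part n s)"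
proof (intro equalityI subsetI)
  fix p assume p: "p \<in> harm_space n s"
  have "pip p (trace_poly * f) = 0" "pip p (det_poly * f) = 0" for f
    using p fischer_adjointD[OF fischer_adjoint_trace_poly, of p f]
      fischer_adjointD[OF fischer_adjoint_det_poly, of p f]
    by (simp_all add: harm_space_def)
  then show "p \<in> inv_space n s \<inter> P.orth (ideal_part n s)"
    using p by (auto simp: harm_space_def P.orth_def ideal_part_def P.ip_add_right)
next
  fix p assume p: "p \<in> inv_space n s \<inter> P.orth (ideal_part n s)"
  have z: "0 \<in> inv_space m s" for m by (rule P.V.subspace_0[OF subspace_inv_space])
  have "pd trace_poly p \<in> inv_space (\<lambda>i. n i - ones i) s"
    using p by (intro pd_inv_space fischer_adjoint_trace_poly trace_poly_in_hom_space root_op_trace_poly) auto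
  then have "trace_poly * pd trace_poly p + det_poly * 0 \<in> ideal_part n s"
    unfolding ideal_part_def using z by blast
  then have "pip p (trace_poly * pd trace_poly p) = 0"
    using p by (simp add: P.orth_def)
  then have 1: "pd trace_poly p = 0"
    using P.ip_definite[of "pd trace_poly p"] fischer_adjointD[OF fischer_adjoint_trace_poly, of p] by simp
  have "pd det_poly p \<in> inv_space (\<lambda>i. n i - 2 * ones i) s"
    using p by (intro pd_inv_space fischer_adjoint_det_poly det_poly_in_hom_space root_op_det_poly) auto
  then have "trace_poly * 0 + det_poly * pd det_poly p \<in> ideal_part n s"
    unfolding ideal_part_def using z by blast
  then have "pip p (det_poly * pd det_poly p) = 0"
    using p by (simp add: P.orth_def)
  then have "pd det_poly p = 0"
    using P.ip_definite[of "pd det_poly p"] fischer_adjointD[OF fischer_adjoint_det_poly, of p] by simp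
  with 1 p show "p \<in> harm_space n s" by (simp add: harm_space_def)
qed

text \<open>If \<open>trace_poly * f = det_poly * g\<close>, then \<open>det_poly\<close> divides
  \<open>f\<close>, and the quotient is again invariant.\<close>

lemma trace_det_Int:
  "trace_mult ` inv_space (\<lambda>i. n i - ones i) s \<inter> det_mult ` inv_space (\<lambda>i. n i - 2 * ones i) s
   = (\<lambda>q. (trace_poly * det_poly) * q) ` inv_space (\<lambda>i. n i - 3 * ones i) s"
proof (intro equalityI subsetI)
  fix z assume "z \<in> trace_mult ` inv_space (\<lambda>i. n i - ones i) s \<inter> det_mult ` inv_space (\<lambda>i. n i - 2 * ones i) s"
  then have z: "z \<in> trace_mult ` inv_space (\<lambda>i. n i - ones i) s" "z \<in> det_mult ` inv_space (\<lambda>i. n i - 2 * ones i) s"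
    by blast+
  from z(1) obtain f where f: "z = trace_poly * f" "f \<in> inv_space (\<lambda>i. n i - ones i) s" by auto
  from z(2) obtain g where g: "z = det_poly * g" by auto
  have fh: "f \<in> hom_space (\<lambda>i. n i - ones i) s" using f(2) by (simp add: inv_space_def)
  have eq: "trace_poly * f = det_poly * g" using f(1) g by simp
  obtain q where q: "q \<in> hom_space (\<lambda>i. n i - ones i - 2 * ones i) s" "f = det_poly * q"
    by (rule det_divides[OF fh eq])
  have "q \<in> inv_space (\<lambda>i. n i - ones i - 2 * ones i) s"
    using f(2) q(2) by (intro inv_space_divide[OF lead_det_poly root_op_det_poly q(1)]) simp_all
  then have "q \<in> inv_space (\<lambda>i. n i - 3 * ones i) s" by (simp add: algebra_simps)
  then show "z \<in> (\<lambda>q. (trace_poly * det_poly) * q) ` inv_space (\<lambda>i. n i - 3 * ones i) s"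
    using f(1) q(2) by (auto simp: mult.assoc)
next
  fix z assume "z \<in> (\<lambda>q. (trace_poly * det_poly) * q) ` inv_space (\<lambda>i. n i - 3 * ones i) s"
  then obtain q where q: "z = trace_poly * det_poly * q" "q \<in> inv_space (\<lambda>i. n i - 3 * ones i) s" by auto
  have "q \<in> inv_space (\<lambda>i. (n i - ones i) - 2 * ones i) s" "q \<in> inv_space (\<lambda>i. (n i - 2 * ones i) - ones i) s"
    using q(2) by (simp_all add: algebra_simps)
  then have "det_poly * q \<in> inv_space (\<lambda>i. n i - ones i) s" "trace_poly * q \<in> inv_space (\<lambda>i. n i - 2 * ones i) s"
    by (auto intro: det_mult_inv_space trace_mult_inv_space)
  moreover have "z = trace_poly * (det_poly * q)" "z = det_poly * (trace_poly * q)"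
    using q(1) by (simp_all add: mult_ac)
  ultimately show "z \<in> trace_mult ` inv_space (\<lambda>i. n i - ones i) s \<inter> det_mult ` inv_space (\<lambda>i. n i - 2 * ones i) s"
    by blast
qed

text \<open>The alternating sum in additive form, as dimensions are natural numbers. Multiplication
  by a polynomial with a leading monomial is injective and keeps dimensions.\<close>

lemma dim_harm_space:
  assumes "supported n" "supported s"
  shows "P.V.dim (harm_space n s) + P.V.dim (inv_space (\<lambda>i. n i - ones i) s) + P.V.dim (inv_space (\<lambda>i. n i - 2 * ones i) s)
    = P.V.dim (inv_space n s) + P.V.dim (inv_space (\<lambda>i. n i - 3 * ones i) s)"
proof -
  let ?T = "trace_mult ` inv_space (\<lambda>i. n i - ones i) s" and ?D = "det_mult ` inv_space (\<lambda>i. n i - 2 * ones i) s"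
  have sup: "supported (\<lambda>i. n i - k * ones i)" for k using assms supported_ones by blast
  have T: "P.V.subspace ?T" "fin_dim pscale ?T" and D: "P.V.subspace ?D" "fin_dim pscale ?D"
    using sup[of 1] sup[of 2] assms
    by (auto intro!: subspace_image_mult fin_dim_image_mult subspace_inv_space fin_dim_inv_space)
  have "P.V.dim (inv_space n s) = P.V.dim (ideal_part n s) + P.V.dim (harm_space n s)"
    unfolding harm_space_eq
    by (intro P.dim_orth subspace_inv_space fin_dim_inv_space subspace_ideal_part ideal_part_subset assms)
  moreover have "P.V.dim (ideal_part n s) + P.V.dim (?T \<inter> ?D) = P.V.dim ?T + P.V.dim ?D"
    unfolding ideal_part_def by (rule P.dim_sum_Int[OF T D])
  moreover have "P.V.dim ?T = P.V.dim (inv_space (\<lambda>i. n i - ones i) s)"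
    "P.V.dim ?D = P.V.dim (inv_space (\<lambda>i. n i - 2 * ones i) s)"
    by (intro dim_image_mult[OF lead_trace_poly] dim_image_mult[OF lead_det_poly] subspace_inv_space)+
  moreover have "P.V.dim (?T \<inter> ?D) = P.V.dim (inv_space (\<lambda>i. n i - 3 * ones i) s)"
    unfolding trace_det_Int
    by (rule dim_image_mult[OF lead_mult[OF lead_trace_poly lead_det_poly] subspace_inv_space])
  ultimately show ?thesis by simp
qed

text \<open>The component orthogonal to the ideal is harmonic, hence zero. Applied below to symbols
  of invariant operators.\<close>

lemma ideal_if_harm_space_0:
  assumes "supported n" "supported s" "harm_space n s \<subseteq> {0}" "p \<in> inv_space n s"
  obtains f g where "p = trace_poly * f + det_poly * g"
proof -
  have fd: "fin_dim pscale (ideal_part n s)"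
    by (rule P.fin_dim_subset[OF fin_dim_inv_space[OF assms(1,2)] ideal_part_subset])
  obtain u w where uw: "u \<in> ideal_part n s" "w \<in> P.orth (ideal_part n s)" "p = u + w"
    by (rule P.projection[OF subspace_ideal_part fd])
  have "w = p - u" using uw(3) by simp
  moreover have "u \<in> inv_space n s" using uw(1) ideal_part_subset by (rule subsetD[rotated])
  ultimately have "w \<in> inv_space n s"
    using assms(4) by (simp only: P.V.subspace_diff[OF subspace_inv_space])
  then have "w = 0" using uw(2) assms(3) harm_space_eq by blast
  then show ?thesis using uw that by (auto simp: ideal_part_def)
qed

end

section \<open>Counting\<close>

lemma card_pairs_sum:
  fixes a b v :: nat
  shows "card {(p, q). p \<le> a \<and> q \<le> b \<and> p + q = v} = min a v + 1 - (v - b)"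
proof -
  have "bij_betw fst {(p, q). p \<le> a \<and> q \<le> b \<and> p + q = v} {v - b..min a v}"
    by (rule bij_betw_byWitness[of _ "\<lambda>p. (p, v - p)"]) auto
  then show ?thesis by (simp add: bij_betw_same_card)
qed

text \<open>The standard basis vectors of weight \<open>v\<close> in the tensor product of three
  irreducible representations with highest weights \<open>a\<close>, \<open>b\<close>,
  \<open>c\<close>, where \<open>v\<close> counts the raised factors.\<close>

definition triples :: "nat \<Rightarrow> nat \<Rightarrow> nat \<Rightarrow> nat \<Rightarrow> (nat \<times> nat \<times> nat) set" where
  "triples a b c v = {(p, q, k). p \<le> a \<and> q \<le> b \<and> k \<le> c \<and> p + q + k = v}"

lemma finite_triples: "finite (triples a b c v)"
proof (rule finite_subset)
  show "triples a b c v \<subseteq> {..a} \<times> {..b} \<times> {..c}" by (auto simp: triples_def)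
qed simp

definition triangle :: "nat \<Rightarrow> nat \<Rightarrow> nat \<Rightarrow> bool" where
  "triangle a b c \<longleftrightarrow> a \<le> b + c \<and> b \<le> a + c \<and> c \<le> a + b"

text \<open>The Clebsch--Gordan rule, in the form of the multiplicity of the trivial representation in
  a tensor product of three irreducible ones.\<close>

lemma triples_diff:
  assumes v: "2 * v = a + b + c"
  shows "int (card (triples a b c v)) - int (card (triples a b c (v + 1))) = (if triangle a b c then 1 else 0)"
proof -
  let ?top = "{(p, q, k). p \<le> a \<and> q \<le> b \<and> k = c \<and> p + q + k = v}"
  let ?bot = "{(p, q, k). p \<le> a \<and> q \<le> b \<and> k = 0 \<and> p + q + k = v + 1}"
  \<comment> \<open>Increasing \<open>k\<close> by one matches the two sets except for
    \<open>k = c\<close> on the left and \<open>k = 0\<close> on the right.\<close>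
  have 1: "bij_betw (\<lambda>(p, q, k). (p, q, k + 1)) (triples a b c v - ?top) (triples a b c (v + 1) - ?bot)"
    by (rule bij_betw_byWitness[of _ "\<lambda>(p, q, k). (p, q, k - 1)"]) (auto simp: triples_def)
  have sub: "?top \<subseteq> triples a b c v" "?bot \<subseteq> triples a b c (v + 1)"
    by (auto simp: triples_def)
  have "card (triples a b c v) - card ?top = card (triples a b c (v + 1)) - card ?bot"
    using bij_betw_same_card[OF 1] sub finite_subset[OF sub(1) finite_triples] finite_subset[OF sub(2) finite_triples]
    by (simp add: card_Diff_subset)
  moreover have "card ?top \<le> card (triples a b c v)" "card ?bot \<le> card (triples a b c (v + 1))"
    using sub by (auto intro: card_mono finite_triples)
  ultimately have diff: "int (card (triples a b c v)) - int (card (triples a b c (v + 1))) = int (card ?top) - int (card ?bot)"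
    by linarith
  have top: "card ?top = (if c \<le> v then min a (v - c) + 1 - (v - c - b) else 0)"
  proof (cases "c \<le> v")
    case True
    then have "bij_betw (\<lambda>(p, q, k). (p, q)) ?top {(p, q). p \<le> a \<and> q \<le> b \<and> p + q = v - c}"
      by (intro bij_betw_byWitness[of _ "\<lambda>(p, q). (p, q, c)"]) auto
    then show ?thesis using True bij_betw_same_card card_pairs_sum[of a b "v - c"] by fastforce
  next
    case False
    then have "?top = {}" by auto
    then have "card ?top = 0" by (simp only: card.empty)
    then show ?thesis using False by simp
  qed
  have "bij_betw (\<lambda>(p, q, k). (p, q)) ?bot {(p, q). p \<le> a \<and> q \<le> b \<and> p + q = v + 1}"
    by (intro bij_betw_byWitness[of _ "\<lambda>(p, q). (p, q, 0)"]) auto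
  then have bot: "card ?bot = min a (v + 1) + 1 - (v + 1 - b)"
    using bij_betw_same_card card_pairs_sum[of a b "v + 1"] by fastforce
  show ?thesis
    unfolding diff top bot triangle_def using v by (auto simp: min_def)
qed

lemma dim_keys:
  assumes "finite M"
  shows "P.V.dim {p :: 'v pol. keys p \<subseteq> M} = card M"
proof (rule P.V.dim_unique)
  let ?B = "(\<lambda>\<alpha>. single \<alpha> (1::complex)) ` M"
  have inj: "inj_on (\<lambda>\<alpha>. single \<alpha> (1::complex)) M"
  proof (rule inj_onI)
    fix \<alpha> \<beta> :: "'v mon" assume "single \<alpha> (1::complex) = single \<beta> 1"
    then have "lookup (single \<alpha> (1::complex)) \<alpha> = lookup (single \<beta> (1::complex)) \<alpha>" by simp
    then show "\<alpha> = \<beta>" by (simp add: lookup_single when_def split: if_splits)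
  qed
  show "?B \<subseteq> {p. keys p \<subseteq> M}" by auto
  show "card ?B = card M" by (rule card_image[OF inj])
  show "P.V.independent ?B"
  proof
    assume "P.V.dependent ?B"
    then obtain u v where v: "v \<in> ?B" "u v \<noteq> 0" and s: "(\<Sum>v\<in>?B. pscale (u v) v) = 0"
      using assms by (auto simp: P.V.dependent_finite)
    then obtain \<beta> where \<beta>: "\<beta> \<in> M" "v = single \<beta> 1" by blast
    have "(\<Sum>v\<in>?B. pscale (u v) v) = (\<Sum>\<alpha>\<in>M. pscale (u (single \<alpha> 1)) (single \<alpha> 1))"
      by (rule sum.reindex_cong[OF inj]) auto
    then have "lookup (\<Sum>\<alpha>\<in>M. pscale (u (single \<alpha> 1)) (single \<alpha> 1)) \<beta> = 0" using s by simp
    then have "(\<Sum>\<alpha>\<in>M. u (single \<alpha> 1) * (if \<alpha> = \<beta> then 1 else 0)) = 0"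
      by (simp add: lookup_sum pscale_def lookup_single when_def)
    then show False using v \<beta> assms by (simp add: if_distrib cong: if_cong)
  qed
  show "{p. keys p \<subseteq> M} \<subseteq> P.V.span ?B"
  proof
    fix p :: "'v pol" assume p: "p \<in> {p. keys p \<subseteq> M}"
    have "(\<Sum>\<alpha>\<in>keys p. pscale (lookup p \<alpha>) (single \<alpha> 1)) \<in> P.V.span ?B"
      using p by (intro P.V.span_sum P.V.span_scale P.V.span_base) auto
    then show "p \<in> P.V.span ?B"
      by (simp add: pscale_def single_eq_Const_mult[symmetric] pol_sum_single[symmetric])
  qed
qed

text \<open>Once \<open>k\<close> pairs \<open>a11\<close>, \<open>a22\<close> are removed, one
  diagonal exponent is zero. The remaining three are recovered from their sum \<open>m\<close> and
  from the second row sum \<open>p\<close> and the first column sum \<open>q\<close> of what is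
  left.\<close>

lemma exponents_encode:
  fixes N a11 a12 a21 a22 :: nat
  assumes N: "N = a11 + a12 + a21 + a22"
  defines "k \<equiv> min a11 a22"
  defines "m \<equiv> N - 2 * k" and "p \<equiv> a21 + a22 - k" and "q \<equiv> a11 + a21 - k"
  shows "m \<le> N" "even (N - m)" "(N - m) div 2 = k" "p \<le> m" "q \<le> m" "p + k = a21 + a22" "q + k = a11 + a21"
    "k + (q - p) = a11" "k + (p - q) = a22" "min p q = a21" "m - max p q = a12"
proof -
  have "2 * k \<le> N" using N by (auto simp: k_def min_def)
  then have "N - m = 2 * k" by (simp add: m_def)
  then show "m \<le> N" "even (N - m)" "(N - m) div 2 = k" by (simp_all add: m_def)
  show "p \<le> m" "q \<le> m" "p + k = a21 + a22" "q + k = a11 + a21"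
    "k + (q - p) = a11" "k + (p - q) = a22" "min p q = a21" "m - max p q = a12"
    using N by (auto simp: k_def m_def p_def q_def min_def max_def)
qed

lemma exponents_decode:
  fixes N m p q :: nat
  assumes "m \<le> N" "even (N - m)" "p \<le> m" "q \<le> m"
  defines "k \<equiv> (N - m) div 2"
  defines "a11 \<equiv> k + (q - p)" and "a22 \<equiv> k + (p - q)" and "a21 \<equiv> min p q" and "a12 \<equiv> m - max p q"
  shows "a11 + a12 + a21 + a22 = N" "min a11 a22 = k" "N - 2 * k = m" "a21 + a22 = p + k" "a11 + a21 = q + k"
proof -
  have "N - m = 2 * k" using assms(2) by (simp add: k_def)
  then have N: "N = m + 2 * k" using assms(1) by simp
  show "a11 + a12 + a21 + a22 = N" "min a11 a22 = k" "N - 2 * k = m" "a21 + a22 = p + k" "a11 + a21 = q + k"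
    using assms(3,4) by (auto simp: N a11_def a22_def a21_def a12_def min_def max_def)
qed

context cyclic
begin

section \<open>Weight spaces and highest weight vectors\<close>

lemma up_deg_add [simp]: "up_deg i (\<alpha> + \<beta>) = up_deg i \<alpha> + up_deg i \<beta>"
  by (simp add: up_deg_def lookup_add)

lemma up_deg_single_X: "up_deg i (single (X k a b) 1) =
    (if k = i \<and> a = 2 then 1 else 0) + (if k = prev i \<and> b = 1 then 1 else 0)"
  using exhaust_2[of a] exhaust_2[of b]
  by (elim disjE) (simp_all add: up_deg_def lookup_single when_def)

lemma up_deg_single_U: "up_deg i (single (U k a) 1) = (if k = i \<and> a = 2 then 1 else 0)"
  using exhaust_2[of a] by (elim disjE) (simp_all add: up_deg_def lookup_single when_def)

lemmas up_deg_single = up_deg_single_X up_deg_single_U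

lemma up_low_deg: "up_deg i \<alpha> + low_deg i \<alpha> = degX i \<alpha> + degX (prev i) \<alpha> + degU i \<alpha>"
  by (simp add: up_deg_def low_deg_def degX_def degU_def)

definition total :: "(nat \<Rightarrow> nat) \<Rightarrow> (nat \<Rightarrow> nat) \<Rightarrow> nat \<Rightarrow> nat" where
  "total N s i = N i + N (prev i) + s i"

lemma up_low_total:
  "\<alpha> \<in> mons (\<lambda>i. int (N i)) s \<Longrightarrow> up_deg i \<alpha> + low_deg i \<alpha> = total N s i"
  by (simp add: up_low_deg mons_def total_def)

definition bump :: "nat \<Rightarrow> (nat \<Rightarrow> nat) \<Rightarrow> nat \<Rightarrow> nat" where
  "bump j \<omega> i = (if i = j then \<omega> i + 1 else \<omega> i)"

definition wmons :: "(nat \<Rightarrow> nat) \<Rightarrow> (nat \<Rightarrow> nat) \<Rightarrow> (nat \<Rightarrow> nat) \<Rightarrow> var mon set" where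
  "wmons N s \<omega> = {\<alpha> \<in> mons (\<lambda>i. int (N i)) s. \<forall>i\<in>{1..r}. up_deg i \<alpha> = \<omega> i}"

text \<open>The vectors of weight \<open>\<omega>\<close> that are highest weight vectors at the
  vertices in \<open>J\<close>. Growing \<open>J\<close> leads from full weight spaces, where
  monomials are counted, to the invariants.\<close>

definition wspace :: "(nat \<Rightarrow> nat) \<Rightarrow> (nat \<Rightarrow> nat) \<Rightarrow> nat set \<Rightarrow> (nat \<Rightarrow> nat) \<Rightarrow> var pol set" where
  "wspace N s J \<omega> = {p. keys p \<subseteq> wmons N s \<omega> \<and> (\<forall>i\<in>J. root_op i 1 2 p = 0)}"

lemma subspace_wspace: "P.V.subspace (wspace N s J \<omega>)"
proof -
  have "wspace N s J \<omega> = {p. keys p \<subseteq> wmons N s \<omega>} \<inter> {p. \<forall>i\<in>J. root_op i 1 2 p = 0}"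
    by (auto simp: wspace_def)
  moreover have "P.V.subspace {p. \<forall>i\<in>J. root_op i 1 2 p = 0}"
    by (rule P.V.subspaceI) (auto simp: root_op_rules pscale_def)
  ultimately show ?thesis by (simp only: P.V.subspace_inter subspace_keys)
qed

lemma finite_wmons: "supported N \<Longrightarrow> supported s \<Longrightarrow> finite (wmons N s \<omega>)"
  by (rule finite_subset[OF _ finite_mons[of "\<lambda>i. int (N i)" s]]) (auto simp: wmons_def supported_def)

lemma fin_dim_wspace: "supported N \<Longrightarrow> supported s \<Longrightarrow> fin_dim pscale (wspace N s J \<omega>)"
  by (rule P.fin_dim_subset[OF fin_dim_keys[OF finite_wmons[of N s \<omega>]]]) (auto simp: wspace_def)

lemma weight_op_wspace:
  assumes "p \<in> wspace N s J \<omega>" "i \<in> {1..r}"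
  shows "weight_op i p = pscale (of_int (2 * int (\<omega> i) - int (total N s i))) p"
proof (rule poly_mapping_eqI)
  fix \<alpha>
  show "lookup (weight_op i p) \<alpha> = lookup (pscale (of_int (2 * int (\<omega> i) - int (total N s i))) p) \<alpha>"
  proof (cases "\<alpha> \<in> keys p")
    case True
    then have \<alpha>: "\<alpha> \<in> mons (\<lambda>i. int (N i)) s" "up_deg i \<alpha> = \<omega> i"
      using assms by (auto simp: wspace_def wmons_def)
    have "int (up_deg i \<alpha>) - int (low_deg i \<alpha>) = 2 * int (\<omega> i) - int (total N s i)"
      using up_low_total[OF \<alpha>(1), of i] \<alpha>(2) by linarith
    then have "(of_int (int (up_deg i \<alpha>) - int (low_deg i \<alpha>)) :: complex) = of_int (2 * int (\<omega> i) - int (total N s i))"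
      by (simp only:)
    then show ?thesis by (simp add: lookup_weight_op pscale_def)
  next
    case False
    then show ?thesis by (simp add: lookup_weight_op pscale_def in_keys_iff)
  qed
qed

text \<open>The additive condition on \<open>\<omega>'\<close> covers both directions:
  \<open>b = 2\<close> raises the weight at \<open>j\<close> by one, \<open>b = 1\<close> lowers
  it.\<close>

lemma root_op_keys_wmons:
  assumes p: "keys p \<subseteq> wmons N s \<omega>" and j: "j \<in> {1..r}" and ab: "a \<noteq> b"
    and \<omega>': "\<omega>' j + (if b = 1 then 1 else 0) = \<omega> j + (if b = 2 then 1 else 0)"
    and other: "\<And>i. i \<in> {1..r} \<Longrightarrow> i \<noteq> j \<Longrightarrow> \<omega>' i = \<omega> i"
  shows "keys (root_op j a b p) \<subseteq> wmons N s \<omega>'"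
proof
  fix \<alpha> assume "\<alpha> \<in> keys (root_op j a b p)"
  then obtain \<beta> u w where \<alpha>: "\<alpha> = \<beta> + single u 1" and \<beta>: "\<beta> + single w 1 \<in> keys p"
    and uw: "(\<exists>c. u = X j b c \<and> w = X j a c) \<or> (\<exists>c. u = X (prev j) c a \<and> w = X (prev j) c b)
      \<or> (u = U j b \<and> w = U j a)"
    by (rule keys_root_op)
  have \<beta>': "\<beta> + single w 1 \<in> mons (\<lambda>i. int (N i)) s" "\<And>i. i \<in> {1..r} \<Longrightarrow> up_deg i (\<beta> + single w 1) = \<omega> i"
    using p \<beta> by (auto simp: wmons_def)
  have deg: "degX i (single u 1) = degX i (single w 1)" "degU i (single u 1) = degU i (single w 1)" for i
    using uw by auto
  have upj: "up_deg j (single u 1) + (if b = 1 then 1 else 0) = up_deg j (single w 1) + (if b = 2 then 1 else 0)"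
    using uw ab prev_neq[OF j] exhaust_2[of a] exhaust_2[of b]
    by (elim disjE exE conjE) (simp_all add: up_deg_single)
  have upi: "up_deg i (single u 1) = up_deg i (single w 1)" if "i \<in> {1..r}" "i \<noteq> j" for i
    using uw prev_inj[OF that(1) j] that
    by (elim disjE exE conjE) (simp_all add: up_deg_single)
  have "\<alpha> \<in> mons (\<lambda>i. int (N i)) s"
    using \<beta>'(1) by (simp add: mons_def \<alpha> deg)
  moreover have "up_deg i \<alpha> = \<omega>' i" if i: "i \<in> {1..r}" for i
  proof (cases "i = j")
    case True
    then show ?thesis
      using \<beta>'(2)[OF i] upj \<omega>' exhaust_2[of b] by (elim disjE) (simp_all add: \<alpha>)
  next
    case False
    then show ?thesis using \<beta>'(2)[OF i] upi[OF i] other[OF i] by (simp add: \<alpha>)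
  qed
  ultimately show "\<alpha> \<in> wmons N s \<omega>'" by (simp add: wmons_def)
qed

lemma raise_wspace:
  assumes "p \<in> wspace N s J \<omega>" "J \<subseteq> {1..r}" "j \<in> {1..r}" "j \<notin> J"
  shows "root_op j 1 2 p \<in> wspace N s J (bump j \<omega>)"
proof -
  have "keys (root_op j 1 2 p) \<subseteq> wmons N s (bump j \<omega>)"
    by (rule root_op_keys_wmons[of p N s \<omega>]) (use assms in \<open>auto simp: wspace_def bump_def\<close>)
  moreover have "root_op i 1 2 (root_op j 1 2 p) = 0" if "i \<in> J" for i
  proof -
    have "root_op i 1 2 (root_op j 1 2 p) = root_op j 1 2 (root_op i 1 2 p)"
      using that assms by (intro root_op_commute) auto
    then show ?thesis using assms(1) that by (simp add: wspace_def root_op_rules)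
  qed
  ultimately show ?thesis by (simp add: wspace_def)
qed

lemma lower_wspace:
  assumes "p \<in> wspace N s J (bump j \<omega>)" "J \<subseteq> {1..r}" "j \<in> {1..r}" "j \<notin> J"
  shows "root_op j 2 1 p \<in> wspace N s J \<omega>"
proof -
  have "keys (root_op j 2 1 p) \<subseteq> wmons N s \<omega>"
    by (rule root_op_keys_wmons[of p N s "bump j \<omega>"]) (use assms in \<open>auto simp: wspace_def bump_def\<close>)
  moreover have "root_op i 1 2 (root_op j 2 1 p) = 0" if "i \<in> J" for i
  proof -
    have "root_op i 1 2 (root_op j 2 1 p) = root_op j 2 1 (root_op i 1 2 p)"
      using that assms by (intro root_op_commute) auto
    then show ?thesis using assms(1) that by (simp add: wspace_def root_op_rules)
  qed
  ultimately show ?thesis by (simp add: wspace_def)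
qed

text \<open>If F p = 0, then [E, F] = H gives - F E p = l p with \<open>l > 0\<close>. Pairing with
  \<open>p\<close> turns this into - |E p|^2 = l |p|^2, so \<open>p\<close> vanishes.\<close>

lemma lower_injective:
  assumes p: "p \<in> wspace N s J \<omega>" and j: "j \<in> {1..r}" and \<omega>: "2 * \<omega> j > total N s j" and z: "root_op j 2 1 p = 0"
  shows "p = 0"
proof -
  define l where "l = 2 * int (\<omega> j) - int (total N s j)"
  have l: "l > 0" using \<omega> by (simp add: l_def)
  have "- root_op j 2 1 (root_op j 1 2 p) = pscale (of_int l) p"
    using root_op_bracket[OF j, of p] weight_op_wspace[OF p j] z by (simp add: root_op_rules l_def)
  then have "pip (- root_op j 2 1 (root_op j 1 2 p)) p = of_int l * pip p p"
    by (simp add: P.ip_scale_left)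
  then have "- pip (root_op j 1 2 p) (root_op j 1 2 p) = of_int l * pip p p"
    by (simp add: P.ip_minus_left pip_root_op)
  then have "- Re (pip (root_op j 1 2 p) (root_op j 1 2 p)) = of_int l * Re (pip p p)"
    by (metis Re_complex_of_real complex_Re_of_int mult.commute of_real_of_int_eq times_complex.sel(1)
        Im_complex_of_real mult_zero_left mult_zero_right diff_zero uminus_complex.sel(1))
  moreover have "Re (pip (root_op j 1 2 p) (root_op j 1 2 p)) \<ge> 0" "Re (pip p p) \<ge> 0"
    by (rule P.ip_nonneg)+
  moreover have "of_int l * Re (pip p p) \<ge> 0" using l P.ip_nonneg[of p] by simp
  ultimately have "of_int l * Re (pip p p) = 0" by linarith
  then have "Re (pip p p) = 0" using l by simp
  moreover have "Im (pip p p) = 0"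
    using arg_cong[OF P.ip_cnj[of p p], of Im] by simp
  ultimately show ?thesis using P.ip_definite complex_eq_iff by (metis zero_complex.sel)
qed

text \<open>The kernel of raising is the orthogonal complement of the image of its adjoint,
  lowering. The conditions at the vertices of \<open>J\<close> are respected because different
  vertices commute.\<close>

lemma wspace_insert:
  assumes J: "J \<subseteq> {1..r}" and j: "j \<in> {1..r}" "j \<notin> J"
  shows "wspace N s (insert j J) \<omega>
    = wspace N s J \<omega> \<inter> P.orth (root_op j 2 1 ` wspace N s J (bump j \<omega>))"
proof (intro equalityI subsetI)
  fix p assume p: "p \<in> wspace N s (insert j J) \<omega>"
  then have "pip p (root_op j 2 1 q) = 0" for q
    by (simp add: wspace_def flip: pip_root_op)
  then show "p \<in> wspace N s J \<omega> \<inter> P.orth (root_op j 2 1 ` wspace N s J (bump j \<omega>))"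
    using p by (auto simp: wspace_def P.orth_def)
next
  fix p assume p: "p \<in> wspace N s J \<omega> \<inter> P.orth (root_op j 2 1 ` wspace N s J (bump j \<omega>))"
  then have "root_op j 1 2 p \<in> wspace N s J (bump j \<omega>)"
    using raise_wspace J j by blast
  then have "pip p (root_op j 2 1 (root_op j 1 2 p)) = 0"
    using p by (auto simp: P.orth_def)
  then have "root_op j 1 2 p = 0"
    using P.ip_definite[of "root_op j 1 2 p"] by (simp add: pip_root_op)
  then show "p \<in> wspace N s (insert j J) \<omega>"
    using p by (simp add: wspace_def)
qed

lemma linear_root_op: "Vector_Spaces.linear pscale pscale (root_op i a b)"
  unfolding Vector_Spaces.linear_iff by (simp add: vector_space_pscale root_op_rules pscale_def)

text \<open>The weight one step above \<open>\<omega> j\<close> is strictly positive, so lowering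
  from it is injective; highest weight vectors make up the complement of its image.\<close>

lemma dim_wspace_insert:
  assumes sup: "supported N" "supported s" and J: "J \<subseteq> {1..r}" and j: "j \<in> {1..r}" "j \<notin> J"
    and \<omega>: "2 * \<omega> j \<ge> total N s j"
  shows "P.V.dim (wspace N s J \<omega>)
    = P.V.dim (wspace N s J (bump j \<omega>)) + P.V.dim (wspace N s (insert j J) \<omega>)"
proof -
  interpret lin: Vector_Spaces.linear pscale pscale "root_op j 2 1" by (rule linear_root_op)
  interpret vp: vector_space_pair pscale pscale
    unfolding vector_space_pair_def by (simp add: vector_space_pscale)
  let ?W = "wspace N s J (bump j \<omega>)"
  have "inj_on (root_op j 2 1) ?W"
  proof (rule inj_onI)
    fix p q assume pq: "p \<in> ?W" "q \<in> ?W" "root_op j 2 1 p = root_op j 2 1 q"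
    then have "p - q \<in> ?W" using P.V.subspace_diff[OF subspace_wspace] by blast
    then have "p - q = 0"
      by (rule lower_injective[OF _ j(1)]) (use \<omega> pq in \<open>simp_all add: root_op_rules bump_def\<close>)
    then show "p = q" by simp
  qed
  then have "P.V.dim (root_op j 2 1 ` ?W) = P.V.dim ?W"
    by (rule vp.dim_inj_image_subspace[OF linear_root_op _ subspace_wspace])
  moreover have "P.V.dim (wspace N s J \<omega>) = P.V.dim (root_op j 2 1 ` ?W)
      + P.V.dim (wspace N s J \<omega> \<inter> P.orth (root_op j 2 1 ` ?W))"
    using lower_wspace[OF _ J j]
    by (intro P.dim_orth subspace_wspace fin_dim_wspace sup lin.subspace_image) auto
  ultimately show ?thesis by (simp add: wspace_insert[OF J j])
qed

section \<open>Counting monomials of a given weight\<close>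

definition deg_choices :: "(nat \<Rightarrow> nat) \<Rightarrow> (nat \<Rightarrow> nat) set" where
  "deg_choices N = (\<Pi>\<^sub>E i\<in>{1..r}. {m. m \<le> N i \<and> even (N i - m)})"

definition half :: "(nat \<Rightarrow> nat) \<Rightarrow> (nat \<Rightarrow> nat) \<Rightarrow> nat \<Rightarrow> nat" where
  "half N m i = (N i - m i) div 2"

text \<open>For fixed \<open>m\<close>, the weight at vertex \<open>i\<close> involves only the row
  datum of X_i, the column datum of X_(i-1) and one exponent of the vector at \<open>i\<close>. No
  datum is shared between vertices, so the count becomes a product.\<close>

definition local_choices :: "(nat \<Rightarrow> nat) \<Rightarrow> (nat \<Rightarrow> nat) \<Rightarrow> (nat \<Rightarrow> nat) \<Rightarrow> nat \<Rightarrow> nat \<Rightarrow> (nat \<times> nat \<times> nat) set" where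
  "local_choices N s m i v = {(p, q, k). p \<le> m i \<and> q \<le> m (prev i) \<and> k \<le> s i
     \<and> p + q + k + half N m i + half N m (prev i) = v}"

lemma finite_deg_choices: "finite (deg_choices N)"
  unfolding deg_choices_def
  by (rule finite_PiE) (auto intro: finite_subset[of _ "{..N i}" for i])

lemma finite_local_choices: "finite (local_choices N s m i v)"
  by (rule finite_subset[of _ "{..m i} \<times> {..m (prev i)} \<times> {..s i}"]) (auto simp: local_choices_def)

definition encode_m :: "(nat \<Rightarrow> nat) \<Rightarrow> var mon \<Rightarrow> nat \<Rightarrow> nat" where
  "encode_m N \<alpha> i = N i - 2 * min (lookup \<alpha> (X i 1 1)) (lookup \<alpha> (X i 2 2))"

definition encode_p :: "var mon \<Rightarrow> nat \<Rightarrow> nat" where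
  "encode_p \<alpha> i = lookup \<alpha> (X i 2 1) + lookup \<alpha> (X i 2 2) - min (lookup \<alpha> (X i 1 1)) (lookup \<alpha> (X i 2 2))"

definition encode_q :: "var mon \<Rightarrow> nat \<Rightarrow> nat" where
  "encode_q \<alpha> i = lookup \<alpha> (X i 1 1) + lookup \<alpha> (X i 2 1) - min (lookup \<alpha> (X i 1 1)) (lookup \<alpha> (X i 2 2))"

text \<open>\<open>t i\<close> holds what is met at vertex \<open>i\<close>: the \<open>p\<close> of
  X_i, the \<open>q\<close> of X_(i-1) and the exponent of \<open>U i 2\<close>. Hence the
  \<open>q\<close> of X_i is found at \<open>nxt r i\<close>.\<close>

definition decode_fun :: "(nat \<Rightarrow> nat) \<Rightarrow> (nat \<Rightarrow> nat) \<Rightarrow> (nat \<Rightarrow> nat) \<times> (nat \<Rightarrow> nat \<times> nat \<times> nat) \<Rightarrow> var \<Rightarrow> nat" where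
  "decode_fun N s mt v = (case mt of (m, t) \<Rightarrow> (case v of
      X i a b \<Rightarrow> (let k = half N m i; p = fst (t i); q = fst (snd (t (nxt r i))) in
        if a = 1 then (if b = 1 then k + (q - p) else m i - max p q)
        else (if b = 1 then min p q else k + (p - q)))
    | U i a \<Rightarrow> if a = 1 then s i - snd (snd (t i)) else snd (snd (t i))))"

definition decode :: "(nat \<Rightarrow> nat) \<Rightarrow> (nat \<Rightarrow> nat) \<Rightarrow> (nat \<Rightarrow> nat) \<times> (nat \<Rightarrow> nat \<times> nat \<times> nat) \<Rightarrow> var mon" where
  "decode N s mt = Abs_poly_mapping (\<lambda>v. if v \<in> vars r then decode_fun N s mt v else 0)"

lemma lookup_decode: "lookup (decode N s mt) v = (if v \<in> vars r then decode_fun N s mt v else 0)"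
proof -
  have "finite {v. (if v \<in> vars r then decode_fun N s mt v else 0) \<noteq> 0}"
    by (rule finite_subset[OF _ finite_vars]) auto
  then show ?thesis by (simp add: decode_def)
qed

text \<open>A monomial in the entries of \<open>X\<^sub>i\<close> of degree \<open>N\<^sub>i\<close> is recorded by \<open>m\<^sub>i = N\<^sub>i - 2 k\<^sub>i\<close> with
  \<open>k\<^sub>i = min (\<alpha>\<^sub>1\<^sub>1) (\<alpha>\<^sub>2\<^sub>2)\<close> and by its row and column sums; this realises
  \<open>Sym\<^bsup>N\<^esup> (\<complex>\<^sup>2 \<otimes> \<complex>\<^sup>2) = \<Oplus>\<^sub>m F\<^sub>m \<otimes> F\<^sub>m\<close> on the level of weights.\<close>

lemma bij_wmons:
  assumes sup: "supported N" "supported s"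
  shows "bij_betw (\<lambda>\<alpha>. (restrict (encode_m N \<alpha>) {1..r},
      \<lambda>i\<in>{1..r}. (encode_p \<alpha> i, encode_q \<alpha> (prev i), lookup \<alpha> (U i 2))))
    (wmons N s \<omega>) (Sigma (deg_choices N) (\<lambda>m. \<Pi>\<^sub>E i\<in>{1..r}. local_choices N s m i (\<omega> i)))"
proof (rule bij_betw_byWitness[of _ "decode N s"])
  let ?f = "\<lambda>\<alpha>. (restrict (encode_m N \<alpha>) {1..r},
      \<lambda>i\<in>{1..r}. (encode_p \<alpha> i, encode_q \<alpha> (prev i), lookup \<alpha> (U i 2)))"
  let ?B = "Sigma (deg_choices N) (\<lambda>m. \<Pi>\<^sub>E i\<in>{1..r}. local_choices N s m i (\<omega> i))"
  have N: "N i = lookup \<alpha> (X i 1 1) + lookup \<alpha> (X i 1 2) + lookup \<alpha> (X i 2 1) + lookup \<alpha> (X i 2 2)"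
    and s: "s i = lookup \<alpha> (U i 1) + lookup \<alpha> (U i 2)"
    if "\<alpha> \<in> wmons N s \<omega>" for \<alpha> i
  proof -
    have "int (degX i \<alpha>) = int (N i)" "degU i \<alpha> = s i" using that by (simp_all add: wmons_def mons_def)
    then show "N i = lookup \<alpha> (X i 1 1) + lookup \<alpha> (X i 1 2) + lookup \<alpha> (X i 2 1) + lookup \<alpha> (X i 2 2)"
      "s i = lookup \<alpha> (U i 1) + lookup \<alpha> (U i 2)"
      unfolding degX_def degU_def by linarith+
  qed
  note enc = exponents_encode[OF N, folded encode_p_def encode_q_def encode_m_def]
  have half: "half N (encode_m N \<alpha>) i = min (lookup \<alpha> (X i 1 1)) (lookup \<alpha> (X i 2 2))"
    if "\<alpha> \<in> wmons N s \<omega>" for \<alpha> i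
    using enc(3)[OF that, of i] by (simp add: half_def)
  show "\<forall>\<alpha>\<in>wmons N s \<omega>. decode N s (?f \<alpha>) = \<alpha>"
  proof (intro ballI poly_mapping_eqI)
    fix \<alpha> v assume \<alpha>: "\<alpha> \<in> wmons N s \<omega>"
    show "lookup (decode N s (?f \<alpha>)) v = lookup \<alpha> v"
    proof (cases "v \<in> vars r")
      case True
      show ?thesis
      proof (cases v)
        case (X i a b)
        then have i: "i \<in> {1..r}" using True by simp
        have h: "half N (restrict (encode_m N \<alpha>) {1..r}) i = min (lookup \<alpha> (X i 1 1)) (lookup \<alpha> (X i 2 2))"
          using half[OF \<alpha>, of i] i by (simp add: half_def)
        show ?thesis
          using i nxt_in[OF i] prev_nxt[OF i] True exhaust_2[of a] exhaust_2[of b]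
            enc(8-11)[OF \<alpha>, of i]
          by (elim disjE) (simp_all add: X lookup_decode decode_fun_def h Let_def del: atLeastAtMost_iff)
      next
        case (U i a)
        then show ?thesis
          using True exhaust_2[of a] s[OF \<alpha>, of i]
          by (elim disjE) (simp_all add: lookup_decode decode_fun_def del: atLeastAtMost_iff)
      qed
    next
      case False
      then have "v \<notin> keys \<alpha>"
        using mons_in_range[of "\<lambda>i. int (N i)" s \<alpha>] \<alpha> sup by (auto simp: wmons_def supported_def)
      then show ?thesis using False by (simp add: lookup_decode in_keys_iff)
    qed
  qed
  show "?f ` wmons N s \<omega> \<subseteq> ?B"
  proof (rule image_subsetI, rule SigmaI)
    fix \<alpha> assume \<alpha>: "\<alpha> \<in> wmons N s \<omega>"
    show "restrict (encode_m N \<alpha>) {1..r} \<in> deg_choices N"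
      using enc(1,2)[OF \<alpha>] by (simp add: deg_choices_def)
    show "(\<lambda>i\<in>{1..r}. (encode_p \<alpha> i, encode_q \<alpha> (prev i), lookup \<alpha> (U i 2)))
        \<in> (\<Pi>\<^sub>E i\<in>{1..r}. local_choices N s (restrict (encode_m N \<alpha>) {1..r}) i (\<omega> i))"
    proof (rule restrict_PiE_iff[THEN iffD2], rule ballI)
      fix i assume i: "i \<in> {1..r}"
      have "up_deg i \<alpha> = \<omega> i" using \<alpha> i by (simp add: wmons_def)
      then have "encode_p \<alpha> i + encode_q \<alpha> (prev i) + lookup \<alpha> (U i 2)
          + min (lookup \<alpha> (X i 1 1)) (lookup \<alpha> (X i 2 2))
          + min (lookup \<alpha> (X (prev i) 1 1)) (lookup \<alpha> (X (prev i) 2 2)) = \<omega> i"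
        using enc(6)[OF \<alpha>, of i] enc(7)[OF \<alpha>, of "prev i"] by (simp add: up_deg_def)
      then show "(encode_p \<alpha> i, encode_q \<alpha> (prev i), lookup \<alpha> (U i 2))
          \<in> local_choices N s (restrict (encode_m N \<alpha>) {1..r}) i (\<omega> i)"
        using i prev_in[OF i] enc(4)[OF \<alpha>, of i] enc(5)[OF \<alpha>, of "prev i"] s[OF \<alpha>, of i]
          half[OF \<alpha>, of i] half[OF \<alpha>, of "prev i"]
        by (simp add: local_choices_def half_def del: atLeastAtMost_iff)
    qed
  qed
  have dec: "fst (t i) \<le> m i" "fst (snd (t (nxt r i))) \<le> m i" "snd (snd (t i)) \<le> s i" "m i \<le> N i" "even (N i - m i)"
    if mt: "(m, t) \<in> ?B" and i: "i \<in> {1..r}" for m t i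
  proof -
    have "t j \<in> local_choices N s m j (\<omega> j)" if "j \<in> {1..r}" for j
      using mt that by (auto simp: PiE_iff)
    from this[OF i] this[OF nxt_in[OF i]] prev_nxt[OF i]
    show "fst (t i) \<le> m i" "fst (snd (t (nxt r i))) \<le> m i" "snd (snd (t i)) \<le> s i"
      by (auto simp: local_choices_def)
    show "m i \<le> N i" "even (N i - m i)"
      using mt i by (auto simp: deg_choices_def PiE_iff)
  qed
  have lookups: "lookup (decode N s (m, t)) (X i 1 1) = half N m i + (fst (snd (t (nxt r i))) - fst (t i))"
      "lookup (decode N s (m, t)) (X i 2 2) = half N m i + (fst (t i) - fst (snd (t (nxt r i))))"
      "lookup (decode N s (m, t)) (X i 2 1) = min (fst (t i)) (fst (snd (t (nxt r i))))"
      "lookup (decode N s (m, t)) (X i 1 2) = m i - max (fst (t i)) (fst (snd (t (nxt r i))))"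
      "lookup (decode N s (m, t)) (U i 2) = snd (snd (t i))"
      "lookup (decode N s (m, t)) (U i 1) = s i - snd (snd (t i))"
    if "i \<in> {1..r}" for m t i
    using that by (simp_all add: lookup_decode decode_fun_def Let_def del: atLeastAtMost_iff)
  have decoded: "degX i (decode N s (m, t)) = N i" "degU i (decode N s (m, t)) = s i"
      "encode_m N (decode N s (m, t)) i = m i" "encode_p (decode N s (m, t)) i = fst (t i)"
      "encode_q (decode N s (m, t)) i = fst (snd (t (nxt r i)))"
      "lookup (decode N s (m, t)) (X i 2 1) + lookup (decode N s (m, t)) (X i 2 2) = fst (t i) + half N m i"
      "lookup (decode N s (m, t)) (X i 1 1) + lookup (decode N s (m, t)) (X i 2 1) = fst (snd (t (nxt r i))) + half N m i"
    if mt: "(m, t) \<in> ?B" and i: "i \<in> {1..r}" for m t i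
  proof -
    note d = dec[OF mt i]
    note e = exponents_decode[OF d(4,5,1,2), folded half_def]
    show "degX i (decode N s (m, t)) = N i"
      using e(1) by (simp add: degX_def lookups[OF i])
    show "degU i (decode N s (m, t)) = s i"
      using d(3) by (simp add: degU_def lookups[OF i])
    show "lookup (decode N s (m, t)) (X i 2 1) + lookup (decode N s (m, t)) (X i 2 2) = fst (t i) + half N m i"
      using e(4) by (simp only: lookups[OF i])
    show "lookup (decode N s (m, t)) (X i 1 1) + lookup (decode N s (m, t)) (X i 2 1) = fst (snd (t (nxt r i))) + half N m i"
      using e(5) by (simp only: lookups[OF i])
    show "encode_m N (decode N s (m, t)) i = m i"
      unfolding encode_m_def lookups[OF i] e(2) by (rule e(3))
    show "encode_p (decode N s (m, t)) i = fst (t i)"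
      unfolding encode_p_def lookups[OF i] e(2) e(4) by simp
    show "encode_q (decode N s (m, t)) i = fst (snd (t (nxt r i)))"
      unfolding encode_q_def lookups[OF i] e(2) e(5) by simp
  qed
  show "\<forall>mt\<in>?B. ?f (decode N s mt) = mt"
  proof
    fix mt assume mt: "mt \<in> ?B"
    obtain m t where [simp]: "mt = (m, t)" by (cases mt)
    have mt': "(m, t) \<in> ?B" using mt by simp
    have "restrict (encode_m N (decode N s (m, t))) {1..r} = m"
    proof (rule extensionalityI[of _ "{1..r}"])
      show "m \<in> extensional {1..r}" using mt' by (auto simp: deg_choices_def PiE_iff)
    qed (use decoded(3)[OF mt'] in auto)
    moreover have "(\<lambda>i\<in>{1..r}. (encode_p (decode N s (m, t)) i, encode_q (decode N s (m, t)) (prev i), lookup (decode N s (m, t)) (U i 2))) = t"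
    proof (rule extensionalityI[of _ "{1..r}"])
      show "t \<in> extensional {1..r}" using mt' by (auto simp: PiE_iff)
      fix i assume i: "i \<in> {1..r}"
      then show "(\<lambda>i\<in>{1..r}. (encode_p (decode N s (m, t)) i, encode_q (decode N s (m, t)) (prev i), lookup (decode N s (m, t)) (U i 2))) i = t i"
        using decoded(4)[OF mt' i] decoded(5)[OF mt' prev_in[OF i]] lookups(5)[OF i, of m t] nxt_prev[OF i]
        by simp
    qed simp
    ultimately show "?f (decode N s mt) = mt" by simp
  qed
  show "decode N s ` ?B \<subseteq> wmons N s \<omega>"
  proof (rule image_subsetI)
    fix mt assume mt: "mt \<in> ?B"
    obtain m t where mteq: "mt = (m, t)" by (cases mt)
    have mt': "(m, t) \<in> ?B" using mt mteq by simp
    have out: "degX i (decode N s (m, t)) = 0 \<and> degU i (decode N s (m, t)) = 0" if "i \<notin> {1..r}" for i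
      using that by (simp add: degX_def degU_def lookup_decode del: atLeastAtMost_iff)
    have "decode N s (m, t) \<in> mons (\<lambda>i. int (N i)) s"
      unfolding mons_def mem_Collect_eq
    proof (intro conjI allI)
      fix i
      show "int (degX i (decode N s (m, t))) = int (N i)" "degU i (decode N s (m, t)) = s i"
        using decoded(1,2)[OF mt', of i] out[of i] sup by (cases "i \<in> {1..r}"; simp add: supported_def)+
    qed
    moreover have "up_deg i (decode N s (m, t)) = \<omega> i" if i: "i \<in> {1..r}" for i
    proof -
      have "t i \<in> local_choices N s m i (\<omega> i)" using mt' i by (auto simp: PiE_iff)
      then have "fst (t i) + fst (snd (t i)) + snd (snd (t i)) + half N m i + half N m (prev i) = \<omega> i"
        by (auto simp: local_choices_def)
      then show ?thesis
        using decoded(6)[OF mt' i] decoded(7)[OF mt' prev_in[OF i]] lookups(5)[OF i, of m t] nxt_prev[OF i]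
        by (simp add: up_deg_def)
    qed
    ultimately show "decode N s mt \<in> wmons N s \<omega>" by (simp add: wmons_def mteq)
  qed
qed

lemma card_wmons:
  assumes sup: "supported N" "supported s"
  shows "card (wmons N s \<omega>) = (\<Sum>m\<in>deg_choices N. \<Prod>i\<in>{1..r}. card (local_choices N s m i (\<omega> i)))"
proof -
  have "card (wmons N s \<omega>) = card (Sigma (deg_choices N) (\<lambda>m. \<Pi>\<^sub>E i\<in>{1..r}. local_choices N s m i (\<omega> i)))"
    by (rule bij_betw_same_card[OF bij_wmons[OF sup]])
  also have "\<dots> = (\<Sum>m\<in>deg_choices N. card (\<Pi>\<^sub>E i\<in>{1..r}. local_choices N s m i (\<omega> i)))"
    by (rule card_SigmaI) (auto intro!: finite_deg_choices finite_PiE finite_local_choices)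
  also have "\<dots> = (\<Sum>m\<in>deg_choices N. \<Prod>i\<in>{1..r}. card (local_choices N s m i (\<omega> i)))"
    by (rule sum.cong) (simp_all add: card_PiE)
  finally show ?thesis .
qed

text \<open>Vertices enter \<open>J\<close> one at a time. In each summand only the factor at the
  new vertex \<open>j\<close> differs between the weights \<open>\<omega>\<close> and
  \<open>bump j \<omega>\<close>, so the difference of products is a product with a difference as
  factor at \<open>j\<close>.\<close>

lemma dim_wspace:
  assumes sup: "supported N" "supported s" and "finite J" "J \<subseteq> {1..r}" "\<And>i. i \<in> J \<Longrightarrow> 2 * \<omega> i \<ge> total N s i"
  shows "int (P.V.dim (wspace N s J \<omega>)) = (\<Sum>m\<in>deg_choices N. \<Prod>i\<in>{1..r}.
     int (card (local_choices N s m i (\<omega> i))) - (if i \<in> J then int (card (local_choices N s m i (\<omega> i + 1))) else 0))"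
  using assms(3-)
proof (induction J arbitrary: \<omega>)
  case empty
  have "wspace N s {} \<omega> = {p. keys p \<subseteq> wmons N s \<omega>}" by (simp add: wspace_def)
  then show ?case
    by (simp add: dim_keys finite_wmons[OF sup] card_wmons[OF sup])
next
  case (insert j J)
  let ?c = "\<lambda>m i v. int (card (local_choices N s m i v))"
  let ?g = "\<lambda>m i. ?c m i (\<omega> i) - (if i \<in> J then ?c m i (\<omega> i + 1) else 0)"
  let ?\<omega>' = "bump j \<omega>"
  have j: "j \<in> {1..r}" "J \<subseteq> {1..r}" using insert.prems by auto
  have 1: "int (P.V.dim (wspace N s J \<omega>)) = (\<Sum>m\<in>deg_choices N. \<Prod>i\<in>{1..r}. ?g m i)"
    using insert by (intro insert.IH) auto
  have 2: "int (P.V.dim (wspace N s J ?\<omega>'))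
      = (\<Sum>m\<in>deg_choices N. \<Prod>i\<in>{1..r}. ?c m i (?\<omega>' i) - (if i \<in> J then ?c m i (?\<omega>' i + 1) else 0))"
    using insert by (intro insert.IH) (auto simp: bump_def)
  have "int (P.V.dim (wspace N s (insert j J) \<omega>)) = int (P.V.dim (wspace N s J \<omega>)) - int (P.V.dim (wspace N s J ?\<omega>'))"
    using dim_wspace_insert[OF sup j(2,1) insert.hyps(2), of \<omega>] insert.prems by simp
  also have "\<dots> = (\<Sum>m\<in>deg_choices N. (\<Prod>i\<in>{1..r}. ?g m i)
      - (\<Prod>i\<in>{1..r}. ?c m i (?\<omega>' i) - (if i \<in> J then ?c m i (?\<omega>' i + 1) else 0)))"
    unfolding 1 2 by (rule sum_subtractf[symmetric])
  also have "\<dots> = (\<Sum>m\<in>deg_choices N. \<Prod>i\<in>{1..r}. ?c m i (\<omega> i) - (if i \<in> insert j J then ?c m i (\<omega> i + 1) else 0))"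
  proof (rule sum.cong[OF refl])
    fix m
    have a: "(\<Prod>i\<in>{1..r}. ?g m i) = ?c m j (\<omega> j) * (\<Prod>i\<in>{1..r} - {j}. ?g m i)"
      using j insert.hyps(2) by (simp add: prod.remove[of _ j])
    have b: "(\<Prod>i\<in>{1..r}. ?c m i (?\<omega>' i) - (if i \<in> J then ?c m i (?\<omega>' i + 1) else 0))
        = ?c m j (\<omega> j + 1) * (\<Prod>i\<in>{1..r} - {j}. ?g m i)"
    proof -
      have "(\<Prod>i\<in>{1..r} - {j}. ?c m i (?\<omega>' i) - (if i \<in> J then ?c m i (?\<omega>' i + 1) else 0))
          = (\<Prod>i\<in>{1..r} - {j}. ?g m i)"
        by (rule prod.cong) (simp_all add: bump_def)
      then show ?thesis
        using j insert.hyps(2) by (simp add: prod.remove[of _ j] bump_def)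
    qed
    have c: "(\<Prod>i\<in>{1..r}. ?c m i (\<omega> i) - (if i \<in> insert j J then ?c m i (\<omega> i + 1) else 0))
        = (?c m j (\<omega> j) - ?c m j (\<omega> j + 1)) * (\<Prod>i\<in>{1..r} - {j}. ?g m i)"
    proof -
      have "(\<Prod>i\<in>{1..r} - {j}. ?c m i (\<omega> i) - (if i \<in> insert j J then ?c m i (\<omega> i + 1) else 0))
          = (\<Prod>i\<in>{1..r} - {j}. ?g m i)"
        by (rule prod.cong) simp_all
      then show ?thesis
        using j by (simp add: prod.remove[of _ j])
    qed
    show "(\<Prod>i\<in>{1..r}. ?g m i) - (\<Prod>i\<in>{1..r}. ?c m i (?\<omega>' i) - (if i \<in> J then ?c m i (?\<omega>' i + 1) else 0))
        = (\<Prod>i\<in>{1..r}. ?c m i (\<omega> i) - (if i \<in> insert j J then ?c m i (\<omega> i + 1) else 0))"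
      unfolding a b c by (simp add: left_diff_distrib)
  qed
  finally show ?case .
qed

lemma inv_space_up_deg:
  assumes p: "p \<in> inv_space (\<lambda>i. int (N i)) s" and i: "i \<in> {1..r}" and \<alpha>: "\<alpha> \<in> keys p"
  shows "2 * up_deg i \<alpha> = total N s i"
proof -
  have "root_op i 1 2 p = 0" "root_op i 2 1 p = 0" using p i by (auto simp: inv_space_def)
  then have "weight_op i p = 0" using root_op_bracket[OF i, of p] by (simp add: root_op_rules)
  then have "(of_nat (up_deg i \<alpha>) - of_nat (low_deg i \<alpha>)) * lookup p \<alpha> = 0"
    using lookup_weight_op[of i p \<alpha>] by simp
  then have "up_deg i \<alpha> = low_deg i \<alpha>" using \<alpha> by (simp add: in_keys_iff)
  moreover have "\<alpha> \<in> mons (\<lambda>i. int (N i)) s" using p \<alpha> by (auto simp: inv_space_def hom_space_def)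
  ultimately show ?thesis using up_low_total[of \<alpha> N s i] by simp
qed

lemma inv_space_odd:
  assumes "i \<in> {1..r}" "odd (total N s i)"
  shows "inv_space (\<lambda>i. int (N i)) s \<subseteq> {0}"
proof
  fix p assume p: "p \<in> inv_space (\<lambda>i. int (N i)) s"
  have "keys p = {}"
  proof (rule ccontr)
    assume "keys p \<noteq> {}"
    then obtain \<alpha> where "\<alpha> \<in> keys p" by blast
    from inv_space_up_deg[OF p assms(1) this] assms(2) show False by (metis dvd_triv_left)
  qed
  then show "p \<in> {0}" by (simp add: poly_mapping_eq_iff fun_eq_iff in_keys_iff set_eq_iff)
qed

text \<open>A highest weight vector of weight zero is killed by lowering as well: |F p|^2 is the
  pairing of \<open>p\<close> with E F p = F E p + H p = 0.\<close>

lemma inv_space_eq_wspace: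
  assumes ev: "\<And>i. i \<in> {1..r} \<Longrightarrow> 2 * \<omega> i = total N s i"
  shows "inv_space (\<lambda>i. int (N i)) s = wspace N s {1..r} \<omega>"
proof (intro equalityI subsetI)
  fix p assume p: "p \<in> inv_space (\<lambda>i. int (N i)) s"
  have "up_deg i \<alpha> = \<omega> i" if "i \<in> {1..r}" "\<alpha> \<in> keys p" for i \<alpha>
    using inv_space_up_deg[OF p that] ev[OF that(1)] by simp
  then show "p \<in> wspace N s {1..r} \<omega>"
    using p by (auto simp: inv_space_def hom_space_def wspace_def wmons_def)
next
  fix p assume p: "p \<in> wspace N s {1..r} \<omega>"
  have "root_op i a b p = 0" if i: "i \<in> {1..r}" and ab: "a \<noteq> b" for i a b
  proof -
    have E: "root_op i 1 2 p = 0" using p i by (simp add: wspace_def)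
    have "weight_op i p = 0"
    proof -
      have "2 * int (\<omega> i) - int (total N s i) = 0" using ev[OF i] by linarith
      then show ?thesis using weight_op_wspace[OF p i] by (simp only:) (simp add: pscale_def)
    qed
    then have "root_op i 1 2 (root_op i 2 1 p) = 0"
      using root_op_bracket[OF i, of p] E by (simp add: root_op_rules)
    then have "pip (root_op i 2 1 p) (root_op i 2 1 p) = 0" by (simp add: pip_root_op[of i 2 1])
    then have "root_op i 2 1 p = 0" by (rule P.ip_definite)
    then show ?thesis using E ab exhaust_2[of a] exhaust_2[of b] by auto
  qed
  then show "p \<in> inv_space (\<lambda>i. int (N i)) s"
    using p by (auto simp: inv_space_def hom_space_def wspace_def wmons_def)
qed

section \<open>Lattice points and dimensions of invariants\<close>

definition lattice_points :: "(nat \<Rightarrow> int) \<Rightarrow> (nat \<Rightarrow> nat) \<Rightarrow> (nat \<Rightarrow> nat) set" where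
  "lattice_points n s = {m \<in> {1..r} \<rightarrow>\<^sub>E UNIV. \<forall>i\<in>{1..r}. int (m i) \<le> n i \<and> even (n i - int (m i))
     \<and> triangle (m i) (m (prev i)) (s i)}"

lemma finite_lattice_points: "finite (lattice_points n s)"
proof (rule finite_subset)
  show "lattice_points n s \<subseteq> (\<Pi>\<^sub>E i\<in>{1..r}. {..nat (n i)})"
  proof
    fix m assume m: "m \<in> lattice_points n s"
    have "m i \<in> {..nat (n i)}" if "i \<in> {1..r}" for i
    proof -
      have "int (m i) \<le> n i" using m that by (simp add: lattice_points_def)
      then show ?thesis by simp
    qed
    then show "m \<in> (\<Pi>\<^sub>E i\<in>{1..r}. {..nat (n i)})"
      using m by (auto simp only: lattice_points_def PiE_iff mem_Collect_eq)
  qed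
qed (simp add: finite_PiE)

text \<open>At weight zero each factor of the product is a Clebsch-Gordan multiplicity 0 or 1, so
  the summand for \<open>m\<close> is the indicator of the triangle inequalities around the
  cycle.\<close>

lemma dim_inv_space_nat:
  assumes sup: "supported N" "supported s" and ev: "\<And>i. i \<in> {1..r} \<Longrightarrow> even (total N s i)"
  shows "P.V.dim (inv_space (\<lambda>i. int (N i)) s) = card (lattice_points (\<lambda>i. int (N i)) s)"
proof -
  define \<omega> where "\<omega> i = total N s i div 2" for i
  have \<omega>: "2 * \<omega> i = total N s i" if "i \<in> {1..r}" for i using ev[OF that] by (simp add: \<omega>_def)
  have "int (P.V.dim (inv_space (\<lambda>i. int (N i)) s)) = (\<Sum>m\<in>deg_choices N. \<Prod>i\<in>{1..r}.
     int (card (local_choices N s m i (\<omega> i))) - (if i \<in> {1..r} then int (card (local_choices N s m i (\<omega> i + 1))) else 0))"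
  proof -
    have "inv_space (\<lambda>i. int (N i)) s = wspace N s {1..r} \<omega>"
      by (rule inv_space_eq_wspace) (rule \<omega>)
    then show ?thesis
      by (simp only:) (rule dim_wspace[OF sup], use \<omega> in auto)
  qed
  also have "\<dots> = (\<Sum>m\<in>deg_choices N. if \<forall>i\<in>{1..r}. triangle (m i) (m (prev i)) (s i) then 1 else 0)"
  proof (rule sum.cong[OF refl])
    fix m assume m: "m \<in> deg_choices N"
    have "(\<Prod>i\<in>{1..r}. int (card (local_choices N s m i (\<omega> i))) - (if i \<in> {1..r} then int (card (local_choices N s m i (\<omega> i + 1))) else 0))
        = (\<Prod>i\<in>{1..r}. if triangle (m i) (m (prev i)) (s i) then 1 else 0)"
    proof (rule prod.cong[OF refl])
      fix i assume i: "i \<in> {1..r}"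
      have mi: "m j \<le> N j" "even (N j - m j)" if "j \<in> {1..r}" for j
        using m that by (auto simp: deg_choices_def PiE_iff)
      have h: "2 * half N m j = N j - m j" if "j \<in> {1..r}" for j
        using mi(2)[OF that] by (simp add: half_def)
      \<comment> \<open>The removed diagonal pairs of the two adjacent arrows contribute a fixed
        amount to the weight; \<open>v\<close> is what remains for the triple.\<close>
      define v where "v = \<omega> i - half N m i - half N m (prev i)"
      have tot: "2 * \<omega> i = N i + N (prev i) + s i" using \<omega>[OF i] by (simp add: total_def)
      have v: "\<omega> i = v + half N m i + half N m (prev i)" "2 * v = m i + m (prev i) + s i"
        using tot h[OF i] h[OF prev_in[OF i]] mi(1)[OF i] mi(1)[OF prev_in[OF i]]
        unfolding v_def by linarith+
      have "local_choices N s m i (\<omega> i) = triples (m i) (m (prev i)) (s i) v"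
        "local_choices N s m i (\<omega> i + 1) = triples (m i) (m (prev i)) (s i) (v + 1)"
        unfolding v(1) by (auto simp: local_choices_def triples_def)
      then show "int (card (local_choices N s m i (\<omega> i))) - (if i \<in> {1..r} then int (card (local_choices N s m i (\<omega> i + 1))) else 0)
          = (if triangle (m i) (m (prev i)) (s i) then 1 else 0)"
        using i triples_diff[OF v(2)] by (simp only: if_True)
    qed
    also have "\<dots> = (if \<forall>i\<in>{1..r}. triangle (m i) (m (prev i)) (s i) then 1 else 0)"
      by (auto intro!: prod.neutral prod_zero)
    finally show "(\<Prod>i\<in>{1..r}. int (card (local_choices N s m i (\<omega> i))) - (if i \<in> {1..r} then int (card (local_choices N s m i (\<omega> i + 1))) else 0))
        = (if \<forall>i\<in>{1..r}. triangle (m i) (m (prev i)) (s i) then 1 else 0)" .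
  qed
  also have "\<dots> = int (card {m \<in> deg_choices N. \<forall>i\<in>{1..r}. triangle (m i) (m (prev i)) (s i)})"
    using finite_deg_choices[of N] by (simp add: sum.If_cases Int_def)
  also have "{m \<in> deg_choices N. \<forall>i\<in>{1..r}. triangle (m i) (m (prev i)) (s i)} = lattice_points (\<lambda>i. int (N i)) s"
  proof -
    have key: "(int a \<le> int b \<and> even (int b - int a) \<and> R) \<longleftrightarrow> (a \<le> b \<and> even (b - a)) \<and> R" for a b :: nat and R
      by (cases "a \<le> b") (simp_all flip: of_nat_diff)
    have dc: "m \<in> deg_choices N \<longleftrightarrow> m \<in> {1..r} \<rightarrow>\<^sub>E UNIV \<and> (\<forall>i\<in>{1..r}. m i \<le> N i \<and> even (N i - m i))" for m
      by (simp only: deg_choices_def PiE_iff mem_Collect_eq) blast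
    show ?thesis
      unfolding lattice_points_def key dc by blast
  qed
  finally show ?thesis by simp
qed

lemma dim_inv_space:
  assumes sup: "supported n" "supported s" and ev: "\<And>i. i \<in> {1..r} \<Longrightarrow> even (n i + n (prev i) + int (s i))"
  shows "P.V.dim (inv_space n s) = card (lattice_points n s)"
proof (cases "\<forall>i\<in>{1..r}. n i \<ge> 0")
  case True
  define N where "N i = nat (n i)" for i
  have n: "n = (\<lambda>i. int (N i))"
    using True sup(1) by (auto simp: N_def supported_def fun_eq_iff)
  have "supported N" using sup(1) by (simp add: supported_def N_def)
  moreover have "even (total N s i)" if "i \<in> {1..r}" for i
    using ev[OF that] unfolding n total_def by (simp flip: of_nat_add)
  ultimately show ?thesis unfolding n using dim_inv_space_nat sup(2) by blast
next
  case False
  then obtain i where i: "i \<in> {1..r}" "n i < 0" by force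
  have "\<alpha> \<notin> mons n s" for \<alpha>
  proof
    assume "\<alpha> \<in> mons n s"
    then have "int (degX i \<alpha>) = n i" unfolding mons_def by blast
    then show False using i(2) by simp
  qed
  have "inv_space n s \<subseteq> {0}"
  proof
    fix p assume "p \<in> inv_space n s"
    then have "keys p \<subseteq> mons n s" by (simp add: inv_space_def hom_space_def)
    then have "keys p = {}" using \<open>\<And>\<alpha>. \<alpha> \<notin> mons n s\<close> by blast
    then show "p \<in> {0}" by (simp add: poly_mapping_eq_iff fun_eq_iff in_keys_iff set_eq_iff)
  qed
  then have "P.V.dim (inv_space n s) = 0"
    by (subst P.dim_eq_0_iff[OF fin_dim_inv_space[OF sup]])
  moreover have "lattice_points n s = {}"
    using i by (force simp: lattice_points_def)
  ultimately show ?thesis by simp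
qed

text \<open>The set \<open>D k\<close> consists of the points for the bound \<open>n - k e\<close>
  that touch it. The four dimensions combine to \<open>card (D 0) - card (D 1)\<close>, and adding e
  maps \<open>D 1\<close> onto the points of \<open>D 0\<close> off the lower boundary.\<close>

lemma dim_harm_space_count:
  assumes sup: "supported n" "supported s" and ev: "\<And>i. i \<in> {1..r} \<Longrightarrow> even (n i + n (prev i) + int (s i))"
  shows "P.V.dim (harm_space n s) = card {m \<in> lattice_points n s. (\<exists>i\<in>{1..r}. int (m i) = n i)
    \<and> (\<exists>i\<in>{1..r}. m (prev i) + m i = s i)}"
proof -
  let ?L = "\<lambda>k. lattice_points (\<lambda>i. n i - k * ones i) s"
  have sup': "supported (\<lambda>i. n i - k * ones i)" for k using sup supported_ones by blast
  have ones: "ones i = 1" if "i \<in> {1..r}" for i using that by (simp add: ones_def)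
  have dim: "P.V.dim (inv_space (\<lambda>i. n i - k * ones i) s) = card (?L k)" for k
  proof (rule dim_inv_space[OF sup' sup(2)])
    fix i assume i: "i \<in> {1..r}"
    then show "even (n i - k * ones i + (n (prev i) - k * ones (prev i)) + int (s i))"
      using ev[OF i] ones[OF i] ones[OF prev_in[OF i]] by simp
  qed
  have L0: "?L 0 = lattice_points n s" by simp
  have eq: "P.V.dim (harm_space n s) + card (?L 1) + card (?L 2) = card (?L 0) + card (?L 3)"
    using dim_harm_space[OF sup] dim[of 1] dim[of 2] dim[of 3] dim[of 0] by simp
  define D where "D = (\<lambda>k. {m \<in> ?L k. \<exists>i\<in>{1..r}. int (m i) = n i - k})"
  have L: "card (?L k) = card (D k) + card (?L (k + 2))" for k
  proof -
    have "m \<in> ?L k \<longleftrightarrow> m \<in> D k \<or> m \<in> ?L (k + 2)" "\<not> (m \<in> D k \<and> m \<in> ?L (k + 2))" for m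
    proof -
      \<comment> \<open>By parity, lowering the bound by 2 excludes exactly the points where it is
        attained.\<close>
      have a: "int (m i) \<le> n i - (k + 2) * ones i \<and> even (n i - (k + 2) * ones i - int (m i))
          \<longleftrightarrow> (int (m i) \<le> n i - k * ones i \<and> even (n i - k * ones i - int (m i))) \<and> int (m i) \<noteq> n i - k"
        if "i \<in> {1..r}" for i
        unfolding ones[OF that] mult_1_right by presburger
      have "m \<in> ?L (k + 2) \<longleftrightarrow> m \<in> ?L k \<and> (\<forall>i\<in>{1..r}. int (m i) \<noteq> n i - k)"
      proof -
        have "m \<in> ?L (k + 2) \<longleftrightarrow> m \<in> {1..r} \<rightarrow>\<^sub>E UNIV \<and> (\<forall>i\<in>{1..r}.
            (int (m i) \<le> n i - (k + 2) * ones i \<and> even (n i - (k + 2) * ones i - int (m i)))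
            \<and> triangle (m i) (m (prev i)) (s i))"
          unfolding lattice_points_def by blast
        also have "\<dots> \<longleftrightarrow> m \<in> {1..r} \<rightarrow>\<^sub>E UNIV \<and> (\<forall>i\<in>{1..r}.
            ((int (m i) \<le> n i - k * ones i \<and> even (n i - k * ones i - int (m i))) \<and> int (m i) \<noteq> n i - k)
            \<and> triangle (m i) (m (prev i)) (s i))"
          by (rule conj_cong[OF refl], rule ball_cong[OF refl], rule arg_cong2[where f="(\<and>)", OF _ refl], rule a)
        also have "\<dots> \<longleftrightarrow> m \<in> ?L k \<and> (\<forall>i\<in>{1..r}. int (m i) \<noteq> n i - k)"
          unfolding lattice_points_def by blast
        finally show ?thesis .
      qed
      then show "m \<in> ?L k \<longleftrightarrow> m \<in> D k \<or> m \<in> ?L (k + 2)" "\<not> (m \<in> D k \<and> m \<in> ?L (k + 2))"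
        unfolding D_def by blast+
    qed
    then have "?L k = D k \<union> ?L (k + 2)" "D k \<inter> ?L (k + 2) = {}" by blast+
    moreover have "finite (D k)" by (simp add: D_def finite_lattice_points)
    ultimately show ?thesis by (simp add: card_Un_disjoint finite_lattice_points)
  qed
  have tight: "P.V.dim (harm_space n s) + card (D 1) = card (D 0)"
    using eq L[of 0] L[of 1] by simp
  let ?E = "{m \<in> D 0. \<exists>i\<in>{1..r}. m (prev i) + m i = s i}"
  have "bij_betw (\<lambda>m. \<lambda>i\<in>{1..r}. m i + 1) (D 1) (D 0 - ?E)"
  proof (rule bij_betw_byWitness[of _ "\<lambda>m. \<lambda>i\<in>{1..r}. m i - 1"])
    show "\<forall>m\<in>D 1. (\<lambda>i\<in>{1..r}. (\<lambda>i\<in>{1..r}. m i + 1) i - 1) = m"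
    proof (intro ballI ext)
      fix m i assume "m \<in> D 1"
      then have "m \<in> extensional {1..r}" unfolding D_def lattice_points_def PiE_def by blast
      then show "(\<lambda>i\<in>{1..r}. (\<lambda>i\<in>{1..r}. m i + 1) i - 1) i = m i"
        by (cases "i \<in> {1..r}") (simp_all add: extensional_def del: atLeastAtMost_iff)
    qed
    have D0_bounds: "\<forall>i\<in>{1..r}. int (m i) \<le> n i \<and> even (n i - int (m i)) \<and> triangle (m i) (m (prev i)) (s i)"
      if "m \<in> D 0 - ?E" for m
    proof -
      have "\<forall>i\<in>{1..r}. int (m i) \<le> n i - 0 * ones i \<and> even (n i - 0 * ones i - int (m i))
          \<and> triangle (m i) (m (prev i)) (s i)"
        using that unfolding D_def lattice_points_def by blast
      then show ?thesis unfolding mult_zero_left diff_0_right .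
    qed
    \<comment> \<open>Parity excludes the sum \<open>s i + 1\<close>, so off the lower boundary
      there is room to subtract 1 from both coordinates; the triangle inequality then also gives
      \<open>m i \<ge> 1\<close>, so that truncated subtraction is harmless.\<close>
    have key: "m (prev i) + m i \<ge> s i + 2" "m i \<ge> 1" "m i + s i \<ge> m (prev i)" "m (prev i) + s i \<ge> m i"
      if m: "m \<in> D 0 - ?E" and i: "i \<in> {1..r}" for m i
    proof -
      have tri: "triangle (m i) (m (prev i)) (s i)" and e: "even (n j - int (m j))" if "j \<in> {1..r}" for j
        using D0_bounds[OF m] i that by blast+
      note tri = tri[OF i]
      have ne: "m (prev i) + m i \<noteq> s i" using m i by blast
      have "even (int (m (prev i)) + int (m i) + int (s i))"
        using ev[OF i] e[OF i] e[OF prev_in[OF i]] by presburger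
      then have "even (int (m (prev i) + m i + s i))" by (simp only: of_nat_add)
      then have ev': "even (m (prev i) + m i + s i)" by (simp only: even_of_nat)
      have tri': "m i \<le> m (prev i) + s i" "m (prev i) \<le> m i + s i" "s i \<le> m i + m (prev i)"
        using tri unfolding triangle_def by blast+
      have "m (prev i) + m i \<noteq> s i + 1"
      proof
        assume "m (prev i) + m i = s i + 1"
        with ev' show False by simp
      qed
      then show "m (prev i) + m i \<ge> s i + 2" using tri'(3) ne by linarith
      then show "m i \<ge> 1" using tri'(2) by linarith
      show "m i + s i \<ge> m (prev i)" "m (prev i) + s i \<ge> m i" using tri' by linarith+
    qed
    show "\<forall>m\<in>D 0 - ?E. (\<lambda>i\<in>{1..r}. (\<lambda>i\<in>{1..r}. m i - 1) i + 1) = m"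
    proof (intro ballI ext)
      fix m i assume m: "m \<in> D 0 - ?E"
      show "(\<lambda>i\<in>{1..r}. (\<lambda>i\<in>{1..r}. m i - 1) i + 1) i = m i"
      proof (cases "i \<in> {1..r}")
        case True
        then show ?thesis using key(2)[OF m True] by simp
      next
        case False
        moreover have "m \<in> extensional {1..r}" using m unfolding D_def lattice_points_def PiE_def by blast
        ultimately show ?thesis by (simp add: extensional_def del: atLeastAtMost_iff)
      qed
    qed
    show "(\<lambda>m. \<lambda>i\<in>{1..r}. m i + 1) ` D 1 \<subseteq> D 0 - ?E"
    proof (rule image_subsetI)
      fix m assume m: "m \<in> D 1"
      then have b0: "\<forall>i\<in>{1..r}. int (m i) \<le> n i - 1 * ones i \<and> even (n i - 1 * ones i - int (m i))
          \<and> triangle (m i) (m (prev i)) (s i)"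
        unfolding D_def lattice_points_def by blast
      have b: "int (m i) \<le> n i - 1" "even (n i - 1 - int (m i))" "triangle (m i) (m (prev i)) (s i)"
        if "i \<in> {1..r}" for i
      proof -
        have "int (m i) \<le> n i - 1 * ones i \<and> even (n i - 1 * ones i - int (m i))
            \<and> triangle (m i) (m (prev i)) (s i)"
          using b0 that by blast
        then show "int (m i) \<le> n i - 1" "even (n i - 1 - int (m i))" "triangle (m i) (m (prev i)) (s i)"
          unfolding ones[OF that] mult_1_right by blast+
      qed
      have "(\<lambda>i\<in>{1..r}. m i + 1) \<in> lattice_points n s"
        unfolding lattice_points_def
      proof (intro CollectI conjI ballI)
        fix i assume i: "i \<in> {1..r}"
        note b = b[OF i] and p = prev_in[OF i]
        show "int ((\<lambda>i\<in>{1..r}. m i + 1) i) \<le> n i" using b i by simp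
        have "n i - int ((\<lambda>i\<in>{1..r}. m i + 1) i) = n i - 1 - int (m i)" using i by simp
        then show "even (n i - int ((\<lambda>i\<in>{1..r}. m i + 1) i))" using b(2) by (simp only:)
        show "triangle ((\<lambda>i\<in>{1..r}. m i + 1) i) ((\<lambda>i\<in>{1..r}. m i + 1) (prev i)) (s i)"
          using b(3) i p by (simp add: triangle_def)
      qed simp
      moreover have "\<exists>i\<in>{1..r}. int ((\<lambda>i\<in>{1..r}. m i + 1) i) = n i"
      proof -
        obtain i where i: "i \<in> {1..r}" "int (m i) = n i - 1" using m unfolding D_def by blast
        then show ?thesis by (intro bexI[of _ i]) simp_all
      qed
      moreover have "(\<lambda>i\<in>{1..r}. m i + 1) (prev i) + (\<lambda>i\<in>{1..r}. m i + 1) i \<noteq> s i" if i: "i \<in> {1..r}" for i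
        using b(3)[OF i] i prev_in[OF i] by (simp add: triangle_def)
      ultimately show "(\<lambda>i\<in>{1..r}. m i + 1) \<in> D 0 - ?E" by (simp add: D_def del: restrict_apply)
    qed
    show "(\<lambda>m. \<lambda>i\<in>{1..r}. m i - 1) ` (D 0 - ?E) \<subseteq> D 1"
    proof (rule image_subsetI)
      fix m assume m: "m \<in> D 0 - ?E"
      have b: "int (m i) \<le> n i" "even (n i - int (m i))" if "i \<in> {1..r}" for i
        using D0_bounds[OF m] that by blast+
      have "(\<lambda>i\<in>{1..r}. m i - 1) \<in> ?L 1"
        unfolding lattice_points_def
      proof (intro CollectI conjI ballI)
        fix i assume i: "i \<in> {1..r}"
        note k = key[OF m i] and k' = key[OF m prev_in[OF i]] and b = b[OF i]
        have im: "int (m i - 1) = int (m i) - 1" using k(2) by simp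
        show "int ((\<lambda>i\<in>{1..r}. m i - 1) i) \<le> n i - 1 * ones i" using b i ones[OF i] im by simp
        show "even (n i - 1 * ones i - int ((\<lambda>i\<in>{1..r}. m i - 1) i))" using b i ones[OF i] im by simp
        show "triangle ((\<lambda>i\<in>{1..r}. m i - 1) i) ((\<lambda>i\<in>{1..r}. m i - 1) (prev i)) (s i)"
        proof -
          have "triangle (m i - 1) (m (prev i) - 1) (s i)"
            unfolding triangle_def using k k'(2) by linarith
          then show ?thesis using i prev_in[OF i] by (simp del: atLeastAtMost_iff)
        qed
      qed simp
      moreover have "\<exists>i\<in>{1..r}. int ((\<lambda>i\<in>{1..r}. m i - 1) i) = n i - 1"
      proof -
        obtain i where "i \<in> {1..r}" "int (m i) = n i - 0" using m unfolding D_def by blast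
        then have i: "i \<in> {1..r}" "int (m i) = n i" by simp_all
        then show ?thesis using key(2)[OF m i(1)] by (intro bexI[of _ i]) (simp_all add: of_nat_diff)
      qed
      ultimately show "(\<lambda>i\<in>{1..r}. m i - 1) \<in> D 1" by (simp add: D_def del: restrict_apply)
    qed
  qed
  then have "card (D 1) = card (D 0 - ?E)" by (rule bij_betw_same_card)
  moreover have "finite (D 0)" by (simp add: D_def finite_lattice_points)
  then have "card (D 0 - ?E) = card (D 0) - card ?E" "card ?E \<le> card (D 0)"
    by (auto intro!: card_Diff_subset card_mono)
  ultimately have "P.V.dim (harm_space n s) = card ?E" using tight by simp
  also have "?E = {m \<in> lattice_points n s. (\<exists>i\<in>{1..r}. int (m i) = n i) \<and> (\<exists>i\<in>{1..r}. m (prev i) + m i = s i)}"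
  proof -
    have "D 0 = {m \<in> lattice_points n s. \<exists>i\<in>{1..r}. int (m i) = n i}"
      by (simp only: D_def mult_zero_left diff_0_right)
    then show ?thesis by blast
  qed
  finally show ?thesis .
qed

text \<open>With \<open>s = 0\<close> the triangle inequalities make \<open>m\<close> constant
  around the cycle, while the two boundary conditions ask for the values \<open>k\<close> and
  0.\<close>

lemma harm_space_trivial:
  assumes "k \<ge> 1"
  shows "harm_space (\<lambda>i. k * ones i) (\<lambda>_. 0) \<subseteq> {0}"
proof -
  have sup: "supported (\<lambda>i. k * ones i)" "supported (\<lambda>_. 0 :: nat)" by (rule supported_multiples)+
  have "{m \<in> lattice_points (\<lambda>i. k * ones i) (\<lambda>_. 0). (\<exists>i\<in>{1..r}. int (m i) = k * ones i)
      \<and> (\<exists>i\<in>{1..r}. m (prev i) + m i = 0)} = {}" (is "?S = {}")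
  proof (rule ccontr)
    assume "?S \<noteq> {}"
    then obtain m i j where m: "m \<in> lattice_points (\<lambda>i. k * ones i) (\<lambda>_. 0)"
      and i: "i \<in> {1..r}" "int (m i) = k * ones i" and j: "j \<in> {1..r}" "m j = 0" by auto
    have eq: "m l = m (prev l)" if "l \<in> {1..r}" for l
    proof -
      have "triangle (m l) (m (prev l)) 0" using m that unfolding lattice_points_def by blast
      then show ?thesis by (simp add: triangle_def)
    qed
    have c: "m l = m 1" if "l \<in> {1..r}" for l
      using that
    proof (induction l)
      case (Suc l)
      show ?case
      proof (cases "l = 0")
        case False
        then have "m (Suc l) = m l" "m l = m 1" using eq[OF Suc.prems] Suc by (auto simp: prv_def)
        then show ?thesis by simp
      qed (simp add: One_nat_def)
    qed simp
    have "m i = 0" using c[OF i(1)] c[OF j(1)] j(2) by simp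
    then show False using i assms by (simp add: ones_def)
  qed
  moreover have "P.V.dim (harm_space (\<lambda>i. k * ones i) (\<lambda>_. 0)) = card ?S"
  proof (rule dim_harm_space_count[OF sup])
    fix i assume i: "i \<in> {1..r}"
    have "ones i = 1" "ones (prev i) = 1"
      using i prev_in[OF i] by (simp_all add: ones_def del: atLeastAtMost_iff)
    then show "even (k * ones i + k * ones (prev i) + int 0)" by simp
  qed
  ultimately have "P.V.dim (harm_space (\<lambda>i. k * ones i) (\<lambda>_. 0)) = 0" by (simp only: card.empty)
  then show ?thesis by (simp add: P.dim_eq_0_iff[OF fin_dim_harm_space[OF sup]])
qed

end

section \<open>Polynomial functions and harmonics\<close>

interpretation F: vector_space fscale by (rule vector_space_fscale)

lemma mev_sum: "mev y (\<Sum>i\<in>I. f i) = (\<Prod>i\<in>I. mev y (f i))"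
  by (induction I rule: infinite_finite_induct) (simp_all add: mev_add)

lemma fischer_single_right: "fischer p (single \<beta> 1) = of_nat (mfact \<beta>) * lookup p \<beta>"
proof -
  have "fischer p (single \<beta> 1) = (\<Sum>\<alpha>\<in>insert \<beta> (keys p). if \<alpha> = \<beta> then of_nat (mfact \<beta>) * lookup p \<beta> else 0)"
    by (subst fischer_superset[of "insert \<beta> (keys p)"])
      (simp, blast, rule sum.cong, auto simp: lookup_single when_def)
  then show ?thesis by simp
qed

text \<open>Rescaling the variables multiplies the coefficient at \<open>\<alpha>\<close> by
  \<open>mev c \<alpha>\<close>; comparing coefficients leaves only the factor 1.\<close>

lemma ev_scale_keys:
  assumes scale: "\<And>y. ev (\<lambda>v. c v * y v) p = ev y p" and \<alpha>: "\<alpha> \<in> keys p"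
  shows "mev c \<alpha> = 1"
proof -
  define p' where "p' = (\<Sum>\<alpha>\<in>keys p. single \<alpha> (mev c \<alpha> * lookup p \<alpha>))"
  have m: "mev (\<lambda>v. c v * y v) \<beta> = mev c \<beta> * mev y \<beta>" for y \<beta>
    by (simp add: mev_def power_mult_distrib prod.distrib)
  have "ev y p' = ev (\<lambda>v. c v * y v) p" for y
    unfolding p'_def ev_sum ev_single ev_def[of _ p] m by (simp add: mult_ac)
  then have "p' = p" using scale by (intro pol_eqI_ev) simp
  then have "lookup p' \<alpha> = lookup p \<alpha>" by simp
  moreover have "lookup p' \<alpha> = mev c \<alpha> * lookup p \<alpha>"
    using \<alpha> by (simp add: p'_def lookup_sum lookup_single when_def)
  ultimately show ?thesis using \<alpha> by (simp add: in_keys_iff)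
qed

lemma dir_deriv_act:
  "dir_deriv v (act r g f) = act r g (dir_deriv (act_V r (inv_tuple g) v) f)"
proof -
  have "act_V r h (\<lambda>i. \<chi> a b. x i $ a $ b + t * v i $ a $ b)
      = (\<lambda>i. \<chi> a b. act_V r h x i $ a $ b + t * act_V r h v i $ a $ b)" for h x and t :: complex
    by (auto simp: fun_eq_iff act_V_def matrix_eq_2 matrix_mult_2 algebra_simps)
  then show ?thesis by (simp add: dir_deriv_def act_def)
qed

lemma matrix_inv_transpose:
  fixes A :: "complex^2^2"
  assumes "invertible A"
  shows "matrix_inv (transpose A) = transpose (matrix_inv A)"
  by (rule matrix_inv_unique)
    (simp_all only: matrix_transpose_mul[symmetric] matrix_inv_left[OF assms] matrix_inv_right[OF assms] transpose_mat)

lemma matrix_inv_scalar_mult: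
  fixes A :: "complex^2^2"
  assumes "invertible A" "c \<noteq> 0"
  shows "matrix_inv (mat c ** A) = mat (inverse c) ** matrix_inv A"
proof -
  have c: "mat a ** B = B ** mat a" for a and B :: "complex^2^2"
    by (simp add: matrix_eq_2 matrix_mult_2 mat_def)
  have cc: "mat a ** mat b = (mat (a * b) :: complex^2^2)" for a b
    by (simp add: matrix_eq_2 matrix_mult_2 mat_def)
  have i: "invertible (mat c :: complex^2^2)" "matrix_inv (mat c :: complex^2^2) = mat (inverse c)"
    using assms(2) cc[of c "inverse c"] cc[of "inverse c" c] matrix_inv_unique[of "mat c :: complex^2^2" "mat (inverse c)"]
    unfolding invertible_def by (auto intro!: exI[of _ "mat (inverse c)"])
  show ?thesis
    using matrix_inv_mult[OF i(1) assms(1)] i(2) c by simp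
qed

lemma det_mat_2: "det (mat c :: complex^2^2) = c\<^sup>2"
  by (simp add: det_2 mat_def power2_eq_square)

lemma invertible_scalar_mult: "invertible A \<Longrightarrow> c \<noteq> 0 \<Longrightarrow> invertible (mat c ** (A :: complex^2^2))"
  by (simp add: invertible_det_nz det_mul det_mat_2)

lemma invertible_transpose_2: "invertible (A :: complex^2^2) \<Longrightarrow> invertible (transpose A)"
  by (simp add: invertible_det_nz)

context cyclic
begin

definition xvars :: "var set" where
  "xvars = {X i a b | i a b. i \<in> {1..r}}"

lemma in_xvars [simp]: "X i a b \<in> xvars \<longleftrightarrow> i \<in> {1..r}" "U i a \<notin> xvars"
  by (auto simp: xvars_def)

definition xonly :: "var pol \<Rightarrow> bool" where
  "xonly p \<longleftrightarrow> (\<forall>\<alpha>\<in>keys p. keys \<alpha> \<subseteq> xvars)"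

text \<open>The \<open>U\<close> variables receive the default value 0, which does not affect
  \<open>xonly\<close> polynomials (\<open>ev_xonly\<close>).\<close>

definition evX :: "var pol \<Rightarrow> tuple \<Rightarrow> complex" where
  "evX p x = ev (point x (\<lambda>_. 0)) p"

lemma xonly_in_range: "xonly p \<Longrightarrow> in_range r p"
  unfolding xonly_def in_range_def xvars_def vars_def by blast

lemma ev_xonly:
  assumes "xonly p"
  shows "ev (point x v) p = evX p x"
  unfolding evX_def
proof (rule ev_cong)
  fix \<alpha> w assume "\<alpha> \<in> keys p" "w \<in> keys \<alpha>"
  then have "w \<in> xvars" using assms unfolding xonly_def by blast
  then show "point x v w = point x (\<lambda>_. 0) w" by (cases w) simp_all
qed

lemma evX_inj: "xonly p \<Longrightarrow> xonly q \<Longrightarrow> evX p = evX q \<Longrightarrow> p = q"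
proof (rule pol_eqI_ev)
  fix y
  assume p: "xonly p" and q: "xonly q" and eq: "evX p = evX q"
  obtain x v where "y = point x v" using point_surj by blast
  then show "ev y p = ev y q" by (simp add: ev_xonly p q eq)
qed

lemma evX_cong:
  assumes "xonly p" "\<And>i. i \<in> {1..r} \<Longrightarrow> x i = x' i"
  shows "evX p x = evX p x'"
  unfolding evX_def
proof (rule ev_cong)
  fix \<alpha> w assume "\<alpha> \<in> keys p" "w \<in> keys \<alpha>"
  then have "w \<in> xvars" using assms(1) unfolding xonly_def by blast
  then show "point x (\<lambda>_. 0) w = point x' (\<lambda>_. 0) w"
    by (cases w) (simp_all add: assms(2) del: atLeastAtMost_iff)
qed

lemma evX_add: "evX (p + q) = evX p + evX q"
  and evX_Const_mult: "evX (Const c * p) = fscale c (evX p)"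
  and evX_0: "evX 0 = 0"
  by (simp_all add: evX_def fun_eq_iff fscale_def)

lemma xonly_Const: "xonly (Const c)"
  by (auto simp: xonly_def Const_def in_keys_iff lookup_single when_def)

lemma xonly_0: "xonly 0"
  by (simp add: xonly_def)

lemma xonly_Var: "v \<in> xvars \<Longrightarrow> xonly (Var v)"
  by (auto simp: xonly_def Var_def in_keys_iff lookup_single when_def)

lemma xonly_add: "xonly p \<Longrightarrow> xonly q \<Longrightarrow> xonly (p + q)"
  by (auto simp: xonly_def dest: keys_add_elim)

lemma keys_mon_add: "keys (\<alpha> + \<beta> :: var mon) = keys \<alpha> \<union> keys \<beta>"
  by (auto simp: in_keys_iff lookup_add)

lemma xonly_mult:
  assumes "xonly p" "xonly q"
  shows "xonly (p * q)"
  unfolding xonly_def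
proof
  fix \<delta> assume "\<delta> \<in> keys (p * q)"
  then obtain \<alpha> \<beta> where "\<alpha> \<in> keys p" "\<beta> \<in> keys q" "\<delta> = \<alpha> + \<beta>" by (rule keys_mult_elim)
  then show "keys \<delta> \<subseteq> xvars" using assms by (simp add: xonly_def keys_mon_add)
qed

lemma xonly_pd:
  assumes "xonly q"
  shows "xonly (pd p q)"
  unfolding xonly_def
proof
  fix \<gamma> assume "\<gamma> \<in> keys (pd p q)"
  then obtain \<alpha> where "\<alpha> + \<gamma> \<in> keys q" using keys_pd by blast
  then have "keys (\<alpha> + \<gamma>) \<subseteq> xvars" using assms by (simp add: xonly_def)
  then show "keys \<gamma> \<subseteq> xvars" by (simp add: keys_mon_add)
qed

lemma xonly_sum: "(\<And>i. i \<in> I \<Longrightarrow> xonly (f i)) \<Longrightarrow> xonly (\<Sum>i\<in>I. f i)"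
  by (induction I rule: infinite_finite_induct) (simp_all add: xonly_0 xonly_add)

lemma xonly_induct [consumes 1, case_names Const mult add]:
  assumes p: "xonly p"
    and C: "\<And>c. P (Const c)"
    and M: "\<And>p v. xonly p \<Longrightarrow> v \<in> xvars \<Longrightarrow> P p \<Longrightarrow> P (p * Var v)"
    and A: "\<And>p q. P p \<Longrightarrow> P q \<Longrightarrow> P (p + q)"
  shows "P p"
proof -
  have mon: "xonly (single \<alpha> c) \<and> P (single \<alpha> c)" if "keys \<alpha> \<subseteq> xvars" for \<alpha> c
    using that
  proof (induction \<alpha> rule: mon_induct)
    case zero
    then show ?case using C[of c] xonly_Const[of c] by (simp add: Const_def)
  next
    case (add \<alpha> v)
    then have v: "keys \<alpha> \<subseteq> xvars" "v \<in> xvars" by (simp_all add: keys_mon_add)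
    then show ?case
      using M[of "single \<alpha> c" v] add.IH xonly_mult[OF _ xonly_Var[OF v(2)]] unfolding single_Suc by blast
  qed
  have "P (\<Sum>\<alpha>\<in>S. single \<alpha> (lookup p \<alpha>))" if "finite S" "S \<subseteq> keys p" for S
    using that
  proof (induction S)
    case empty
    then show ?case using C[of 0] by simp
  next
    case (insert \<alpha> S)
    then have "P (single \<alpha> (lookup p \<alpha>))" using mon p by (simp add: xonly_def)
    then show ?case using insert A by simp
  qed
  from this[of "keys p"] show ?thesis by (simp only: pol_sum_single[symmetric] finite_keys)
qed

subsection \<open>Polynomial functions\<close>

definition exponent_mon :: "(nat \<Rightarrow> 2 \<Rightarrow> 2 \<Rightarrow> nat) \<Rightarrow> var mon" where
  "exponent_mon \<alpha> = (\<Sum>i\<in>{1..r}. \<Sum>a\<in>UNIV. \<Sum>b\<in>UNIV. single (X i a b) (\<alpha> i a b))"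

lemma monomial_fun_eq: "monomial_fun r \<alpha> = evX (single (exponent_mon \<alpha>) 1)"
  by (simp add: fun_eq_iff monomial_fun_def evX_def exponent_mon_def mev_sum)

lemma lookup_exponent_mon:
  "lookup (exponent_mon \<alpha>) (X i a b) = (if i \<in> {1..r} then \<alpha> i a b else 0)"
  "lookup (exponent_mon \<alpha>) (U i a) = 0"
proof -
  have "lookup (exponent_mon \<alpha>) (X i a b) = (\<Sum>k\<in>{1..r}. if k = i then \<alpha> i a b else 0)"
    unfolding exponent_mon_def lookup_sum
    by (rule sum.cong[OF refl]) (use exhaust_2[of a] exhaust_2[of b] in \<open>auto simp: sum_2 lookup_single when_def\<close>)
  then show "lookup (exponent_mon \<alpha>) (X i a b) = (if i \<in> {1..r} then \<alpha> i a b else 0)"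
    by (simp del: atLeastAtMost_iff)
  show "lookup (exponent_mon \<alpha>) (U i a) = 0"
    by (simp add: exponent_mon_def lookup_sum lookup_single)
qed

lemma exponent_mon_lookup:
  assumes "keys \<alpha> \<subseteq> xvars"
  shows "exponent_mon (\<lambda>i a b. lookup \<alpha> (X i a b)) = \<alpha>"
proof (rule poly_mapping_eqI)
  fix v
  show "lookup (exponent_mon (\<lambda>i a b. lookup \<alpha> (X i a b))) v = lookup \<alpha> v"
  proof (cases "v \<in> xvars")
    case True
    then show ?thesis by (auto simp: xvars_def lookup_exponent_mon)
  next
    case False
    then have "lookup \<alpha> v = 0" using assms by (auto simp: in_keys_iff)
    then show ?thesis using False by (cases v) (auto simp: lookup_exponent_mon)
  qed
qed

lemma span_monomial_fun: "F.span (monomial_fun r ` M) = evX ` {p. keys p \<subseteq> exponent_mon ` M}"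
proof (intro equalityI)
  have "F.subspace (evX ` {p. keys p \<subseteq> exponent_mon ` M})"
  proof (rule F.subspaceI)
    show "0 \<in> evX ` {p. keys p \<subseteq> exponent_mon ` M}"
      by (rule image_eqI[of _ _ 0]) (simp_all add: evX_0)
  next
    fix f g assume "f \<in> evX ` {p. keys p \<subseteq> exponent_mon ` M}" "g \<in> evX ` {p. keys p \<subseteq> exponent_mon ` M}"
    then obtain p q where "keys p \<subseteq> exponent_mon ` M" "f = evX p" "keys q \<subseteq> exponent_mon ` M" "g = evX q" by blast
    then show "f + g \<in> evX ` {p. keys p \<subseteq> exponent_mon ` M}"
      by (intro image_eqI[of _ _ "p + q"]) (auto simp: evX_add dest: keys_add_elim)
  next
    fix c f assume "f \<in> evX ` {p. keys p \<subseteq> exponent_mon ` M}"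
    then obtain p where "keys p \<subseteq> exponent_mon ` M" "f = evX p" by blast
    moreover from this have "keys (Const c * p) \<subseteq> exponent_mon ` M" by (auto simp: in_keys_iff)
    ultimately show "fscale c f \<in> evX ` {p. keys p \<subseteq> exponent_mon ` M}"
      by (intro image_eqI[of _ _ "Const c * p"]) (simp_all add: evX_Const_mult)
  qed
  moreover have "monomial_fun r ` M \<subseteq> evX ` {p. keys p \<subseteq> exponent_mon ` M}"
    by (auto simp: monomial_fun_eq intro!: imageI)
  ultimately show "F.span (monomial_fun r ` M) \<subseteq> evX ` {p. keys p \<subseteq> exponent_mon ` M}"
    by (intro F.span_minimal)
next
  show "evX ` {p. keys p \<subseteq> exponent_mon ` M} \<subseteq> F.span (monomial_fun r ` M)"
  proof (rule image_subsetI)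
    fix p :: "var pol" assume "p \<in> {p. keys p \<subseteq> exponent_mon ` M}"
    then have p: "keys p \<subseteq> exponent_mon ` M" by simp
    have "evX (\<Sum>\<alpha>\<in>S. single \<alpha> (lookup p \<alpha>)) \<in> F.span (monomial_fun r ` M)" if "finite S" "S \<subseteq> keys p" for S
      using that
    proof (induction S)
      case empty
      then show ?case by (simp only: sum.empty evX_0 F.span_zero)
    next
      case (insert \<alpha> S)
      then obtain a where a: "a \<in> M" "\<alpha> = exponent_mon a" using p by auto
      have "evX (single \<alpha> (lookup p \<alpha>)) = fscale (lookup p \<alpha>) (monomial_fun r a)"
        by (subst single_eq_Const_mult) (simp only: evX_Const_mult monomial_fun_eq a(2))
      then have "evX (single \<alpha> (lookup p \<alpha>)) \<in> F.span (monomial_fun r ` M)"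
        using a(1) by (simp add: F.span_scale F.span_base)
      moreover have "evX (\<Sum>\<alpha>\<in>S. single \<alpha> (lookup p \<alpha>)) \<in> F.span (monomial_fun r ` M)"
        using insert by blast
      ultimately show ?case
        by (simp only: sum.insert[OF insert.hyps] evX_add F.span_add)
    qed
    from this[of "keys p"] show "evX p \<in> F.span (monomial_fun r ` M)"
      by (simp only: pol_sum_single[symmetric] finite_keys)
  qed
qed

lemma CV_eq: "CV r = evX ` {p. xonly p}"
proof -
  have "Set.range exponent_mon = {\<alpha>. keys \<alpha> \<subseteq> xvars}"
  proof (intro equalityI subsetI)
    fix \<alpha> assume "\<alpha> \<in> Set.range exponent_mon"
    then obtain a where "\<alpha> = exponent_mon a" by blast
    then have "v \<in> xvars" if "v \<in> keys \<alpha>" for v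
      using that by (cases v) (auto simp: in_keys_iff lookup_exponent_mon split: if_splits)
    then show "\<alpha> \<in> {\<alpha>. keys \<alpha> \<subseteq> xvars}" by blast
  next
    fix \<alpha> :: "var mon" assume "\<alpha> \<in> {\<alpha>. keys \<alpha> \<subseteq> xvars}"
    then show "\<alpha> \<in> Set.range exponent_mon" using exponent_mon_lookup[of \<alpha>] by (metis mem_Collect_eq rangeI)
  qed
  then show ?thesis
    unfolding CV_def span_monomial_fun by (auto simp: xonly_def subset_iff)
qed

text \<open>The multidegree of the theorem is an arbitrary function outside \<open>{1..r}\<close>;
  cutting it off there makes it \<open>supported\<close>.\<close>

definition int_ext :: "(nat \<Rightarrow> nat) \<Rightarrow> nat \<Rightarrow> int" where
  "int_ext n i = (if i \<in> {1..r} then int (n i) else 0)"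

lemma supported_int_ext: "supported (int_ext n)"
  by (simp add: supported_def int_ext_def)

lemma hom_space_xonly:
  assumes "supported n" "p \<in> hom_space n (\<lambda>_. 0)"
  shows "xonly p"
  unfolding xonly_def
proof (intro ballI subsetI)
  fix \<alpha> v assume \<alpha>: "\<alpha> \<in> keys p" and v: "v \<in> keys \<alpha>"
  have m: "\<alpha> \<in> mons n (\<lambda>_. 0)" using assms(2) \<alpha> by (auto simp: hom_space_def)
  have "v \<in> vars r" using mons_in_range[OF assms(1) supported_multiples(3) m] v by blast
  moreover have "v \<noteq> U i a" for i a
  proof
    assume "v = U i a"
    then have "lookup \<alpha> (U i a) \<noteq> 0" using v by (simp add: in_keys_iff)
    moreover have "degU i \<alpha> = 0" using m by (simp add: mons_def)
    ultimately show False using exhaust_2[of a] by (auto simp: degU_def)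
  qed
  ultimately show "v \<in> xvars" by (cases v) auto
qed

lemma CV_deg_eq: "CV_deg r n = evX ` hom_space (int_ext n) (\<lambda>_. 0)"
proof -
  have "exponent_mon ` {\<alpha>. \<forall>i\<in>{1..r}. (\<Sum>a\<in>UNIV. \<Sum>b\<in>UNIV. \<alpha> i a b) = n i} = mons (int_ext n) (\<lambda>_. 0)"
  proof (intro equalityI subsetI)
    fix \<alpha> assume "\<alpha> \<in> exponent_mon ` {\<alpha>. \<forall>i\<in>{1..r}. (\<Sum>a\<in>UNIV. \<Sum>b\<in>UNIV. \<alpha> i a b) = n i}"
    then obtain a where a: "\<forall>i\<in>{1..r}. (\<Sum>c\<in>UNIV. \<Sum>d\<in>UNIV. a i c d) = n i" "\<alpha> = exponent_mon a" by blast
    show "\<alpha> \<in> mons (int_ext n) (\<lambda>_. 0)"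
      unfolding mons_def mem_Collect_eq
    proof (intro conjI allI)
      fix i
      show "int (degX i \<alpha>) = int_ext n i"
      proof (cases "i \<in> {1..r}")
        case True
        then have "a i 1 1 + a i 1 2 + (a i 2 1 + a i 2 2) = n i" using a(1) by (simp add: sum_2 del: atLeastAtMost_iff)
        then have "degX i \<alpha> = n i"
          using True by (simp add: degX_def a(2) lookup_exponent_mon del: atLeastAtMost_iff)
        then show ?thesis using True by (simp add: int_ext_def del: atLeastAtMost_iff)
      next
        case False
        then show ?thesis by (simp add: degX_def a(2) lookup_exponent_mon int_ext_def del: atLeastAtMost_iff)
      qed
      show "degU i \<alpha> = 0" by (simp add: degU_def a(2) lookup_exponent_mon)
    qed
  next
    fix \<alpha> assume \<alpha>: "\<alpha> \<in> mons (int_ext n) (\<lambda>_. 0)"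
    have "single \<alpha> (1::complex) \<in> hom_space (int_ext n) (\<lambda>_. 0)" using \<alpha> by (rule single_in_hom_space)
    then have "xonly (single \<alpha> 1)" by (rule hom_space_xonly[OF supported_int_ext])
    then have "keys \<alpha> \<subseteq> xvars" by (simp add: xonly_def)
    then have "\<alpha> = exponent_mon (\<lambda>i a b. lookup \<alpha> (X i a b))" by (rule exponent_mon_lookup[symmetric])
    moreover have "(\<Sum>a\<in>UNIV. \<Sum>b\<in>UNIV. lookup \<alpha> (X i a b)) = n i" if i: "i \<in> {1..r}" for i
    proof -
      have "int (degX i \<alpha>) = int (n i)" using \<alpha> i by (simp add: mons_def int_ext_def del: atLeastAtMost_iff)
      then have "degX i \<alpha> = n i" by simp
      then show ?thesis by (simp add: degX_def sum_2)
    qed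
    ultimately show "\<alpha> \<in> exponent_mon ` {\<alpha>. \<forall>i\<in>{1..r}. (\<Sum>a\<in>UNIV. \<Sum>b\<in>UNIV. \<alpha> i a b) = n i}"
      by (intro image_eqI[of _ _ "\<lambda>i a b. lookup \<alpha> (X i a b)"]) simp_all
  qed
  then show ?thesis unfolding CV_deg_def span_monomial_fun hom_space_def by simp
qed

subsection \<open>Constant coefficient operators on functions\<close>

definition linear_form :: "tuple \<Rightarrow> var pol" where
  "linear_form v = (\<Sum>i\<in>{1..r}. \<Sum>a\<in>UNIV. \<Sum>b\<in>UNIV. Const (v i $ a $ b) * Var (X i a b))"

lemma xonly_linear_form: "xonly (linear_form v)"
  unfolding linear_form_def by (intro xonly_sum xonly_mult xonly_Const xonly_Var) simp

lemma lookup_linear_form_0: "lookup (linear_form v) 0 = 0"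
  by (simp add: linear_form_def ev_at_0[symmetric])

lemma pd_linear_form: "pd (linear_form v) q = (\<Sum>i\<in>{1..r}. \<Sum>a\<in>UNIV. \<Sum>b\<in>UNIV. Const (v i $ a $ b) * dv (X i a b) q)"
  by (simp add: linear_form_def pd_sum_left pd_mult)

lemma derivation_linear_form: "derivation (pd (linear_form v))"
  unfolding pd_linear_form[abs_def] by (intro derivation_sum derivation_mult derivation_dv)

lemma pd_linear_form_Var:
  assumes "i \<in> {1..r}"
  shows "pd (linear_form v) (Var (X i a b)) = Const (v i $ a $ b)"
proof -
  have "pd (linear_form v) (Var (X i a b)) = (\<Sum>k\<in>{1..r}. if k = i then Const (v i $ a $ b) else 0)"
    unfolding pd_linear_form
    by (rule sum.cong[OF refl]) (use exhaust_2[of a] exhaust_2[of b] in \<open>auto simp: sum_2 dv_Var\<close>)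
  then show ?thesis using assms by simp
qed

lemma dir_deriv_evX:
  assumes q: "xonly q"
  shows "dir_deriv v (evX q) = evX (pd (linear_form v) q)"
proof
  fix x
  define y where "y = point x (\<lambda>_. 0)"
  have "((\<lambda>t. ev (\<lambda>w. y w + t * ev y (pd (linear_form v) (Var w))) q) has_field_derivative
      ev y (pd (linear_form v) q)) (at 0)"
    by (rule DERIV_ev_line) (simp_all add: derivation_linear_form)
  moreover have "ev (\<lambda>w. y w + t * ev y (pd (linear_form v) (Var w))) q
      = evX q (\<lambda>i. \<chi> a b. x i $ a $ b + t * v i $ a $ b)" for t
    unfolding evX_def
  proof (rule ev_cong)
    fix \<alpha> w assume "\<alpha> \<in> keys q" "w \<in> keys \<alpha>"
    then have "w \<in> xvars" using q by (auto simp: xonly_def)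
    then obtain i a b where w: "w = X i a b" "i \<in> {1..r}" unfolding xvars_def by blast
    show "y w + t * ev y (pd (linear_form v) (Var w)) = point (\<lambda>i. \<chi> a b. x i $ a $ b + t * v i $ a $ b) (\<lambda>_. 0) w"
      by (simp add: w(1) pd_linear_form_Var[OF w(2)] y_def)
  qed
  ultimately have "((\<lambda>t. evX q (\<lambda>i. \<chi> a b. x i $ a $ b + t * v i $ a $ b)) has_field_derivative
      ev y (pd (linear_form v) q)) (at 0)" by simp
  then show "dir_deriv v (evX q) x = evX (pd (linear_form v) q) x"
    unfolding dir_deriv_def evX_def y_def by (rule DERIV_imp_deriv)
qed

lemma Sym_plus_pol:
  assumes "D \<in> Sym_plus"
  shows "\<exists>p. xonly p \<and> lookup p 0 = 0 \<and> (\<forall>q. xonly q \<longrightarrow> D (evX q) = evX (pd p q))"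
  using assms
proof (induction rule: Sym_plus.induct)
  case (deriv v)
  show ?case
    by (intro exI[of _ "linear_form v"])
      (simp add: xonly_linear_form lookup_linear_form_0 dir_deriv_evX)
next
  case (add D E)
  then obtain p p' where "xonly p" "lookup p 0 = 0" "\<forall>q. xonly q \<longrightarrow> D (evX q) = evX (pd p q)"
    "xonly p'" "lookup p' 0 = 0" "\<forall>q. xonly q \<longrightarrow> E (evX q) = evX (pd p' q)" by blast
  then show ?case
    by (intro exI[of _ "p + p'"]) (simp add: xonly_add lookup_add pd_add_left evX_add)
next
  case (scale D c)
  then obtain p where "xonly p" "lookup p 0 = 0" "\<forall>q. xonly q \<longrightarrow> D (evX q) = evX (pd p q)" by blast
  then show ?case
    by (intro exI[of _ "Const c * p"]) (simp add: xonly_mult xonly_Const pd_mult evX_Const_mult)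
next
  case (mult D E)
  then obtain p p' where p: "xonly p" "lookup p 0 = 0" "\<forall>q. xonly q \<longrightarrow> D (evX q) = evX (pd p q)"
    "xonly p'" "lookup p' 0 = 0" "\<forall>q. xonly q \<longrightarrow> E (evX q) = evX (pd p' q)" by blast
  have "lookup (p * p') 0 = 0"
    using p(2) by (simp flip: ev_at_0)
  then show ?case
    using p by (intro exI[of _ "p * p'"]) (simp add: xonly_mult pd_mult xonly_pd)
qed

text \<open>\<open>Sym_plus\<close> contains no nonzero constants, so the constant term of the
  symbol is split off. The induction still passes through symbols that have one.\<close>

lemma Sym_plus_exists:
  assumes "xonly p"
  shows "\<exists>D\<in>Sym_plus. \<forall>q. xonly q \<longrightarrow> evX (pd p q) = fscale (lookup p 0) (evX q) + D (evX q)"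
  using assms
proof (induction rule: xonly_induct)
  case (Const c)
  \<comment> \<open>The zero operator, written as a multiple of a derivative to belong to
    \<open>Sym_plus\<close>.\<close>
  let ?Z = "\<lambda>f. fscale 0 (dir_deriv (\<lambda>_. 0) f)"
  have "?Z \<in> Sym_plus" by (intro Sym_plus.intros)
  moreover have c: "lookup (Const c) 0 = c" by (simp add: Const_def)
  have z: "?Z f = 0" for f by (simp add: fscale_def fun_eq_iff)
  ultimately show ?case
    by (intro bexI[of _ ?Z] allI impI) (simp_all only: c z pd_Const evX_Const_mult add_0_right)
next
  case (mult p v)
  then obtain D where D: "D \<in> Sym_plus" "\<And>q. xonly q \<Longrightarrow> evX (pd p q) = fscale (lookup p 0) (evX q) + D (evX q)" by blast
  obtain i a b where v: "v = X i a b" "i \<in> {1..r}" using mult(2) unfolding xvars_def by blast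
  define e :: tuple where "e = (\<lambda>k. \<chi> c d. if k = i \<and> c = a \<and> d = b then 1 else 0)"
  have e: "dir_deriv e (evX q) = evX (dv v q)" if "xonly q" for q
  proof -
    have "linear_form e = (\<Sum>k\<in>{1..r}. if k = i then Var v else 0)"
      unfolding linear_form_def
      by (rule sum.cong[OF refl]) (use exhaust_2[of a] exhaust_2[of b] in \<open>auto simp: sum_2 e_def v(1)\<close>)
    then have "linear_form e = Var v" using v(2) by simp
    then show ?thesis using dir_deriv_evX[OF that, of e] by simp
  qed
  let ?E = "\<lambda>f. fscale (lookup p 0) (dir_deriv e f) + (D \<circ> dir_deriv e) f"
  have "?E \<in> Sym_plus"
    by (intro Sym_plus.intros D(1))
  moreover have "lookup (p * Var v) 0 = 0" by (simp flip: ev_at_0)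
  moreover have "evX (pd (p * Var v) q) = ?E (evX q)" if "xonly q" for q
    using D(2)[OF xonly_pd[OF that], of "Var v"] e[OF that] by (simp add: pd_mult)
  ultimately show ?case
    by (intro bexI[of _ ?E]) (simp_all add: fscale_def fun_eq_iff)
next
  case (add p q)
  then obtain D E where D: "D \<in> Sym_plus" "\<And>f. xonly f \<Longrightarrow> evX (pd p f) = fscale (lookup p 0) (evX f) + D (evX f)"
    and E: "E \<in> Sym_plus" "\<And>f. xonly f \<Longrightarrow> evX (pd q f) = fscale (lookup q 0) (evX f) + E (evX f)" by blast
  have "(\<lambda>f. D f + E f) \<in> Sym_plus" by (intro Sym_plus.intros D(1) E(1))
  then show ?case
    by (intro bexI[of _ "\<lambda>f. D f + E f"])
      (simp_all add: pd_add_left evX_add D(2) E(2) lookup_add F.scale_left_distrib add_ac)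
qed

subsection \<open>Conjugation by group elements\<close>

lemma act_evX:
  assumes "xonly q"
  shows "\<exists>q'. xonly q' \<and> evX q' = act r g (evX q)"
  using assms
proof (induction rule: xonly_induct)
  case (Const c)
  show ?case by (intro exI[of _ "Const c"]) (simp add: xonly_Const evX_def act_def fun_eq_iff)
next
  case (mult p v)
  then obtain p' where p': "xonly p'" "evX p' = act r g (evX p)" by blast
  obtain i a b where v: "v = X i a b" "i \<in> {1..r}" using mult(2) unfolding xvars_def by blast
  define A B where "A = inv_tuple g i" and "B = matrix_inv (inv_tuple g (nxt r i))"
  let ?l = "\<Sum>d\<in>UNIV. \<Sum>c\<in>UNIV. Const (A $ a $ c * B $ d $ b) * Var (X i c d)"
  have "xonly ?l" using v(2) by (intro xonly_sum xonly_mult xonly_Const xonly_Var) simp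
  moreover have "evX ?l x = act_V r (inv_tuple g) x i $ a $ b" for x
    by (simp add: evX_def act_V_def matrix_mult_2 sum_2 A_def B_def algebra_simps)
  ultimately show ?case
    using p' by (intro exI[of _ "p' * ?l"])
      (auto simp: xonly_mult fun_eq_iff act_def evX_def v(1) simp del: sum_2)
next
  case (add p q)
  then obtain p' q' where "xonly p'" "evX p' = act r g (evX p)" "xonly q'" "evX q' = act r g (evX q)" by blast
  then show ?case
    by (intro exI[of _ "p' + q'"]) (simp add: xonly_add evX_add, simp add: act_def fun_eq_iff)
qed

lemma act_inverse:
  assumes g: "\<forall>i\<in>{1..r}. invertible (g i)" and q: "xonly q"
  shows "act r g (act r (inv_tuple g) (evX q)) = evX q"
proof
  fix x
  have "evX q (act_V r (inv_tuple (inv_tuple g)) (act_V r (inv_tuple g) x)) = evX q x"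
  proof (rule evX_cong[OF q])
    fix i assume i: "i \<in> {1..r}"
    have gi: "invertible (g i)" and gn: "invertible (g (nxt r i))" using g i nxt_in[OF i] by blast+
    have "g i ** (matrix_inv (g i) ** x i ** g (nxt r i)) ** matrix_inv (g (nxt r i))
        = (g i ** matrix_inv (g i)) ** x i ** (g (nxt r i) ** matrix_inv (g (nxt r i)))"
      by (simp only: matrix_mul_assoc)
    then show "act_V r (inv_tuple (inv_tuple g)) (act_V r (inv_tuple g) x) i = x i"
      by (simp add: act_V_def inv_tuple_def matrix_inv_matrix_inv gi gn matrix_inv_right)
  qed
  then show "act r g (act r (inv_tuple g) (evX q)) x = evX q x" by (simp add: act_def)
qed

text \<open>Conjugation by \<open>g\<close> moves directions of differentiation by \<open>g\<close>.
  A symbol is a function on the dual of V, so as a polynomial function it gets composed with the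
  transposed tuple. Here \<open>q1\<close> stands for a polynomial representing the inverse of
  \<open>g\<close> applied to \<open>q\<close>.\<close>

lemma conj_pol:
  assumes g: "\<forall>i\<in>{1..r}. invertible (g i)" and p: "xonly p"
  shows "\<exists>p'. xonly p' \<and> (\<forall>y v. ev (point y v) p' = ev (point (act_V r (\<lambda>i. transpose (g i)) y) v) p)
    \<and> (\<forall>q q1. xonly q \<longrightarrow> xonly q1 \<longrightarrow> evX q1 = act r (inv_tuple g) (evX q)
        \<longrightarrow> act r g (evX (pd p q1)) = evX (pd p' q))"
  using p
proof (induction rule: xonly_induct)
  case (Const c)
  have "act r g (evX (Const c * q1)) = evX (Const c * q)"
    if "xonly q" "evX q1 = act r (inv_tuple g) (evX q)" for q q1
  proof -
    have "act r g (evX (Const c * q1)) = fscale c (act r g (evX q1))"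
      unfolding evX_Const_mult by (simp add: act_def fscale_def)
    also have "act r g (evX q1) = evX q" unfolding that(2) by (rule act_inverse[OF g that(1)])
    finally show ?thesis by (simp only: evX_Const_mult)
  qed
  then show ?case by (intro exI[of _ "Const c"]) (simp add: xonly_Const)
next
  case (mult p u)
  then obtain p' where p': "xonly p'"
      "\<And>y v. ev (point y v) p' = ev (point (act_V r (\<lambda>i. transpose (g i)) y) v) p"
      "\<And>q q1. xonly q \<Longrightarrow> xonly q1 \<Longrightarrow> evX q1 = act r (inv_tuple g) (evX q)
        \<Longrightarrow> act r g (evX (pd p q1)) = evX (pd p' q)" by blast
  obtain i a b where u: "u = X i a b" "i \<in> {1..r}" using mult(2) unfolding xvars_def by blast
  define e :: tuple where "e = (\<lambda>k. \<chi> c d. if k = i \<and> c = a \<and> d = b then 1 else 0)"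
  \<comment> \<open>The direction \<open>e\<close> moved by \<open>g\<close>; the double inverse
    arises from using the chain rule for \<open>inv_tuple g\<close>.\<close>
  define G where "G = act_V r (inv_tuple (inv_tuple g)) e"
  have lin_e: "linear_form e = Var u"
  proof -
    have "linear_form e = (\<Sum>k\<in>{1..r}. if k = i then Var u else 0)"
      unfolding linear_form_def
      by (rule sum.cong[OF refl]) (use exhaust_2[of a] exhaust_2[of b] in \<open>auto simp: sum_2 e_def u(1)\<close>)
    then show ?thesis using u(2) by simp
  qed
  have gi: "invertible (g i)" and gn: "invertible (g (nxt r i))" using g u(2) nxt_in[OF u(2)] by blast+
  have G0: "G k = 0" if "k \<noteq> i" for k
  proof -
    have "e k = 0" using that by (simp add: e_def vec_eq_iff)
    then show ?thesis by (simp add: G_def act_V_def)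
  qed
  have Gi: "G i $ c $ d = g i $ c $ a * matrix_inv (g (nxt r i)) $ b $ d" for c d
    using exhaust_2[of a] exhaust_2[of b]
    by (elim disjE) (simp_all add: G_def act_V_def inv_tuple_def matrix_inv_matrix_inv[OF gi]
        matrix_inv_matrix_inv[OF gn] matrix_mult_2 e_def)
  have ev_lin: "ev (point y v) (linear_form G) = act_V r (\<lambda>i. transpose (g i)) y i $ a $ b" for y v
  proof -
    have "ev (point y v) (linear_form G) = (\<Sum>k\<in>{1..r}. if k = i then \<Sum>c\<in>UNIV. \<Sum>d\<in>UNIV. G i $ c $ d * y i $ c $ d else 0)"
      unfolding linear_form_def ev_sum
      by (rule sum.cong[OF refl]) (auto simp: G0)
    also have "\<dots> = (\<Sum>c\<in>UNIV. \<Sum>d\<in>UNIV. G i $ c $ d * y i $ c $ d)" using u(2) by simp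
    also have "\<dots> = act_V r (\<lambda>i. transpose (g i)) y i $ a $ b"
      by (simp only: act_V_def matrix_inv_transpose[OF gn])
        (simp add: matrix_mult_2 Gi sum_2 transpose_def algebra_simps)
    finally show ?thesis .
  qed
  have "act r g (evX (pd (p * Var u) q1)) = evX (pd (p' * linear_form G) q)"
    if q: "xonly q" "xonly q1" "evX q1 = act r (inv_tuple g) (evX q)" for q q1
  proof -
    have "evX (dv u q1) = dir_deriv e (act r (inv_tuple g) (evX q))"
      using dir_deriv_evX[OF q(2), of e] by (simp add: lin_e q(3))
    also have "\<dots> = act r (inv_tuple g) (dir_deriv G (evX q))"
      by (simp add: dir_deriv_act G_def)
    also have "dir_deriv G (evX q) = evX (pd (linear_form G) q)"
      by (rule dir_deriv_evX[OF q(1)])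
    finally have "act r g (evX (pd p (dv u q1))) = evX (pd p' (pd (linear_form G) q))"
      by (intro p'(3) xonly_pd q)
    then show ?thesis by (simp add: pd_mult)
  qed
  then show ?case
    using p' ev_lin by (intro exI[of _ "p' * linear_form G"]) (simp add: xonly_mult xonly_linear_form u(1))
next
  case (add p q)
  then obtain p' q' where p': "xonly p'"
      "\<And>y v. ev (point y v) p' = ev (point (act_V r (\<lambda>i. transpose (g i)) y) v) p"
      "\<And>f f1. xonly f \<Longrightarrow> xonly f1 \<Longrightarrow> evX f1 = act r (inv_tuple g) (evX f)
        \<Longrightarrow> act r g (evX (pd p f1)) = evX (pd p' f)"
    and q': "xonly q'"
      "\<And>y v. ev (point y v) q' = ev (point (act_V r (\<lambda>i. transpose (g i)) y) v) q"
      "\<And>f f1. xonly f \<Longrightarrow> xonly f1 \<Longrightarrow> evX f1 = act r (inv_tuple g) (evX f)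
        \<Longrightarrow> act r g (evX (pd q f1)) = evX (pd q' f)" by blast
  have "act r g (evX (pd (p + q) f1)) = evX (pd (p' + q') f)"
    if "xonly f" "xonly f1" "evX f1 = act r (inv_tuple g) (evX f)" for f f1
  proof -
    have "act r g (evX (pd p f1) + evX (pd q f1)) = act r g (evX (pd p f1)) + act r g (evX (pd q f1))"
      by (simp add: act_def fun_eq_iff)
    then show ?thesis using p'(3)[OF that] q'(3)[OF that] by (simp add: pd_add_left evX_add)
  qed
  then show ?case
    using p' q' by (intro exI[of _ "p' + q'"]) (simp add: xonly_add)
qed

lemma K_grp_invertible: "g \<in> K_grp G r \<Longrightarrow> \<forall>i\<in>{1..r}. invertible (g i)"
  by (cases G) auto

text \<open>Transposes of invertible tuples are invertible, so conjugation returns the same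
  symbol.\<close>

lemma K_invariant_if_GL_invariant:
  assumes p: "xonly p" and inv: "\<And>g y v. \<forall>i\<in>{1..r}. invertible (g i) \<Longrightarrow> ev (point (act_V r g y) v) p = ev (point y v) p"
    and D: "\<And>q. xonly q \<Longrightarrow> D (evX q) = evX (pd p q)"
  shows "K_invariant G r D"
  unfolding K_invariant_def
proof (intro ballI)
  fix g f assume g: "g \<in> K_grp G r" and "f \<in> CV r"
  then obtain q where q: "xonly q" "f = evX q" by (auto simp: CV_eq)
  have gi: "\<forall>i\<in>{1..r}. invertible (g i)" by (rule K_grp_invertible[OF g])
  obtain q1 where q1: "xonly q1" "evX q1 = act r (inv_tuple g) (evX q)" using act_evX[OF q(1)] by blast
  obtain p' where p': "\<And>y v. ev (point y v) p' = ev (point (act_V r (\<lambda>i. transpose (g i)) y) v) p"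
      "act r g (evX (pd p q1)) = evX (pd p' q)"
    using conj_pol[OF gi p] q(1) q1 by blast
  have "\<forall>i\<in>{1..r}. invertible (transpose (g i))" using gi invertible_transpose_2 by blast
  then have "ev (point y v) p' = ev (point y v) p" for y v
    using p'(1) inv by simp
  then have "p' = p" using point_surj by (intro pol_eqI_ev) metis
  then show "act r g (D (act r (inv_tuple g) f)) = D f"
    using p'(2) q1 q D by (simp flip: q1(2))
qed

text \<open>Applied to a monomial, the operator has as constant term the corresponding coefficient
  of its symbol times a factorial.\<close>

lemma pd_faithful:
  assumes "xonly p" "xonly p'" "\<And>q. xonly q \<Longrightarrow> pd p q = pd p' q"
  shows "p = p'"
proof (rule poly_mapping_eqI)
  fix \<alpha>
  show "lookup p \<alpha> = lookup p' \<alpha>"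
  proof (cases "keys \<alpha> \<subseteq> xvars")
    case True
    then have "xonly (single \<alpha> 1)" by (simp add: xonly_def)
    then have "lookup (pd p (single \<alpha> 1)) 0 = lookup (pd p' (single \<alpha> 1)) 0" using assms(3) by simp
    then show ?thesis by (simp add: lookup_pd_0 fischer_single_right)
  next
    case False
    then have "\<alpha> \<notin> keys p" "\<alpha> \<notin> keys p'" using assms by (auto simp: xonly_def)
    then show ?thesis by (simp add: in_keys_iff)
  qed
qed

lemma act_V_scalar:
  assumes "c \<noteq> 0" "\<forall>i\<in>{1..r}. invertible (g i)" "i \<in> {1..r}"
  shows "act_V r (\<lambda>j. mat c ** g j) y i = act_V r g y i"
proof -
  have gn: "invertible (g (nxt r i))" using assms nxt_in by blast
  show ?thesis
    using assms(1)
    by (simp only: act_V_def matrix_inv_scalar_mult[OF gn assms(1)])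
      (simp add: matrix_eq_2 matrix_mult_2 mat_def field_simps)
qed

text \<open>Scalar tuples act trivially on \<open>V\<close>, so invariance under \<open>S(GL\<^sub>2\<^sup>r)\<close> already
  implies invariance under \<open>GL\<^sub>2\<^sup>r\<close>.\<close>

lemma GL_invariant_if_K_invariant:
  assumes p: "xonly p" and D: "\<And>q. xonly q \<Longrightarrow> D (evX q) = evX (pd p q)" and inv: "K_invariant G r D"
    and g: "\<forall>i\<in>{1..r}. invertible (g i)"
  shows "ev (point (act_V r g y) v) p = ev (point y v) p"
proof -
  have K: "ev (point (act_V r h y) v) p = ev (point y v) p" if h: "(\<lambda>i. transpose (h i)) \<in> K_grp G r" for h
  proof -
    let ?h = "\<lambda>i. transpose (h i)"
    have hi: "\<forall>i\<in>{1..r}. invertible (?h i)" by (rule K_grp_invertible[OF h])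
    obtain p' where p': "xonly p'" "\<And>y v. ev (point y v) p' = ev (point (act_V r h y) v) p"
        "\<And>q q1. xonly q \<Longrightarrow> xonly q1 \<Longrightarrow> evX q1 = act r (inv_tuple ?h) (evX q)
          \<Longrightarrow> act r ?h (evX (pd p q1)) = evX (pd p' q)"
      using conj_pol[OF hi p] by auto
    have "p = p'"
    proof (rule pd_faithful[OF p p'(1)])
      fix q assume q: "xonly q"
      obtain q1 where q1: "xonly q1" "evX q1 = act r (inv_tuple ?h) (evX q)" using act_evX[OF q] by blast
      have "evX q \<in> CV r" using q by (auto simp: CV_eq)
      then have "act r ?h (D (act r (inv_tuple ?h) (evX q))) = D (evX q)"
        using inv h unfolding K_invariant_def by blast
      then have "evX (pd p' q) = evX (pd p q)"
        using p'(3)[OF q q1] D[OF q1(1)] D[OF q] by (simp flip: q1(2))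
      then show "pd p q = pd p' q" by (intro evX_inj xonly_pd q) simp
    qed
    then show ?thesis using p'(2)[of y v] by simp
  qed
  define P where "P = (\<Prod>i\<in>{1..r}. det (g i))"
  have P: "P \<noteq> 0" using g by (simp add: P_def invertible_det_nz)
  \<comment> \<open>A root of order \<open>2 * r\<close> of the inverse of \<open>P\<close>, taken
    through the logarithm. Scaling every \<open>g i\<close> by \<open>c\<close> multiplies the
    product of the determinants by \<open>c ^ (2 * r)\<close> and so makes it 1.\<close>
  define c where "c = exp (- Ln P / of_nat (2 * r))"
  have c: "c \<noteq> 0" by (simp add: c_def)
  have "c ^ (2 * r) = exp (of_nat (2 * r) * (- Ln P / of_nat (2 * r)))"
    unfolding c_def by (rule exp_of_nat_mult[symmetric])
  also have "of_nat (2 * r) * (- Ln P / of_nat (2 * r)) = - Ln P" using r2 by (simp add: field_simps)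
  also have "exp (- Ln P) = inverse P" using P by (simp add: exp_minus)
  finally have cP: "c ^ (2 * r) * P = 1" using P by simp
  have "(\<Prod>i\<in>{1..r}. det (transpose (mat c ** g i))) = (\<Prod>i\<in>{1..r}. c\<^sup>2 * det (g i))"
    by (simp add: det_mul det_mat_2)
  also have "\<dots> = (c\<^sup>2) ^ r * P" by (simp add: prod.distrib P_def)
  also have "\<dots> = 1" using cP by (simp add: power_mult)
  finally have dP: "(\<Prod>i\<in>{1..r}. det (transpose (mat c ** g i))) = 1" .
  have "\<forall>i\<in>{1..r}. invertible (transpose (mat c ** g i))"
    using g c invertible_scalar_mult invertible_transpose_2 by blast
  then have "(\<lambda>i. transpose (mat c ** g i)) \<in> K_grp G r" using dP by (cases G) auto
  then have "ev (point (act_V r (\<lambda>i. mat c ** g i) y) v) p = ev (point y v) p" by (rule K)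
  moreover have "ev (point (act_V r (\<lambda>i. mat c ** g i) y) v) p = ev (point (act_V r g y) v) p"
    unfolding ev_xonly[OF p] by (rule evX_cong[OF p]) (rule act_V_scalar[OF c g])
  ultimately show ?thesis by simp
qed

section \<open>Symbols of invariant operators\<close>

lemma trace_poly_xonly: "xonly trace_poly"
  by (rule hom_space_xonly[OF supported_multiples(2) trace_poly_in_hom_space])

lemma det_poly_xonly: "xonly det_poly"
  by (rule hom_space_xonly[OF supported_multiples(1) det_poly_in_hom_space])

text \<open>The scalar 2 at vertex \<open>j\<close> multiplies X_j by 2 and X_(j-1) by 1/2, so
  invariance forces equal powers of 2.\<close>

lemma GL_invariant_degrees:
  assumes p: "xonly p" and inv: "\<And>g y v. \<forall>i\<in>{1..r}. invertible (g i) \<Longrightarrow> ev (point (act_V r g y) v) p = ev (point y v) p"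
    and \<alpha>: "\<alpha> \<in> keys p" and j: "j \<in> {1..r}"
  shows "degX j \<alpha> = degX (prev j) \<alpha>"
proof -
  define c :: "var \<Rightarrow> complex" where
    "c w = (case w of X i a b \<Rightarrow> if i = j then 2 else if i = prev j then 1 / 2 else 1 | U i a \<Rightarrow> 1)" for w
  let ?g = "at_vertex j (mat 2)"
  have i2: "invertible (mat 2 :: complex^2^2)" by (simp add: invertible_det_nz det_mat_2)
  have inv2: "matrix_inv (mat 2 :: complex^2^2) = mat (1 / 2)"
    by (rule matrix_inv_unique) (simp_all add: matrix_eq_2 matrix_mult_2 mat_def)
  have inv_g: "\<forall>i\<in>{1..r}. invertible (?g i)"
    using i2 by (simp add: at_vertex_def invertible_det_nz det_I)
  have "ev (\<lambda>w. c w * y w) p = ev y p" for y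
  proof -
    obtain x v where y: "y = point x v" using point_surj by blast
    have "ev (\<lambda>w. c w * y w) p = ev (point (act_V r ?g x) v) p"
    proof (rule ev_cong)
      fix \<beta> w assume "\<beta> \<in> keys p" "w \<in> keys \<beta>"
      then have "w \<in> xvars" using p by (auto simp: xonly_def)
      then obtain i a b where w: "w = X i a b" "i \<in> {1..r}" unfolding xvars_def by blast
      consider "i = j" "nxt r i \<noteq> j" | "i \<noteq> j" "i = prev j" "nxt r i = j" | "i \<noteq> j" "i \<noteq> prev j" "nxt r i \<noteq> j"
        using nxt_eq[OF j w(2)] prev_neq[OF j] by metis
      then show "c w * y w = point (act_V r ?g x) v w"
        by cases (use exhaust_2[of a] exhaust_2[of b] in
          \<open>(elim disjE; simp add: w(1) y c_def act_V_def at_vertex_def inv2 matrix_mult_2; simp add: mat_def)+\<close>)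
    qed
    also have "\<dots> = ev y p" unfolding y by (rule inv[OF inv_g])
    finally show ?thesis .
  qed
  then have m: "mev c \<alpha> = 1" by (rule ev_scale_keys[OF _ \<alpha>])
  have "keys \<alpha> \<subseteq> xvars" using p \<alpha> by (simp add: xonly_def)
  then have "mev c \<alpha> = mev c (exponent_mon (\<lambda>i a b. lookup \<alpha> (X i a b)))"
    by (simp only: exponent_mon_lookup)
  also have "\<dots> = (\<Prod>i\<in>{1..r}. \<Prod>a\<in>UNIV. \<Prod>b\<in>UNIV. c (X i a b) ^ lookup \<alpha> (X i a b))"
    by (simp add: exponent_mon_def mev_sum)
  also have "\<dots> = (\<Prod>i\<in>{1..r}. c (X i 1 1) ^ degX i \<alpha>)"
    by (rule prod.cong[OF refl]) (simp add: c_def UNIV_2 degX_def power_add mult_ac)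
  also have "\<dots> = (\<Prod>i\<in>{1..r}. (if i = j then 2 ^ degX j \<alpha> else 1) * (if i = prev j then (1 / 2) ^ degX (prev j) \<alpha> else 1))"
    using prev_neq[OF j] by (intro prod.cong) (auto simp: c_def)
  also have "\<dots> = 2 ^ degX j \<alpha> * (1 / 2) ^ degX (prev j) \<alpha>"
    using j prev_in[OF j] by (simp add: prod.distrib del: atLeastAtMost_iff)
  finally have "(2::complex) ^ degX j \<alpha> = 2 ^ degX (prev j) \<alpha>"
    using m by (simp add: power_one_over field_simps)
  then have "norm ((2::complex) ^ degX j \<alpha>) = norm ((2::complex) ^ degX (prev j) \<alpha>)" by simp
  then have "(2::real) ^ degX j \<alpha> = 2 ^ degX (prev j) \<alpha>" by (simp add: norm_power)
  then show ?thesis by simp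
qed

text \<open>The degree at vertex 1 is enough for the grading, as an invariant symbol has equal
  degrees at all vertices.\<close>

definition hom_part :: "nat \<Rightarrow> var pol \<Rightarrow> var pol" where
  "hom_part k p = (\<Sum>\<alpha>\<in>{\<alpha>\<in>keys p. degX 1 \<alpha> = k}. single \<alpha> (lookup p \<alpha>))"

text \<open>Each homogeneous part of the symbol is an invariant of positive degree k e, where no
  harmonic invariants exist. It is thus a combination of the trace and the determinant, and its
  operator factors through two operators that kill \<open>q\<close>.\<close>

lemma GL_invariant_ideal:
  assumes p: "xonly p" "lookup p 0 = 0"
    and inv: "\<And>g y v. \<forall>i\<in>{1..r}. invertible (g i) \<Longrightarrow> ev (point (act_V r g y) v) p = ev (point y v) p"
    and q: "pd trace_poly q = 0" "pd det_poly q = 0"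
  shows "pd p q = 0"
proof -
  define K where "K = degX 1 ` keys p"
  have finK: "finite K" by (simp add: K_def)
  have sum: "p = (\<Sum>k\<in>K. hom_part k p)"
  proof -
    have "(\<Sum>k\<in>K. hom_part k p) = (\<Sum>\<alpha>\<in>keys p. single \<alpha> (lookup p \<alpha>))"
      unfolding hom_part_def K_def by (rule sum.image_gen[symmetric]) simp
    then show ?thesis by (simp add: pol_sum_single[symmetric])
  qed
  have deg: "degX i \<alpha> = degX 1 \<alpha>" if "i \<in> {1..r}" "\<alpha> \<in> keys p" for i \<alpha>
    using that(1)
  proof (induction i)
    case (Suc i)
    show ?case
    proof (cases "i = 0")
      case False
      then have "degX (Suc i) \<alpha> = degX i \<alpha>"
        using GL_invariant_degrees[OF p(1) inv that(2) Suc.prems] by (simp add: prv_def One_nat_def)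
      then show ?thesis using Suc False by simp
    qed (simp add: One_nat_def)
  qed simp
  have keys_part: "keys (hom_part k p) \<subseteq> {\<alpha>\<in>keys p. degX 1 \<alpha> = k}" for k
  proof
    fix \<alpha> assume "\<alpha> \<in> keys (hom_part k p)"
    then have "lookup (hom_part k p) \<alpha> \<noteq> 0" by (simp add: in_keys_iff)
    then show "\<alpha> \<in> {\<alpha>\<in>keys p. degX 1 \<alpha> = k}"
      by (rule contrapos_np) (auto simp: hom_part_def lookup_sum lookup_single when_def intro!: sum.neutral)
  qed
  have part_hom: "hom_part k p \<in> hom_space (\<lambda>i. int k * ones i) (\<lambda>_. 0)" for k
    unfolding hom_space_def mem_Collect_eq
  proof
    fix \<alpha> assume "\<alpha> \<in> keys (hom_part k p)"
    then have \<alpha>: "\<alpha> \<in> keys p" "degX 1 \<alpha> = k" using keys_part by blast+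
    have x: "keys \<alpha> \<subseteq> xvars" using p(1) \<alpha>(1) by (simp add: xonly_def)
    have "lookup \<alpha> (X i a b) = 0" if "i \<notin> {1..r}" for i a b
    proof -
      have "X i a b \<notin> keys \<alpha>" using x that by auto
      then show ?thesis by (simp add: in_keys_iff)
    qed
    moreover have "lookup \<alpha> (U i a) = 0" for i a
    proof -
      have "U i a \<notin> keys \<alpha>" using x by auto
      then show ?thesis by (simp add: in_keys_iff)
    qed
    ultimately show "\<alpha> \<in> mons (\<lambda>i. int k * ones i) (\<lambda>_. 0)"
      using deg[OF _ \<alpha>(1)] \<alpha>(2) by (simp add: mons_def ones_def degU_def) (simp add: degX_def)
  qed
  have slp: "SL_invariant r p"
    unfolding SL_invariant_def fixed_by_def
  proof (intro allI impI)
    fix g x v assume "\<forall>i\<in>{1..r}. det (g i :: complex^2^2) = 1"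
    then have "\<forall>i\<in>{1..r}. invertible (g i)" by (simp add: invertible_det_1)
    then have "ev (point (act_V r g x) v) p = ev (point x v) p" by (rule inv)
    then show "ev (point (act_V r g x) (act_U g v)) p = ev (point x v) p"
      by (simp only: ev_xonly[OF p(1)])
  qed
  have part_inv: "hom_part k p \<in> inv_space (\<lambda>i. int k * ones i) (\<lambda>_. 0)" if k: "k \<in> K" for k
    unfolding inv_space_def
  proof (intro CollectI conjI part_hom ballI allI impI poly_mapping_eqI)
    fix i \<alpha> and a b :: 2 assume i: "i \<in> {1..r}" and ab: "a \<noteq> b"
    \<comment> \<open>Root operators preserve the degree, so the vanishing of their value on
      \<open>p\<close> can be read off part by part.\<close>
    have root_deg: "degX 1 \<alpha> = k'" if key: "\<alpha> \<in> keys (root_op i a b (hom_part k' p))" for k'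
    proof -
      obtain \<beta> u w where "\<alpha> = \<beta> + single u 1" "\<beta> + single w 1 \<in> keys (hom_part k' p)"
        "(\<exists>c. u = X i b c \<and> w = X i a c) \<or> (\<exists>c. u = X (prev i) c a \<and> w = X (prev i) c b)
          \<or> (u = U i b \<and> w = U i a)"
        using key by (rule keys_root_op)
      moreover from this have "degX 1 (\<beta> + single w 1) = k'" using keys_part by blast
      ultimately show ?thesis by auto
    qed
    have "root_op i a b p = 0"
      by (rule root_op_eq_0_if_SL_invariant[OF xonly_in_range[OF p(1)] slp i ab])
    moreover have "root_op i a b p = root_op i a b (\<Sum>k\<in>K. hom_part k p)"
      by (rule arg_cong[OF sum])
    moreover have "root_op i a b (\<Sum>k\<in>S. hom_part k p) = (\<Sum>k\<in>S. root_op i a b (hom_part k p))" for S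
      by (induction S rule: infinite_finite_induct) (simp_all add: root_op_rules)
    ultimately have "(\<Sum>k\<in>K. root_op i a b (hom_part k p)) = 0" by metis
    then have s: "(\<Sum>k\<in>K. lookup (root_op i a b (hom_part k p)) \<alpha>) = 0"
      by (simp flip: lookup_sum)
    show "lookup (root_op i a b (hom_part k p)) \<alpha> = lookup 0 \<alpha>"
    proof (cases "degX 1 \<alpha> = k")
      case True
      have "lookup (root_op i a b (hom_part k' p)) \<alpha> = 0" if "k' \<noteq> k" for k'
        using root_deg[of k'] that True by (auto simp: in_keys_iff)
      then have "(\<Sum>k\<in>K. lookup (root_op i a b (hom_part k p)) \<alpha>) = lookup (root_op i a b (hom_part k p)) \<alpha>"
        using k finK by (simp add: sum.remove[of K k])
      then show ?thesis using s by simp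
    next
      case False
      then show ?thesis using root_deg[of k] by (auto simp: in_keys_iff)
    qed
  qed
  have "pd (hom_part k p) q = 0" if k: "k \<in> K" for k
  proof -
    \<comment> \<open>A part of degree 0 would be a nonzero constant term, which operators in
      \<open>Sym_plus\<close> do not have.\<close>
    have "k \<noteq> 0"
    proof
      assume "k = 0"
      then obtain \<alpha> where \<alpha>: "\<alpha> \<in> keys p" "degX 1 \<alpha> = 0" using k by (auto simp: K_def)
      have "lookup \<alpha> v = 0" for v
      proof (cases "v \<in> xvars")
        case True
        then obtain i a b where v: "v = X i a b" "i \<in> {1..r}" unfolding xvars_def by blast
        then have "degX i \<alpha> = 0" using deg \<alpha> by metis
        then show ?thesis using exhaust_2[of a] exhaust_2[of b] by (auto simp: degX_def v(1))
      next
        case False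
        then have "v \<notin> keys \<alpha>" using p(1) \<alpha>(1) by (auto simp: xonly_def)
        then show ?thesis by (simp add: in_keys_iff)
      qed
      then have "\<alpha> = 0" by (intro poly_mapping_eqI) simp
      then show False using \<alpha>(1) p(2) by (simp add: in_keys_iff)
    qed
    then have "harm_space (\<lambda>i. int k * ones i) (\<lambda>_. 0) \<subseteq> {0}" by (intro harm_space_trivial) simp
    then obtain f g where "hom_part k p = trace_poly * f + det_poly * g"
      by (rule ideal_if_harm_space_0[OF supported_multiples(1,3) _ part_inv[OF k]])
    then have "pd (hom_part k p) q = pd f (pd trace_poly q) + pd g (pd det_poly q)"
      by (simp add: pd_add_left pd_mult pd_commute[of trace_poly] pd_commute[of det_poly])
    then show ?thesis by (simp add: q)
  qed
  then have "pd (\<Sum>k\<in>K. hom_part k p) q = 0" by (simp add: pd_sum_left)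
  then show ?thesis by (simp flip: sum)
qed

text \<open>The infinitely many conditions defining harmonics reduce to two, and these do not depend
  on which of the two groups is meant.\<close>

lemma Harm_iff:
  assumes q: "xonly q"
  shows "evX q \<in> Harm G r \<longleftrightarrow> pd trace_poly q = 0 \<and> pd det_poly q = 0"
proof
  assume h: "evX q \<in> Harm G r"
  have zero: "pd p q = 0" if p: "xonly p" "lookup p 0 = 0"
    and inv: "\<And>g y v. \<forall>i\<in>{1..r}. invertible (g i) \<Longrightarrow> ev (point (act_V r g y) v) p = ev (point y v) p" for p
  proof -
    obtain D where D: "D \<in> Sym_plus" "\<And>f. xonly f \<Longrightarrow> evX (pd p f) = fscale (lookup p 0) (evX f) + D (evX f)"
      using Sym_plus_exists[OF p(1)] by blast
    have D': "D (evX f) = evX (pd p f)" if "xonly f" for f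
      using D(2)[OF that] p(2) by simp
    have "K_invariant G r D" by (rule K_invariant_if_GL_invariant[OF p(1) inv D'])
    then have "D (evX q) = 0" using h D(1) unfolding Harm_def by blast
    then have "evX (pd p q) = evX 0" using D'[OF q] by (simp add: evX_0)
    then show ?thesis by (rule evX_inj[OF xonly_pd[OF q] xonly_0])
  qed
  have "lookup trace_poly 0 = 0"
  proof -
    have "0 \<notin> mons ones (\<lambda>_. 0)" using r2 by (auto simp: mons_def ones_def intro!: exI[of _ 1])
    then have "0 \<notin> keys trace_poly" using trace_poly_in_hom_space by (auto simp: hom_space_def)
    then show ?thesis by (simp add: in_keys_iff)
  qed
  moreover have "lookup det_poly 0 = 0"
  proof -
    have "0 \<notin> mons (\<lambda>i. 2 * ones i) (\<lambda>_. 0)" using r2 by (auto simp: mons_def ones_def intro!: exI[of _ 1])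
    then have "0 \<notin> keys det_poly" using det_poly_in_hom_space by (auto simp: hom_space_def)
    then show ?thesis by (simp add: in_keys_iff)
  qed
  ultimately show "pd trace_poly q = 0 \<and> pd det_poly q = 0"
    by (intro conjI zero trace_poly_xonly det_poly_xonly trace_poly_invariant det_poly_invariant)
next
  assume z: "pd trace_poly q = 0 \<and> pd det_poly q = 0"
  have "D (evX q) = 0" if D: "D \<in> Sym_plus" "K_invariant G r D" for D
  proof -
    obtain p where p: "xonly p" "lookup p 0 = 0" "\<And>q. xonly q \<Longrightarrow> D (evX q) = evX (pd p q)"
      using Sym_plus_pol[OF D(1)] by blast
    have "pd p q = 0"
      using z by (intro GL_invariant_ideal[OF p(1,2) GL_invariant_if_K_invariant[OF p(1,3) D(2)]]) auto
    then show ?thesis by (simp add: p(3)[OF q] evX_0)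
  qed
  moreover have "evX q \<in> CV r" using q by (auto simp: CV_eq)
  ultimately show "evX q \<in> Harm G r" by (auto simp: Harm_def)
qed

end

section \<open>Intertwining maps as invariant polynomials\<close>

interpretation H: vector_space hscale by (rule vector_space_hscale)

text \<open>The symmetric power of \<open>g\<close> sends the power w^s to (g w)^s, and the
  coordinates of such a power are binomial coefficients times monomials. Both sides are coefficients
  of one binomial expansion.\<close>

lemma sym_pow_binomial:
  assumes "k \<le> s"
  shows "(\<Sum>a\<in>{0..s}. sym_pow s g k a * (of_nat (s choose a) * w $ 1 ^ (s - a) * w $ 2 ^ a))
    = of_nat (s choose k) * (g *v w) $ 1 ^ (s - k) * (g *v w) $ 2 ^ k"
proof -
  let ?p = "[:g $ 1 $ 1, g $ 2 $ 1:]" and ?q = "[:g $ 1 $ 2, g $ 2 $ 2:]"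
  have "(\<Sum>a\<in>{0..s}. sym_pow s g k a * (of_nat (s choose a) * w $ 1 ^ (s - a) * w $ 2 ^ a))
      = coeff (\<Sum>a\<le>s. of_nat (s choose a) * (smult (w $ 2) ?q) ^ a * (smult (w $ 1) ?p) ^ (s - a)) k"
    unfolding coeff_sum atLeast0AtMost
  proof (rule sum.cong[OF refl])
    fix a
    have "of_nat (s choose a) * (smult (w $ 2) ?q) ^ a * (smult (w $ 1) ?p) ^ (s - a)
        = smult (of_nat (s choose a) * w $ 1 ^ (s - a) * w $ 2 ^ a) (?p ^ (s - a) * ?q ^ a)"
      by (simp add: smult_power of_nat_poly mult_ac del: smult_pCons)
    then show "sym_pow s g k a * (of_nat (s choose a) * w $ 1 ^ (s - a) * w $ 2 ^ a)
        = coeff (of_nat (s choose a) * (smult (w $ 2) ?q) ^ a * (smult (w $ 1) ?p) ^ (s - a)) k"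
      by (simp only: coeff_smult sym_pow_def mult.commute)
  qed
  also have "(\<Sum>a\<le>s. of_nat (s choose a) * (smult (w $ 2) ?q) ^ a * (smult (w $ 1) ?p) ^ (s - a))
      = (smult (w $ 2) ?q + smult (w $ 1) ?p) ^ s"
    by (rule binomial_ring[symmetric])
  also have "smult (w $ 2) ?q + smult (w $ 1) ?p = [:(g *v w) $ 1, (g *v w) $ 2:]"
    by (simp add: matrix_vector_mult_2 mult.commute add.commute)
  also have "coeff ([:(g *v w) $ 1, (g *v w) $ 2:] ^ s) k
      = of_nat (s choose k) * (g *v w) $ 2 ^ k * (g *v w) $ 1 ^ (s - k)"
    by (rule coeff_linear_poly_power[OF assms])
  finally show ?thesis by (simp add: mult_ac)
qed

context cyclic
begin

abbreviation "idx s \<equiv> tensor_index r s"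

lemma idxD: "k \<in> idx s \<Longrightarrow> i \<in> {1..r} \<Longrightarrow> k i \<le> s i"
  by (auto simp: tensor_index_def PiE_iff)

lemma finite_idx: "finite (idx s)"
  unfolding tensor_index_def by (rule finite_PiE) auto

definition binom_prod :: "(nat \<Rightarrow> nat) \<Rightarrow> (nat \<Rightarrow> nat) \<Rightarrow> complex" where
  "binom_prod s k = (\<Prod>i\<in>{1..r}. of_nat (s i choose k i))"

lemma binom_prod_nonzero: "k \<in> idx s \<Longrightarrow> binom_prod s k \<noteq> 0"
  by (auto simp: binom_prod_def dest: idxD)

definition umon :: "(nat \<Rightarrow> nat) \<Rightarrow> (nat \<Rightarrow> nat) \<Rightarrow> var mon" where
  "umon s k = (\<Sum>i\<in>{1..r}. single (U i 1) (s i - k i) + single (U i 2) (k i))"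

lemma mev_umon: "mev (point x v) (umon s k) = (\<Prod>i\<in>{1..r}. v i $ 1 ^ (s i - k i) * v i $ 2 ^ k i)"
  by (simp add: umon_def mev_sum mev_add)

lemma lookup_umon:
  "lookup (umon s k) (X i a b) = 0"
  "lookup (umon s k) (U i 1) = (if i \<in> {1..r} then s i - k i else 0)"
  "lookup (umon s k) (U i 2) = (if i \<in> {1..r} then k i else 0)"
  by (simp_all add: umon_def lookup_sum lookup_add lookup_single when_def)

lemma inj_umon: "inj_on (umon s) (idx s)"
proof (rule inj_onI)
  fix k l assume kl: "k \<in> idx s" "l \<in> idx s" and eq: "umon s k = umon s l"
  show "k = l"
  proof
    fix i
    show "k i = l i"
    proof (cases "i \<in> {1..r}")
      case True
      then show ?thesis
        using arg_cong[OF eq, of "\<lambda>\<alpha>. lookup \<alpha> (U i 2)"] by (simp add: lookup_umon del: atLeastAtMost_iff)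
    next
      case False
      then show ?thesis using kl by (simp add: tensor_index_def PiE_iff extensional_def del: atLeastAtMost_iff)
    qed
  qed
qed

text \<open>The coordinates of \<open>v\<^sub>1\<^bsup>s\<^sub>1\<^esup> \<otimes> \<dots> \<otimes> v\<^sub>r\<^bsup>s\<^sub>r\<^esup>\<close>.\<close>

definition power_vec :: "(nat \<Rightarrow> nat) \<Rightarrow> (nat \<Rightarrow> complex^2) \<Rightarrow> (nat \<Rightarrow> nat) \<Rightarrow> complex" where
  "power_vec s v k = (if k \<in> idx s then
     (\<Prod>i\<in>{1..r}. of_nat (s i choose k i) * v i $ 1 ^ (s i - k i) * v i $ 2 ^ k i) else 0)"

lemma power_vec_eq: "k \<in> idx s \<Longrightarrow> power_vec s v k = binom_prod s k * mev (point x v) (umon s k)"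
  by (simp add: power_vec_def binom_prod_def mev_umon prod.distrib mult.assoc)

lemma power_vec_in_F_space: "power_vec s v \<in> F_space r s"
  by (simp add: F_space_def power_vec_def)

lemma F_act_power_vec:
  "F_act G r z s (w, g) (power_vec s v)
    = fscale (\<Prod>j\<in>{1..ell G r}. w j powi z j) (power_vec s (act_U g v))"
proof
  fix k
  show "F_act G r z s (w, g) (power_vec s v) k
    = fscale (\<Prod>j\<in>{1..ell G r}. w j powi z j) (power_vec s (act_U g v)) k"
  proof (cases "k \<in> idx s")
    case True
    let ?h = "\<lambda>i a. sym_pow (s i) (g i) (k i) a * (of_nat (s i choose a) * v i $ 1 ^ (s i - a) * v i $ 2 ^ a)"
    have "(\<Sum>l\<in>idx s. (\<Prod>i\<in>{1..r}. sym_pow (s i) (g i) (k i) (l i)) * power_vec s v l)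
        = (\<Sum>l\<in>idx s. \<Prod>i\<in>{1..r}. ?h i (l i))"
      by (rule sum.cong[OF refl]) (simp add: power_vec_def prod.distrib)
    also have "\<dots> = (\<Prod>i\<in>{1..r}. \<Sum>a\<in>{0..s i}. ?h i a)"
      unfolding tensor_index_def by (rule prod_sum_PiE[symmetric]) auto
    also have "\<dots> = (\<Prod>i\<in>{1..r}. of_nat (s i choose k i) * (g i *v v i) $ 1 ^ (s i - k i) * (g i *v v i) $ 2 ^ k i)"
      by (rule prod.cong[OF refl], rule sym_pow_binomial, rule idxD[OF True])
    also have "\<dots> = power_vec s (act_U g v) k"
      using True by (simp add: power_vec_def act_U_def)
    finally show ?thesis using True by (simp add: F_act_def fscale_def)
  next
    case False
    then show ?thesis by (simp add: F_act_def fscale_def power_vec_def)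
  qed
qed

text \<open>Power vectors span the tensor product: a functional vanishing on all of them is an
  identically vanishing polynomial in the \<open>U\<close> variables, whose monomials
  \<open>umon s k\<close> are distinct.\<close>

lemma power_vec_separating:
  assumes "\<And>v. (\<Sum>k\<in>idx s. power_vec s v k * c k) = 0" and k: "k \<in> idx s"
  shows "c k = 0"
proof -
  define p where "p = (\<Sum>l\<in>idx s. single (umon s l) (binom_prod s l * c l))"
  have "ev y p = 0" for y
  proof -
    obtain x v where y: "y = point x v" using point_surj by blast
    have "ev y p = (\<Sum>l\<in>idx s. power_vec s v l * c l)"
      unfolding p_def ev_sum ev_single y
      by (rule sum.cong[OF refl]) (simp add: power_vec_eq[of _ s v x] mult_ac)
    then show ?thesis using assms(1) by simp
  qed
  then have "p = 0" by (rule pol_eq_0_if_ev_0)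
  then have "lookup p (umon s k) = 0" by simp
  moreover have "lookup p (umon s k) = (\<Sum>l\<in>idx s. if l = k then binom_prod s k * c k else 0)"
    unfolding p_def lookup_sum
  proof (rule sum.cong[OF refl])
    fix l assume "l \<in> idx s"
    then have "umon s l = umon s k \<longleftrightarrow> l = k" using inj_umon k by (meson inj_on_eq_iff)
    then show "lookup (single (umon s l) (binom_prod s l * c l)) (umon s k) = (if l = k then binom_prod s k * c k else 0)"
      by (simp add: lookup_single when_def)
  qed
  ultimately have "binom_prod s k * c k = 0" using k finite_idx by simp
  then show ?thesis using binom_prod_nonzero[OF k] by simp
qed

definition unit_vec :: "(nat \<Rightarrow> nat) \<Rightarrow> (nat \<Rightarrow> nat) \<Rightarrow> complex" where
  "unit_vec k l = (if l = k then 1 else 0)"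

lemma unit_vec_in_F_space: "k \<in> idx s \<Longrightarrow> unit_vec k \<in> F_space r s"
  by (auto simp: F_space_def unit_vec_def)

lemma linear_on_F_space:
  assumes add: "\<forall>u\<in>F_space r s. \<forall>v\<in>F_space r s. T (u + v) = T u + (T v :: tuple \<Rightarrow> complex)"
    and scale: "\<forall>c. \<forall>u\<in>F_space r s. T (fscale c u) = fscale c (T u)" and u: "u \<in> F_space r s"
  shows "T u x = (\<Sum>k\<in>idx s. u k * T (unit_vec k) x)"
proof -
  have expand: "T (\<lambda>l. if l \<in> S then u l else 0) x = (\<Sum>k\<in>S. u k * T (unit_vec k) x)" if "finite S" "S \<subseteq> idx s" for S
    using that
  proof (induction S)
    case empty
    have z: "(\<lambda>_. 0) \<in> F_space r s" by (simp add: F_space_def)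
    have zero: "fscale 0 (\<lambda>_. 0) = (\<lambda>_ :: nat \<Rightarrow> nat. 0)" by (simp only: fscale_def mult_zero_left)
    have "T (\<lambda>_. 0) x = fscale 0 (T (\<lambda>_. 0)) x"
      using bspec[OF spec[OF scale, of 0] z] unfolding zero by (rule fun_cong)
    also have "\<dots> = 0" by (simp only: fscale_def mult_zero_left)
    finally show ?case by simp
  next
    case (insert k S)
    let ?u = "\<lambda>l. if l \<in> S then u l else 0"
    have k: "k \<in> idx s" and uS: "?u \<in> F_space r s" using insert.prems by (auto simp: F_space_def)
    have ku: "fscale (u k) (unit_vec k) \<in> F_space r s"
      using unit_vec_in_F_space[OF k] by (auto simp: F_space_def fscale_def)
    have "(\<lambda>l. if l \<in> insert k S then u l else 0) = fscale (u k) (unit_vec k) + ?u"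
      by (rule ext) (use insert.hyps in \<open>auto simp: fscale_def unit_vec_def\<close>)
    then have "T (\<lambda>l. if l \<in> insert k S then u l else 0) x = T (fscale (u k) (unit_vec k)) x + T ?u x"
      by (simp only: bspec[OF bspec[OF add ku] uS] plus_fun_apply)
    also have "T (fscale (u k) (unit_vec k)) x = u k * T (unit_vec k) x"
      unfolding bspec[OF spec[OF scale] unit_vec_in_F_space[OF k]] by (simp only: fscale_def)
    also have "T ?u x = (\<Sum>k\<in>S. u k * T (unit_vec k) x)" using insert.IH insert.prems by simp
    finally show ?case by (simp only: sum.insert[OF insert.hyps])
  qed
  have "(\<lambda>l. if l \<in> idx s then u l else 0) = u" using u by (auto simp: F_space_def)
  then show ?thesis using expand[OF finite_idx subset_refl] by (simp only:)
qed

definition ext0 :: "(nat \<Rightarrow> nat) \<Rightarrow> nat \<Rightarrow> nat" where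
  "ext0 s i = (if i \<in> {1..r} then s i else 0)"

lemma supported_ext0: "supported (ext0 s)"
  by (simp add: supported_def ext0_def)

lemma umon_in_mons:
  assumes "k \<in> idx s"
  shows "umon s k \<in> mons (\<lambda>_. 0) (ext0 s)"
  unfolding mons_def mem_Collect_eq
proof (intro conjI allI)
  fix i
  show "int (degX i (umon s k)) = 0" by (simp add: degX_def lookup_umon)
  show "degU i (umon s k) = ext0 s i"
    using idxD[OF assms, of i] by (simp add: degU_def lookup_umon ext0_def)
qed

text \<open>Monomials in the \<open>U\<close> variables are constants for an operator whose symbol
  involves \<open>X\<close> variables only.\<close>

lemma pd_umon_mult:
  assumes p: "xonly p" and \<mu>: "keys \<mu> \<inter> xvars = {}"
  shows "pd p (single \<mu> 1 * q) = single \<mu> 1 * pd p q"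
  using p
proof (induction arbitrary: q rule: xonly_induct)
  case (Const c)
  show ?case by (simp add: mult.left_commute)
next
  case (mult p v)
  have "dv v (single \<mu> 1) = 0"
  proof (rule poly_mapping_eqI)
    fix \<gamma>
    have "\<mu> \<noteq> \<gamma> + single v 1"
    proof
      assume "\<mu> = \<gamma> + single v 1"
      then have "v \<in> keys \<mu>" by (simp add: in_keys_iff lookup_add)
      then show False using \<mu> mult(2) by blast
    qed
    then show "lookup (dv v (single \<mu> 1)) \<gamma> = lookup 0 \<gamma>"
      by (simp add: lookup_dv lookup_single when_def)
  qed
  then have "dv v (single \<mu> 1 * q) = single \<mu> 1 * dv v q"
    by (simp add: derivationD(2)[OF derivation_dv])
  then show ?case by (simp add: pd_mult mult.IH)
next
  case (add p q)
  then show ?case by (simp add: pd_add_left distrib_left)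
qed

lemma keys_umon: "keys (umon s k) \<inter> xvars = {}"
proof -
  have "v \<notin> xvars" if "v \<in> keys (umon s k)" for v
    using that by (cases v) (auto simp: in_keys_iff lookup_umon)
  then show ?thesis by blast
qed

lemma U_decomposition:
  assumes "p \<in> hom_space n (ext0 s)"
  shows "\<exists>Q. (\<forall>k\<in>idx s. Q k \<in> hom_space n (\<lambda>_. 0)) \<and> p = (\<Sum>k\<in>idx s. single (umon s k) 1 * Q k)"
proof -
  define S where "S = {p. \<exists>Q. (\<forall>k\<in>idx s. Q k \<in> hom_space n (\<lambda>_. 0)) \<and> p = (\<Sum>k\<in>idx s. single (umon s k) 1 * Q k)}"
  have S0: "0 \<in> S"
    unfolding S_def by (intro CollectI exI[of _ "\<lambda>_. 0"]) (simp add: P.V.subspace_0[OF subspace_hom_space])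
  have S_add: "p + q \<in> S" if pq: "p \<in> S" "q \<in> S" for p q
  proof -
    obtain Q Q' where "\<forall>k\<in>idx s. Q k \<in> hom_space n (\<lambda>_. 0)" "p = (\<Sum>k\<in>idx s. single (umon s k) 1 * Q k)"
      "\<forall>k\<in>idx s. Q' k \<in> hom_space n (\<lambda>_. 0)" "q = (\<Sum>k\<in>idx s. single (umon s k) 1 * Q' k)"
      using pq unfolding S_def by blast
    then show ?thesis
      unfolding S_def by (intro CollectI exI[of _ "\<lambda>k. Q k + Q' k"])
        (simp add: P.V.subspace_add[OF subspace_hom_space] distrib_left sum.distrib)
  qed
  have S_single: "single \<alpha> c \<in> S" if \<alpha>: "\<alpha> \<in> mons n (ext0 s)" for \<alpha> c
  proof -
    define k where "k = (\<lambda>i\<in>{1..r}. lookup \<alpha> (U i 2))"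
    have dU: "lookup \<alpha> (U i 1) + lookup \<alpha> (U i 2) = ext0 s i" for i
      using \<alpha> by (simp add: mons_def degU_def)
    have "lookup \<alpha> (U i 2) \<le> s i" if "i \<in> {1..r}" for i
      using dU[of i] that by (simp add: ext0_def del: atLeastAtMost_iff)
    then have k: "k \<in> idx s"
      unfolding k_def tensor_index_def by (intro restrict_PiE_iff[THEN iffD2]) simp
    define \<beta> where "\<beta> = \<alpha> - umon s k"
    have le: "lookup (umon s k) v \<le> lookup \<alpha> v" for v
    proof (cases v)
      case (U i a)
      then show ?thesis
        using exhaust_2[of a] dU[of i] by (auto simp: lookup_umon k_def ext0_def)
    qed (simp add: lookup_umon)
    have "\<alpha> = umon s k + \<beta>"
      using le by (intro poly_mapping_eqI) (simp add: \<beta>_def lookup_add lookup_minus)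
    moreover from this have "\<beta> \<in> mons n (\<lambda>_. 0)"
    proof -
      have "degX i \<alpha> = degX i \<beta>" for i
        using umon_in_mons[OF k] \<open>\<alpha> = umon s k + \<beta>\<close> by (simp add: mons_def)
      moreover have "degU i \<beta> = 0" for i
      proof -
        have "degU i (umon s k) = ext0 s i" "degU i \<alpha> = ext0 s i"
          using umon_in_mons[OF k] \<alpha> by (simp_all add: mons_def)
        then show ?thesis using \<open>\<alpha> = umon s k + \<beta>\<close> by simp
      qed
      ultimately show ?thesis using \<alpha> by (simp add: mons_def)
    qed
    ultimately have e: "single \<alpha> c = single (umon s k) 1 * single \<beta> c" "single \<beta> c \<in> hom_space n (\<lambda>_. 0)"
      by (simp_all add: mult_single single_in_hom_space)
    have "(\<Sum>l\<in>idx s. single (umon s l) 1 * (if l = k then single \<beta> c else 0))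
        = (\<Sum>l\<in>idx s. if l = k then single \<alpha> c else 0)"
      by (rule sum.cong[OF refl]) (simp add: e(1))
    also have "\<dots> = single \<alpha> c" using k finite_idx by simp
    finally show ?thesis
      unfolding S_def using e(2)
      by (intro CollectI exI[of _ "\<lambda>l. if l = k then single \<beta> c else 0"])
        (simp add: P.V.subspace_0[OF subspace_hom_space])
  qed
  have "(\<Sum>\<alpha>\<in>A. single \<alpha> (lookup p \<alpha>)) \<in> S" if "finite A" "A \<subseteq> keys p" for A
    using that
  proof (induction A)
    case empty
    then show ?case using S0 by simp
  next
    case (insert \<alpha> A)
    then have "single \<alpha> (lookup p \<alpha>) \<in> S"
      using assms by (intro S_single) (auto simp: hom_space_def)
    then show ?case using insert S_add by simp
  qed
  from this[of "keys p"] have "p \<in> S" by (simp only: pol_sum_single[symmetric] finite_keys)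
  then show ?thesis by (simp add: S_def)
qed

lemma Harm_deg_iff:
  "f \<in> Harm_deg G r n \<longleftrightarrow> (\<exists>q. q \<in> hom_space (int_ext n) (\<lambda>_. 0) \<and> pd trace_poly q = 0 \<and> pd det_poly q = 0 \<and> f = evX q)"
proof
  assume "f \<in> Harm_deg G r n"
  then obtain q where q: "q \<in> hom_space (int_ext n) (\<lambda>_. 0)" "f = evX q" "f \<in> Harm G r"
    unfolding Harm_deg_def CV_deg_eq by blast
  then show "\<exists>q. q \<in> hom_space (int_ext n) (\<lambda>_. 0) \<and> pd trace_poly q = 0 \<and> pd det_poly q = 0 \<and> f = evX q"
    using Harm_iff[OF hom_space_xonly[OF supported_int_ext q(1)]] by blast
next
  assume "\<exists>q. q \<in> hom_space (int_ext n) (\<lambda>_. 0) \<and> pd trace_poly q = 0 \<and> pd det_poly q = 0 \<and> f = evX q"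
  then obtain q where q: "q \<in> hom_space (int_ext n) (\<lambda>_. 0)" "pd trace_poly q = 0" "pd det_poly q = 0" "f = evX q" by blast
  then show "f \<in> Harm_deg G r n"
    unfolding Harm_deg_def CV_deg_eq using Harm_iff[OF hom_space_xonly[OF supported_int_ext q(1)]] by blast
qed

lemma subspace_Harm_deg: "F.subspace (Harm_deg G r n)"
proof (rule F.subspaceI)
  show "0 \<in> Harm_deg G r n"
    unfolding Harm_deg_iff using P.V.subspace_0[OF subspace_hom_space]
    by (intro exI[of _ 0]) (simp add: evX_0)
next
  fix f g assume "f \<in> Harm_deg G r n" "g \<in> Harm_deg G r n"
  then obtain p q where "p \<in> hom_space (int_ext n) (\<lambda>_. 0)" "pd trace_poly p = 0" "pd det_poly p = 0" "f = evX p"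
    "q \<in> hom_space (int_ext n) (\<lambda>_. 0)" "pd trace_poly q = 0" "pd det_poly q = 0" "g = evX q"
    unfolding Harm_deg_iff by blast
  then show "f + g \<in> Harm_deg G r n"
    unfolding Harm_deg_iff
    by (intro exI[of _ "p + q"]) (simp add: P.V.subspace_add[OF subspace_hom_space] pd_add_right evX_add)
next
  fix c f assume "f \<in> Harm_deg G r n"
  then obtain p where "p \<in> hom_space (int_ext n) (\<lambda>_. 0)" "pd trace_poly p = 0" "pd det_poly p = 0" "f = evX p"
    unfolding Harm_deg_iff by blast
  then show "fscale c f \<in> Harm_deg G r n"
    unfolding Harm_deg_iff
    by (intro exI[of _ "Const c * p"])
      (simp add: P.V.subspace_scale[OF subspace_hom_space, unfolded pscale_def] pd_Const_mult_right evX_Const_mult)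
qed

definition scalars :: "group_type \<Rightarrow> (nat \<Rightarrow> complex) \<Rightarrow> nat \<Rightarrow> complex" where
  "scalars G w i = (case G of GL_power \<Rightarrow> w i
     | S_GL_power \<Rightarrow> if i = r then (\<Prod>j\<in>{1..r-1}. inverse (w j)) else w i)"

lemma phi_eq: "phi G r (w, g) = (\<lambda>i. mat (scalars G w i) ** g i)"
  by (cases G) (simp_all add: scalars_def)

lemma scalars_nonzero:
  assumes "(w, g) \<in> K_tilde G r" "i \<in> {1..r}"
  shows "scalars G w i \<noteq> 0"
  using assms by (cases G) (auto simp: scalars_def K_tilde_def)

lemma evX_scale:
  assumes q: "q \<in> hom_space (int_ext n) (\<lambda>_. 0)"
  shows "evX q (\<lambda>i. mat (c i) ** x i) = (\<Prod>i\<in>{1..r}. c i ^ n i) * evX q x"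
proof -
  define c' where "c' w = (case w of X i a b \<Rightarrow> c i | U i a \<Rightarrow> 1)" for w
  have "point (\<lambda>i. mat (c i) ** x i) (\<lambda>_. 0) w = c' w * point x (\<lambda>_. 0) w" for w
  proof (cases w)
    case (X i a b)
    then show ?thesis
      using exhaust_2[of a] by (elim disjE) (simp_all add: c'_def matrix_mult_2, simp_all add: mat_def)
  qed (simp add: c'_def)
  then have pt: "point (\<lambda>i. mat (c i) ** x i) (\<lambda>_. 0) = (\<lambda>w. c' w * point x (\<lambda>_. 0) w)" by blast
  have m: "mev (\<lambda>w. c' w * y w) \<alpha> = (\<Prod>i\<in>{1..r}. c i ^ n i) * mev y \<alpha>" if \<alpha>: "\<alpha> \<in> keys q" for y \<alpha>
  proof -
    have "keys \<alpha> \<subseteq> xvars" using hom_space_xonly[OF supported_int_ext q] \<alpha> by (simp add: xonly_def)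
    then have "mev c' \<alpha> = mev c' (exponent_mon (\<lambda>i a b. lookup \<alpha> (X i a b)))"
      by (simp only: exponent_mon_lookup)
    also have "\<dots> = (\<Prod>i\<in>{1..r}. \<Prod>a\<in>UNIV. \<Prod>b\<in>UNIV. c' (X i a b) ^ lookup \<alpha> (X i a b))"
      by (simp add: exponent_mon_def mev_sum)
    also have "\<dots> = (\<Prod>i\<in>{1..r}. c i ^ n i)"
    proof (rule prod.cong[OF refl])
      fix i assume i: "i \<in> {1..r}"
      have "\<alpha> \<in> mons (int_ext n) (\<lambda>_. 0)" using q \<alpha> by (auto simp: hom_space_def)
      then have "int (degX i \<alpha>) = int (n i)" using i by (simp add: mons_def int_ext_def del: atLeastAtMost_iff)
      then have "n i = degX i \<alpha>" by simp
      then show "(\<Prod>a\<in>UNIV. \<Prod>b\<in>UNIV. c' (X i a b) ^ lookup \<alpha> (X i a b)) = c i ^ n i"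
        by (simp add: c'_def UNIV_2 degX_def power_add mult_ac)
    qed
    finally have "mev c' \<alpha> = (\<Prod>i\<in>{1..r}. c i ^ n i)" .
    moreover have "mev (\<lambda>w. c' w * y w) \<alpha> = mev c' \<alpha> * mev y \<alpha>"
      by (simp add: mev_def power_mult_distrib prod.distrib)
    ultimately show ?thesis by simp
  qed
  show ?thesis
    unfolding evX_def pt ev_def sum_distrib_left
    by (rule sum.cong[OF refl]) (simp add: m mult_ac)
qed

text \<open>The character by which the scalars of the covering group act on polynomials of degree
  \<open>n\<close>. The quotient appears in this order because the action on functions uses the
  inverse element.\<close>

definition degree_char :: "group_type \<Rightarrow> (nat \<Rightarrow> nat) \<Rightarrow> (nat \<Rightarrow> complex) \<Rightarrow> complex" where
  "degree_char G n w = (\<Prod>i\<in>{1..r}. (scalars G w (nxt r i) / scalars G w i) ^ n i)"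

lemma act_phi_evX:
  assumes h: "(w, g) \<in> K_tilde G r" and q: "q \<in> hom_space (int_ext n) (\<lambda>_. 0)"
  shows "act r (phi G r (w, g)) (evX q) x = degree_char G n w * evX q (act_V r (inv_tuple g) x)"
proof -
  let ?c = "\<lambda>i. scalars G w (nxt r i) / scalars G w i"
  have "evX q (act_V r (inv_tuple (phi G r (w, g))) x) = evX q (\<lambda>i. mat (?c i) ** act_V r (inv_tuple g) x i)"
  proof (rule evX_cong[OF hom_space_xonly[OF supported_int_ext q]])
    fix i assume i: "i \<in> {1..r}"
    have n: "nxt r i \<in> {1..r}" by (rule nxt_in[OF i])
    have inv: "invertible (g j)" if "j \<in> {1..r}" for j
      using h that by (auto simp: K_tilde_def intro: invertible_det_1)
    have si: "scalars G w i \<noteq> 0" and sn: "scalars G w (nxt r i) \<noteq> 0"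
      using scalars_nonzero[OF h] i n by blast+
    have "act_V r (inv_tuple (phi G r (w, g))) x i
        = (mat (inverse (scalars G w i)) ** matrix_inv (g i)) ** x i ** (mat (scalars G w (nxt r i)) ** g (nxt r i))"
      by (simp add: act_V_def inv_tuple_def phi_eq matrix_inv_matrix_inv invertible_scalar_mult inv i n si sn
          matrix_inv_scalar_mult invertible_matrix_inv del: atLeastAtMost_iff)
    also have "\<dots> = mat (?c i) ** (matrix_inv (g i) ** x i ** g (nxt r i))"
      using si by (simp add: matrix_eq_2 matrix_mult_2 mat_def field_simps)
    finally show "act_V r (inv_tuple (phi G r (w, g))) x i = mat (?c i) ** act_V r (inv_tuple g) x i"
      by (simp add: act_V_def inv_tuple_def matrix_inv_matrix_inv inv n del: atLeastAtMost_iff)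
  qed
  also have "\<dots> = degree_char G n w * evX q (act_V r (inv_tuple g) x)"
    unfolding degree_char_def by (rule evX_scale[OF q])
  finally show ?thesis by (simp add: act_def)
qed

text \<open>Intertwining maps and harmonic invariants both embed linearly into functions of
  \<open>(x, v)\<close>. Once \<open>Hom\<close> is nonzero the images coincide, and dimensions are
  compared there.\<close>

definition to_fun :: "(nat \<Rightarrow> nat) \<Rightarrow> (((nat \<Rightarrow> nat) \<Rightarrow> complex) \<Rightarrow> tuple \<Rightarrow> complex)
    \<Rightarrow> tuple \<times> (nat \<Rightarrow> complex^2) \<Rightarrow> complex" where
  "to_fun s T = (\<lambda>(x, v). T (power_vec s v) x)"

definition pol_fun :: "var pol \<Rightarrow> tuple \<times> (nat \<Rightarrow> complex^2) \<Rightarrow> complex" where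
  "pol_fun p = (\<lambda>(x, v). ev (point x v) p)"

lemma linear_to_fun: "Vector_Spaces.linear hscale fscale (to_fun s)"
  unfolding Vector_Spaces.linear_iff
  by (simp add: vector_space_hscale vector_space_fscale to_fun_def hscale_def fscale_def fun_eq_iff)

lemma linear_pol_fun: "Vector_Spaces.linear pscale fscale pol_fun"
  unfolding Vector_Spaces.linear_iff
  by (simp add: vector_space_pscale vector_space_fscale pol_fun_def pscale_def fscale_def fun_eq_iff)

lemma pol_fun_inj: "pol_fun p = pol_fun q \<Longrightarrow> p = q"
proof (rule pol_eqI_ev)
  fix y assume eq: "pol_fun p = pol_fun q"
  obtain x v where "y = point x v" using point_surj by blast
  then show "ev y p = ev y q" using fun_cong[OF eq, of "(x, v)"] by (simp add: pol_fun_def)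
qed

context
  fixes G :: group_type and z :: "nat \<Rightarrow> int" and s n :: "nat \<Rightarrow> nat"
begin

abbreviation "Hom \<equiv> Hom_K G r z s n"

lemma Hom_expand: "T \<in> Hom \<Longrightarrow> u \<in> F_space r s \<Longrightarrow> T u x = (\<Sum>k\<in>idx s. u k * T (unit_vec k) x)"
  unfolding Hom_K_def by (rule linear_on_F_space) blast+

lemma Hom_eqI:
  assumes T: "T \<in> Hom" "T' \<in> Hom" and eq: "to_fun s T = to_fun s T'"
  shows "T = T'"
proof (intro ext)
  fix u x
  show "T u x = T' u x"
  proof (cases "u \<in> F_space r s")
    case True
    have "T (unit_vec k) x - T' (unit_vec k) x = 0" if "k \<in> idx s" for k
    proof (rule power_vec_separating[OF _ that])
      fix v
      have "T (power_vec s v) x = T' (power_vec s v) x"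
        using fun_cong[OF eq, of "(x, v)"] by (simp add: to_fun_def)
      then show "(\<Sum>k\<in>idx s. power_vec s v k * (T (unit_vec k) x - T' (unit_vec k) x)) = 0"
        using Hom_expand[OF T(1) power_vec_in_F_space, of v x] Hom_expand[OF T(2) power_vec_in_F_space, of v x]
        by (simp add: right_diff_distrib sum_subtractf)
    qed
    then show ?thesis
      unfolding Hom_expand[OF T(1) True] Hom_expand[OF T(2) True] by (intro sum.cong) simp_all
  next
    case False
    then show ?thesis using T by (simp add: Hom_K_def)
  qed
qed

lemma Hom_power_vec:
  assumes T: "T \<in> Hom" and h: "(w, g) \<in> K_tilde G r"
  shows "(\<Prod>j\<in>{1..ell G r}. w j powi z j) * T (power_vec s (act_U g v)) x
    = degree_char G n w * T (power_vec s v) (act_V r (inv_tuple g) x)"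
proof -
  have "T (F_act G r z s (w, g) (power_vec s v)) x = act r (phi G r (w, g)) (T (power_vec s v)) x"
    using T h power_vec_in_F_space unfolding Hom_K_def by simp
  moreover have "T (F_act G r z s (w, g) (power_vec s v)) x = (\<Prod>j\<in>{1..ell G r}. w j powi z j) * T (power_vec s (act_U g v)) x"
    using T power_vec_in_F_space unfolding F_act_power_vec Hom_K_def by (simp add: fscale_def)
  moreover obtain q where "q \<in> hom_space (int_ext n) (\<lambda>_. 0)" "T (power_vec s v) = evX q"
    using T power_vec_in_F_space[of s v] Harm_deg_iff[of "T (power_vec s v)" G n] unfolding Hom_K_def by blast
  ultimately show ?thesis using act_phi_evX[OF h] by simp
qed

lemma act_V_inverse:
  assumes "\<forall>i\<in>{1..r}. invertible (g i)" "i \<in> {1..r}"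
  shows "act_V r (inv_tuple g) (act_V r g x) i = x i"
proof -
  have gi: "invertible (g i)" and gn: "invertible (g (nxt r i))" using assms nxt_in by blast+
  have "matrix_inv (g i) ** (g i ** x i ** matrix_inv (g (nxt r i))) ** g (nxt r i)
      = (matrix_inv (g i) ** g i) ** x i ** (matrix_inv (g (nxt r i)) ** g (nxt r i))"
    by (simp only: matrix_mul_assoc)
  then show ?thesis
    by (simp add: act_V_def inv_tuple_def matrix_inv_matrix_inv[OF gn] matrix_inv_left[OF gi] matrix_inv_left[OF gn])
qed

text \<open>The coordinates of a power vector are monomials in \<open>v\<close> with coefficients
  \<open>binom_prod s k\<close>. Substituting for each \<open>unit_vec k\<close> a polynomial
  representing its image assembles one polynomial in \<open>x\<close> and \<open>v\<close>.\<close>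

lemma Hom_to_pol:
  assumes T: "T \<in> Hom"
  shows "to_fun s T \<in> pol_fun ` harm_space (int_ext n) (ext0 s)"
proof -
  have "\<forall>k\<in>idx s. \<exists>q. q \<in> hom_space (int_ext n) (\<lambda>_. 0) \<and> pd trace_poly q = 0 \<and> pd det_poly q = 0 \<and> T (unit_vec k) = evX q"
  proof
    fix k assume "k \<in> idx s"
    then have "T (unit_vec k) \<in> Harm_deg G r n"
      using T unit_vec_in_F_space unfolding Hom_K_def by blast
    then show "\<exists>q. q \<in> hom_space (int_ext n) (\<lambda>_. 0) \<and> pd trace_poly q = 0 \<and> pd det_poly q = 0 \<and> T (unit_vec k) = evX q"
      unfolding Harm_deg_iff .
  qed
  then obtain Q where Q: "\<And>k. k \<in> idx s \<Longrightarrow> Q k \<in> hom_space (int_ext n) (\<lambda>_. 0)"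
    "\<And>k. k \<in> idx s \<Longrightarrow> pd trace_poly (Q k) = 0" "\<And>k. k \<in> idx s \<Longrightarrow> pd det_poly (Q k) = 0"
    "\<And>k. k \<in> idx s \<Longrightarrow> T (unit_vec k) = evX (Q k)"
    by metis
  define p where "p = (\<Sum>k\<in>idx s. Const (binom_prod s k) * (single (umon s k) 1 * Q k))"
  have ev_p: "ev (point x v) p = T (power_vec s v) x" for x v
  proof -
    have "ev (point x v) p = (\<Sum>k\<in>idx s. power_vec s v k * T (unit_vec k) x)"
      unfolding p_def ev_sum
    proof (rule sum.cong[OF refl])
      fix k assume k: "k \<in> idx s"
      show "ev (point x v) (Const (binom_prod s k) * (single (umon s k) 1 * Q k)) = power_vec s v k * T (unit_vec k) x"
        using ev_xonly[OF hom_space_xonly[OF supported_int_ext Q(1)[OF k]], of x v]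
        by (simp add: power_vec_eq[OF k, of v x] Q(4)[OF k])
    qed
    then show ?thesis by (simp add: Hom_expand[OF T power_vec_in_F_space])
  qed
  have p_hom: "p \<in> hom_space (int_ext n) (ext0 s)"
    unfolding p_def
  proof (rule P.V.subspace_sum[OF subspace_hom_space])
    fix k assume k: "k \<in> idx s"
    have "single (umon s k) 1 * Q k \<in> hom_space (int_ext n) (ext0 s)"
      using hom_space_mult[OF single_in_hom_space[OF umon_in_mons[OF k], of 1] Q(1)[OF k]] by simp
    then show "Const (binom_prod s k) * (single (umon s k) 1 * Q k) \<in> hom_space (int_ext n) (ext0 s)"
      by (rule P.V.subspace_scale[OF subspace_hom_space, unfolded pscale_def])
  qed
  have "pd trace_poly p = 0" "pd det_poly p = 0"
    unfolding p_def pd_sum_right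
    by (rule sum.neutral, simp add: pd_Const_mult_right pd_umon_mult trace_poly_xonly det_poly_xonly keys_umon Q)+
  moreover have "SL_invariant r p"
    unfolding SL_invariant_def fixed_by_def
  proof (intro allI impI)
    fix g x v assume g: "\<forall>i\<in>{1..r}. det (g i :: complex^2^2) = 1"
    then have gi: "\<forall>i\<in>{1..r}. invertible (g i)" by (simp add: invertible_det_1)
    \<comment> \<open>With trivial scalars both characters are 1 and only SL_2^r is left.\<close>
    let ?w = "\<lambda>_. 1 :: complex"
    have one: "scalars G ?w i = 1" for i by (cases G) (simp_all add: scalars_def)
    have "(?w, g) \<in> K_tilde G r" using g by (simp add: K_tilde_def)
    from Hom_power_vec[OF T this, of v "act_V r g x"]
    have "T (power_vec s (act_U g v)) (act_V r g x) = T (power_vec s v) (act_V r (inv_tuple g) (act_V r g x))"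
      by (simp add: degree_char_def one)
    moreover have "T (power_vec s v) (act_V r (inv_tuple g) (act_V r g x)) = T (power_vec s v) x"
    proof -
      obtain q where q: "q \<in> hom_space (int_ext n) (\<lambda>_. 0)" "T (power_vec s v) = evX q"
        using T power_vec_in_F_space[of s v] Harm_deg_iff[of "T (power_vec s v)" G n] unfolding Hom_K_def by blast
      show ?thesis
        unfolding q(2) by (rule evX_cong[OF hom_space_xonly[OF supported_int_ext q(1)]]) (rule act_V_inverse[OF gi])
    qed
    ultimately show "ev (point (act_V r g x) (act_U g v)) p = ev (point x v) p"
      by (simp only: ev_p)
  qed
  then have "root_op i a b p = 0" if "i \<in> {1..r}" "a \<noteq> b" for i a b
    using root_op_eq_0_if_SL_invariant[OF hom_space_in_range[OF supported_int_ext supported_ext0 p_hom]] that by blast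
  ultimately have "p \<in> harm_space (int_ext n) (ext0 s)"
    using p_hom by (simp add: harm_space_def inv_space_def)
  moreover have "to_fun s T = pol_fun p"
    by (simp add: to_fun_def pol_fun_def fun_eq_iff ev_p)
  ultimately show ?thesis by blast
qed

text \<open>The coefficient of \<open>p\<close> at \<open>umon s k\<close>, divided by
  \<open>binom_prod s k\<close>, serves as the image of \<open>unit_vec k\<close>. Scalars are
  handled by the hypothesis on the characters, SL_2^r by the invariance of \<open>p\<close>.\<close>

lemma pol_to_Hom:
  assumes char: "\<And>w g. (w, g) \<in> K_tilde G r \<Longrightarrow> (\<Prod>j\<in>{1..ell G r}. w j powi z j) = degree_char G n w"
    and p: "p \<in> harm_space (int_ext n) (ext0 s)"
  shows "\<exists>T\<in>Hom. to_fun s T = pol_fun p"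
proof -
  have p_hom: "p \<in> hom_space (int_ext n) (ext0 s)" using p by (simp add: harm_space_def inv_space_def)
  obtain Q where Q: "\<And>k. k \<in> idx s \<Longrightarrow> Q k \<in> hom_space (int_ext n) (\<lambda>_. 0)"
    and pQ: "p = (\<Sum>k\<in>idx s. single (umon s k) 1 * Q k)"
    using U_decomposition[OF p_hom] by blast
  have Qx: "xonly (Q k)" if "k \<in> idx s" for k by (rule hom_space_xonly[OF supported_int_ext Q[OF that]])
  have pdQ: "pd t (Q k) = 0" if t: "xonly t" "pd t p = 0" and k: "k \<in> idx s" for t k
  proof -
    have zero: "(\<Sum>k\<in>idx s. single (umon s k) 1 * pd t (Q k)) = 0"
      using t(2) unfolding pQ pd_sum_right by (simp add: pd_umon_mult[OF t(1) keys_umon])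
    have "evX (pd t (Q k)) x / binom_prod s k = 0" for x
    proof (rule power_vec_separating[OF _ k])
      fix v
      have "(\<Sum>k\<in>idx s. power_vec s v k * (evX (pd t (Q k)) x / binom_prod s k))
          = ev (point x v) (\<Sum>k\<in>idx s. single (umon s k) 1 * pd t (Q k))"
        unfolding ev_sum
      proof (rule sum.cong[OF refl])
        fix k assume k: "k \<in> idx s"
        show "power_vec s v k * (evX (pd t (Q k)) x / binom_prod s k) = ev (point x v) (single (umon s k) 1 * pd t (Q k))"
          using binom_prod_nonzero[OF k]
          by (simp add: power_vec_eq[OF k, of v x] ev_xonly[OF xonly_pd[OF Qx[OF k]]])
      qed
      then show "(\<Sum>k\<in>idx s. power_vec s v k * (evX (pd t (Q k)) x / binom_prod s k)) = 0"
        by (simp only: zero ev_0)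
    qed
    then have "evX (pd t (Q k)) x = 0" for x using binom_prod_nonzero[OF k] by simp
    then have "evX (pd t (Q k)) = evX 0" by (simp add: evX_0 fun_eq_iff)
    then show ?thesis by (rule evX_inj[OF xonly_pd[OF Qx[OF k]] xonly_0])
  qed
  have Q_harm: "pd trace_poly (Q k) = 0" "pd det_poly (Q k) = 0" if "k \<in> idx s" for k
    using p that by (auto intro!: pdQ trace_poly_xonly det_poly_xonly simp: harm_space_def)
  define q where "q u = (\<Sum>k\<in>idx s. Const (u k / binom_prod s k) * Q k)" for u
  define T where "T u = (if u \<in> F_space r s then evX (q u) else 0)" for u
  have q_hom: "q u \<in> hom_space (int_ext n) (\<lambda>_. 0)" for u
    unfolding q_def
    by (intro P.V.subspace_sum[OF subspace_hom_space] P.V.subspace_scale[OF subspace_hom_space, unfolded pscale_def] Q)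
  have evX_q: "evX (q u) x = (\<Sum>k\<in>idx s. u k * (evX (Q k) x / binom_prod s k))" for u x
    by (simp add: q_def evX_def)
  have T_power: "T (power_vec s v) x = ev (point x v) p" for v x
  proof -
    have "T (power_vec s v) x = (\<Sum>k\<in>idx s. power_vec s v k * (evX (Q k) x / binom_prod s k))"
      by (simp add: T_def power_vec_in_F_space evX_q)
    also have "\<dots> = ev (point x v) p"
      unfolding pQ ev_sum
    proof (rule sum.cong[OF refl])
      fix k assume k: "k \<in> idx s"
      show "power_vec s v k * (evX (Q k) x / binom_prod s k) = ev (point x v) (single (umon s k) 1 * Q k)"
        using binom_prod_nonzero[OF k] by (simp add: power_vec_eq[OF k, of v x] ev_xonly[OF Qx[OF k]])
    qed
    finally show ?thesis .
  qed
  have inv: "ev (point (act_V r g x) (act_U g v)) p = ev (point x v) p" if "\<forall>i\<in>{1..r}. det (g i) = 1" for g x v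
  proof -
    have "SL_invariant r p"
      using p by (intro SL_invariant_if_root_op_eq_0 hom_space_in_range[OF supported_int_ext supported_ext0 p_hom])
        (simp add: harm_space_def inv_space_def)
    then show ?thesis using that by (simp add: SL_invariant_def fixed_by_def)
  qed
  have F_closed: "F_act G r z s h u \<in> F_space r s" for h u
    by (cases h) (simp add: F_space_def F_act_def)
  have equi: "T (F_act G r z s (w, g) u) x = act r (phi G r (w, g)) (T u) x"
    if h: "(w, g) \<in> K_tilde G r" and u: "u \<in> F_space r s" for w g u x
  proof -
    let ?y = "act_V r (inv_tuple g) x"
    define A where "A k l = (\<Prod>j\<in>{1..ell G r}. w j powi z j) * (\<Prod>i\<in>{1..r}. sym_pow (s i) (g i) (k i) (l i))" for k l
    define t where "t x k = evX (Q k) x / binom_prod s k" for x k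
    have F: "F_act G r z s (w, g) u k = (\<Sum>l\<in>idx s. A k l * u l)" if "k \<in> idx s" for u k
      using that by (simp add: F_act_def A_def sum_distrib_left mult.assoc)
    have lhs: "T (F_act G r z s (w, g) u) x = (\<Sum>l\<in>idx s. u l * (\<Sum>k\<in>idx s. A k l * t x k))" for u
    proof -
      have "T (F_act G r z s (w, g) u) x = (\<Sum>k\<in>idx s. F_act G r z s (w, g) u k * t x k)"
        by (simp add: T_def F_closed evX_q t_def)
      also have "\<dots> = (\<Sum>k\<in>idx s. \<Sum>l\<in>idx s. u l * (A k l * t x k))"
        by (rule sum.cong[OF refl]) (simp add: F sum_distrib_left sum_distrib_right mult.commute mult.left_commute)
      also have "\<dots> = (\<Sum>l\<in>idx s. \<Sum>k\<in>idx s. u l * (A k l * t x k))"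
        by (rule sum.swap)
      finally show ?thesis by (simp add: sum_distrib_left)
    qed
    have rhs: "act r (phi G r (w, g)) (T u) x = (\<Sum>l\<in>idx s. u l * (degree_char G n w * t ?y l))" if "u \<in> F_space r s" for u
    proof -
      have "act r (phi G r (w, g)) (T u) x = degree_char G n w * evX (q u) ?y"
        using act_phi_evX[OF h q_hom] that by (simp add: T_def)
      then show ?thesis by (simp add: evX_q t_def sum_distrib_left mult_ac)
    qed
    have gi: "\<forall>i\<in>{1..r}. invertible (inv_tuple g i)"
      using h by (simp add: K_tilde_def inv_tuple_def invertible_matrix_inv invertible_det_1)
    have g1: "\<forall>i\<in>{1..r}. invertible (g i)" "\<forall>i\<in>{1..r}. det (g i) = 1"
      using h by (auto simp: K_tilde_def intro!: invertible_det_1)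
    \<comment> \<open>Equivariance is an identity of linear functionals in \<open>u\<close>, so it
      may be tested on power vectors, where it expresses the invariance of \<open>p\<close>.\<close>
    have "(\<Sum>k\<in>idx s. A k l * t x k) - degree_char G n w * t ?y l = 0" if l: "l \<in> idx s" for l
    proof (rule power_vec_separating[OF _ l])
      fix v
      have "T (F_act G r z s (w, g) (power_vec s v)) x = degree_char G n w * T (power_vec s (act_U g v)) x"
        unfolding F_act_power_vec char[OF h]
        by (simp add: T_def power_vec_in_F_space evX_q)
          (simp add: fscale_def F_space_def power_vec_def sum_distrib_left mult_ac)
      also have "T (power_vec s (act_U g v)) x = ev (point (act_V r g ?y) (act_U g v)) p"
      proof -
        have "act_V r g ?y i = x i" if i: "i \<in> {1..r}" for i
        proof -
          have "g i = inv_tuple (inv_tuple g) i" "g (nxt r i) = inv_tuple (inv_tuple g) (nxt r i)"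
            using g1(1) i nxt_in[OF i] by (simp_all add: inv_tuple_def matrix_inv_matrix_inv del: atLeastAtMost_iff)
          then have "act_V r g ?y i = act_V r (inv_tuple (inv_tuple g)) ?y i"
            by (simp add: act_V_def)
          then show ?thesis using act_V_inverse[OF gi i] by simp
        qed
        then have "ev (point x (act_U g v)) p = ev (point (act_V r g ?y) (act_U g v)) p"
          by (intro ev_cong_in_range[OF hom_space_in_range[OF supported_int_ext supported_ext0 p_hom]] point_cong) simp_all
        then show ?thesis by (simp only: T_power)
      qed
      also have "\<dots> = T (power_vec s v) ?y"
        using inv[OF g1(2)] by (simp only: T_power)
      also have "degree_char G n w * T (power_vec s v) ?y = act r (phi G r (w, g)) (T (power_vec s v)) x"
        using act_phi_evX[OF h q_hom] by (simp add: T_def power_vec_in_F_space)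
      finally have "(\<Sum>l\<in>idx s. power_vec s v l * (\<Sum>k\<in>idx s. A k l * t x k))
          = (\<Sum>l\<in>idx s. power_vec s v l * (degree_char G n w * t ?y l))"
        unfolding lhs rhs[OF power_vec_in_F_space] .
      then show "(\<Sum>l\<in>idx s. power_vec s v l * ((\<Sum>k\<in>idx s. A k l * t x k) - degree_char G n w * t ?y l)) = 0"
        by (simp add: right_diff_distrib sum_subtractf)
    qed
    then show ?thesis unfolding lhs rhs[OF u] by (intro sum.cong) simp_all
  qed
  have "T \<in> Hom"
    unfolding Hom_K_def
  proof (intro CollectI conjI ballI allI impI)
    fix u assume u: "u \<in> F_space r s"
    have "pd t (q u) = 0" if "\<And>k. k \<in> idx s \<Longrightarrow> pd t (Q k) = 0" for t
      unfolding q_def pd_sum_right by (rule sum.neutral) (simp add: pd_Const_mult_right that)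
    then have "pd trace_poly (q u) = 0" "pd det_poly (q u) = 0" using Q_harm by blast+
    then show "T u \<in> Harm_deg G r n"
      unfolding Harm_deg_iff using u q_hom by (intro exI[of _ "q u"]) (simp add: T_def)
    fix c
    have "fscale c u \<in> F_space r s" using u by (simp add: F_space_def fscale_def)
    then show "T (fscale c u) = fscale c (T u)"
      using u by (simp add: T_def fun_eq_iff evX_q fscale_def sum_distrib_left mult.assoc)
  next
    fix u v assume u: "u \<in> F_space r s" and v: "v \<in> F_space r s"
    then have "u + v \<in> F_space r s" by (simp add: F_space_def)
    then show "T (u + v) = T u + T v"
      using u v by (simp add: T_def fun_eq_iff evX_q distrib_right add_divide_distrib sum.distrib)
  next
    fix h u assume "h \<in> K_tilde G r" "u \<in> F_space r s"
    then show "T (F_act G r z s h u) = act r (phi G r h) (T u)"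
      by (cases h) (simp add: fun_eq_iff equi)
  next
    fix u assume "u \<notin> F_space r s"
    then show "T u = 0" by (simp add: T_def)
  qed
  moreover have "to_fun s T = pol_fun p"
    by (simp add: to_fun_def pol_fun_def fun_eq_iff T_power)
  ultimately show ?thesis by blast
qed

lemma subspace_Hom: "H.subspace Hom"
proof (rule H.subspaceI)
  have act_rules: "act r g (f + f') = act r g f + act r g f'" "act r g (fscale c f) = fscale c (act r g f)"
    "act r g 0 = 0" for g f f' c
    by (simp_all add: act_def fscale_def fun_eq_iff)
  have fs: "fscale c (f + g) = fscale c f + fscale c g" "fscale c (fscale d f) = fscale d (fscale c f)"
    "fscale c 0 = 0" for c d and f g :: "tuple \<Rightarrow> complex"
    by (simp_all add: fscale_def fun_eq_iff algebra_simps)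
  show "0 \<in> Hom"
    using F.subspace_0[OF subspace_Harm_deg] act_rules(3) fs(3) unfolding Hom_K_def by simp
  fix T T' c assume T: "T \<in> Hom"
  show "hscale c T \<in> Hom"
    using T F.subspace_scale[OF subspace_Harm_deg] unfolding Hom_K_def
    by (simp add: hscale_def act_rules fs(1,3) fs(2)[of c])
  assume "T' \<in> Hom"
  with T show "T + T' \<in> Hom"
    using F.subspace_add[OF subspace_Harm_deg] unfolding Hom_K_def
    by (simp add: act_rules fs add_ac)
qed

text \<open>A nonzero map takes a nonzero value on some power vector. Equivariance under scalars at
  that point equates the two characters, and from then on every harmonic invariant comes from an
  intertwining map.\<close>

lemma dim_Hom:
  assumes pos: "dim_Hom_K G r z s n > 0"
  shows "dim_Hom_K G r z s n = P.V.dim (harm_space (int_ext n) (ext0 s))"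
    and "\<not> harm_space (int_ext n) (ext0 s) \<subseteq> {0}"
proof -
  have "\<not> Hom \<subseteq> {0}"
  proof
    assume "Hom \<subseteq> {0}"
    then have "Hom \<subseteq> H.span {}" by simp
    from H.dim_le_card[OF this] have "H.dim Hom = 0" by simp
    then show False using pos by (simp add: dim_Hom_K_def)
  qed
  then obtain T where T: "T \<in> Hom" "T \<noteq> 0" by blast
  have "to_fun s T \<noteq> to_fun s 0"
    using Hom_eqI[OF T(1) H.subspace_0[OF subspace_Hom]] T(2) by blast
  then obtain x v where nz: "T (power_vec s v) x \<noteq> 0" by (auto simp: to_fun_def fun_eq_iff)
  have char: "(\<Prod>j\<in>{1..ell G r}. w j powi z j) = degree_char G n w" if h: "(w, g) \<in> K_tilde G r" for w g
  proof -
    let ?g = "\<lambda>_. mat 1 :: complex^2^2"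
    have "(w, ?g) \<in> K_tilde G r" using h by (simp add: K_tilde_def)
    from Hom_power_vec[OF T(1) this, of v x] nz show ?thesis
      by (simp add: act_U_def act_V_def inv_tuple_def)
  qed
  have img: "to_fun s ` Hom = pol_fun ` harm_space (int_ext n) (ext0 s)"
  proof (intro equalityI subsetI)
    fix f assume "f \<in> to_fun s ` Hom"
    then show "f \<in> pol_fun ` harm_space (int_ext n) (ext0 s)" using Hom_to_pol by blast
  next
    fix f assume "f \<in> pol_fun ` harm_space (int_ext n) (ext0 s)"
    then obtain p where p: "p \<in> harm_space (int_ext n) (ext0 s)" "f = pol_fun p" by blast
    have "\<exists>T\<in>Hom. to_fun s T = pol_fun p" by (rule pol_to_Hom[OF _ p(1)]) (rule char)
    then show "f \<in> to_fun s ` Hom" using p(2) by (metis imageI)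
  qed
  interpret hf: vector_space_pair hscale "fscale :: complex \<Rightarrow> (tuple \<times> (nat \<Rightarrow> complex^2) \<Rightarrow> complex) \<Rightarrow> _"
    unfolding vector_space_pair_def by (simp add: vector_space_hscale vector_space_fscale)
  interpret pf: vector_space_pair pscale "fscale :: complex \<Rightarrow> (tuple \<times> (nat \<Rightarrow> complex^2) \<Rightarrow> complex) \<Rightarrow> _"
    unfolding vector_space_pair_def by (simp add: vector_space_pscale vector_space_fscale)
  have "F.dim (to_fun s ` Hom) = H.dim Hom"
    by (rule hf.dim_inj_image_subspace[OF linear_to_fun _ subspace_Hom]) (auto intro!: inj_onI Hom_eqI)
  moreover have "F.dim (pol_fun ` harm_space (int_ext n) (ext0 s)) = P.V.dim (harm_space (int_ext n) (ext0 s))"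
    by (rule pf.dim_inj_image_subspace[OF linear_pol_fun _ subspace_harm_space]) (auto intro!: inj_onI dest: pol_fun_inj)
  ultimately show dim: "dim_Hom_K G r z s n = P.V.dim (harm_space (int_ext n) (ext0 s))"
    by (simp add: dim_Hom_K_def img)
  show "\<not> harm_space (int_ext n) (ext0 s) \<subseteq> {0}"
  proof
    assume "harm_space (int_ext n) (ext0 s) \<subseteq> {0}"
    then have "P.V.dim (harm_space (int_ext n) (ext0 s)) = 0"
      by (simp add: P.dim_eq_0_iff[OF fin_dim_harm_space[OF supported_int_ext supported_ext0]])
    then show False using pos dim by simp
  qed
qed

lemma harm_points_eq:
  "{m \<in> lattice_points (int_ext n) (ext0 s). (\<exists>i\<in>{1..r}. int (m i) = int_ext n i) \<and> (\<exists>i\<in>{1..r}. m (prev i) + m i = ext0 s i)}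
    = {m \<in> {1..r} \<rightarrow>\<^sub>E (UNIV :: nat set). (\<lambda>i\<in>{1..r}. real (m i)) \<in> bd_P r n \<inter> bd_Q r s
        \<and> (\<forall>i\<in>{1..r}. [m i = n i] (mod 2))}"
proof (rule Collect_cong)
  fix m :: "nat \<Rightarrow> nat"
  let ?x = "\<lambda>i\<in>{1..r}. real (m i)"
  have x: "?x i = real (m i)" "?x (prev i) = real (m (prev i))" if "i \<in> {1..r}" for i
    using that prev_in[OF that] by (simp_all del: atLeastAtMost_iff prev_in)
  have e: "int_ext n i = int (n i)" "ext0 s i = s i" if "i \<in> {1..r}" for i
    using that by (simp_all add: int_ext_def ext0_def del: atLeastAtMost_iff)
  have parity: "even (int a - int b) \<longleftrightarrow> [b = a] (mod 2)" for a b :: nat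
  proof -
    have "[b = a] (mod 2) \<longleftrightarrow> (even b \<longleftrightarrow> even a)" by (simp add: cong_def) presburger
    then show ?thesis by (auto simp: even_diff)
  qed
  have L: "m \<in> lattice_points (int_ext n) (ext0 s) \<longleftrightarrow> m \<in> {1..r} \<rightarrow>\<^sub>E UNIV
      \<and> (\<forall>i\<in>{1..r}. m i \<le> n i \<and> [m i = n i] (mod 2) \<and> triangle (m i) (m (prev i)) (s i))"
  proof -
    have "(\<forall>i\<in>{1..r}. int (m i) \<le> int_ext n i \<and> even (int_ext n i - int (m i)) \<and> triangle (m i) (m (prev i)) (ext0 s i))
      \<longleftrightarrow> (\<forall>i\<in>{1..r}. m i \<le> n i \<and> [m i = n i] (mod 2) \<and> triangle (m i) (m (prev i)) (s i))"
      by (rule ball_cong[OF refl]) (simp only: e parity of_nat_le_iff)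
    then show ?thesis unfolding lattice_points_def by blast
  qed
  have P: "?x \<in> bd_P r n \<longleftrightarrow> (\<forall>i\<in>{1..r}. m i \<le> n i) \<and> (\<exists>i\<in>{1..r}. m i = n i)"
  proof -
    have "?x \<in> P_poly r n \<longleftrightarrow> (\<forall>i\<in>{1..r}. m i \<le> n i)"
      unfolding P_poly_def by (auto simp: x)
    moreover have "(\<exists>i\<in>{1..r}. ?x i = real (n i)) \<longleftrightarrow> (\<exists>i\<in>{1..r}. m i = n i)"
      by (rule bex_cong[OF refl]) (simp only: x of_nat_eq_iff)
    ultimately show ?thesis unfolding bd_P_def by blast
  qed
  have Q: "?x \<in> bd_Q r s \<longleftrightarrow> (\<forall>i\<in>{1..r}. triangle (m i) (m (prev i)) (s i)) \<and> (\<exists>i\<in>{1..r}. m (prev i) + m i = s i)"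
  proof -
    have "(\<forall>i\<in>{1..r}. ?x (prev i) + ?x i - real (s i) \<ge> 0 \<and> ?x (prev i) - ?x i + real (s i) \<ge> 0
          \<and> - ?x (prev i) + ?x i + real (s i) \<ge> 0)
        \<longleftrightarrow> (\<forall>i\<in>{1..r}. triangle (m i) (m (prev i)) (s i))"
    proof (rule ball_cong[OF refl])
      fix i assume i: "i \<in> {1..r}"
      show "(?x (prev i) + ?x i - real (s i) \<ge> 0 \<and> ?x (prev i) - ?x i + real (s i) \<ge> 0
          \<and> - ?x (prev i) + ?x i + real (s i) \<ge> 0) \<longleftrightarrow> triangle (m i) (m (prev i)) (s i)"
        unfolding x[OF i] triangle_def by linarith
    qed
    then have "?x \<in> Q_poly r s \<longleftrightarrow> (\<forall>i\<in>{1..r}. triangle (m i) (m (prev i)) (s i))"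
      unfolding Q_poly_def mem_Collect_eq by (simp del: restrict_apply)
    moreover have "(\<exists>i\<in>{1..r}. ?x (prev i) + ?x i = real (s i)) \<longleftrightarrow> (\<exists>i\<in>{1..r}. m (prev i) + m i = s i)"
      by (rule bex_cong[OF refl]) (simp only: x of_nat_add[symmetric] of_nat_eq_iff)
    ultimately show ?thesis unfolding bd_Q_def by blast
  qed
  have "(\<exists>i\<in>{1..r}. int (m i) = int_ext n i) \<longleftrightarrow> (\<exists>i\<in>{1..r}. m i = n i)"
    by (rule bex_cong[OF refl]) (simp only: e of_nat_eq_iff)
  moreover have "(\<exists>i\<in>{1..r}. m (prev i) + m i = ext0 s i) \<longleftrightarrow> (\<exists>i\<in>{1..r}. m (prev i) + m i = s i)"
    by (rule bex_cong[OF refl]) (simp only: e)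
  ultimately show "(m \<in> lattice_points (int_ext n) (ext0 s) \<and> (\<exists>i\<in>{1..r}. int (m i) = int_ext n i)
        \<and> (\<exists>i\<in>{1..r}. m (prev i) + m i = ext0 s i))
      \<longleftrightarrow> (m \<in> {1..r} \<rightarrow>\<^sub>E UNIV \<and> ?x \<in> bd_P r n \<inter> bd_Q r s \<and> (\<forall>i\<in>{1..r}. [m i = n i] (mod 2)))"
    unfolding L Int_iff P Q by blast
qed

end

end

theorem theorem2:
  fixes G :: group_type and r :: nat
    and z :: "nat \<Rightarrow> int" and s n :: "nat \<Rightarrow> nat"
  assumes "r \<ge> 2"
    and "dim_Hom_K G r z s n > 0"
  shows "dim_Hom_K G r z s n =
    card {m \<in> {1..r} \<rightarrow>\<^sub>E (UNIV :: nat set).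
            (\<lambda>i\<in>{1..r}. real (m i)) \<in> bd_P r n \<inter> bd_Q r s \<and>
            (\<forall>i\<in>{1..r}. [m i = n i] (mod 2))}"
proof -
  interpret cyclic r by unfold_locales (rule assms(1))
  \<comment> \<open>A nonzero invariant has weight zero at each vertex, which is impossible if the
    total degree met there is odd.\<close>
  have even: "even (int_ext n i + int_ext n (prev i) + int (ext0 s i))" if i: "i \<in> {1..r}" for i
  proof (rule ccontr)
    assume odd: "odd (int_ext n i + int_ext n (prev i) + int (ext0 s i))"
    have nn: "int_ext n = (\<lambda>i. int (ext0 n i))"
      by (simp add: int_ext_def ext0_def fun_eq_iff)
    have "odd (total (ext0 n) (ext0 s) i)"
      using odd unfolding nn total_def by (simp flip: of_nat_add)
    then have "inv_space (int_ext n) (ext0 s) \<subseteq> {0}"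
      unfolding nn by (rule inv_space_odd[OF i])
    then show False using dim_Hom(2)[OF assms(2)] by (auto simp: harm_space_def)
  qed
  show ?thesis
    unfolding dim_Hom(1)[OF assms(2)] harm_points_eq[symmetric]
    by (rule dim_harm_space_count[OF supported_int_ext supported_ext0 even])
qed

end
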